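(* Let $(Q,\le_Q)$ be a nonempty countable better-quasi-ordering. With respect to continuous bi-embeddability (i.e. the equivalence relation $A\equiv B$ iff $A\preceq B$ and $B\preceq A$) there are exactly $\aleph_1$ many equivalence classes of $Q$-labeled countable closed linear orderings ($Q$-cclo's).
   Context: **Better-quasi-orderings.** A quasi-ordering is a reflexive transitive relation. For a finite $c\subseteq\mathbb{N}$ and any $d\subseteq\mathbb{N}$, $c$ is an initial segment of $d$ if $c=\{i\in d: i\le\max c\}$. An infinite set $B$ of finite subsets of $\mathbb{N}$ is a block if every infinite $X\subseteq\bigcup B$ has an initial segment in $B$; a block is a barrier if no two distinct elements of $B$ are comparable with respect to inclusion. For $b_1,b_2\in B$ write $b_1\vartriangleleft b_2$ if there are $i_1<i_2<\dots<i_m$ and $k$ with $1\le k<m$ such that $b_1=\{i_1,\dots,i_k\}$ and $b_2=\{i_2,\dots,i_m\}$. $Q$ is a better-quasi-ordering (bqo) if for every barrier $B$ and every $f:B\to Q$ there are $b_1,b_2\in B$ with $b_1\vartriangleleft b_2$ and $f(b_1)\le f(b_2)$. **$Q$-cclo's.** A countable closed linear ordering (cclo) is a countable closed subset of $\mathbb{R}$. A smc embedding (strictly monotone continuous embedding) between cclo's $V_1,V_2$ is a map $h:V_1\to V_2$ that is strictly increasing and such that whenever $p_n\in V_1$ converges in $\mathbb{R}$ to $p\in V_1$, then $h(p_n)$ converges to $h(p)$. A $Q$-cclo is a function $A$ whose domain $\operatorname{dom}A$ is a cclo and whose range is contained in $Q$. For $Q$-cclo's, $A\preceq B$ means that there is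 a smc embedding $h:\operatorname{dom}A\to\operatorname{dom}B$ with $A(a)\le_Q B(h(a))$ for all $a\in\operatorname{dom}A$. *)

theory Defs
  imports "HOL-Analysis.Analysis"
begin

unbundle cardinal_syntax

definition quasi_order_on :: "'q set \<Rightarrow> ('q \<Rightarrow> 'q \<Rightarrow> bool) \<Rightarrow> bool" where
  "quasi_order_on Q le \<longleftrightarrow> reflp_on Q le \<and> transp_on Q le"

text \<open>\<open>Max {}\<close> is unspecified, so the empty set is treated separately; it is an initial segment
  of every set.\<close>

definition initial_segment :: "nat set \<Rightarrow> nat set \<Rightarrow> bool" where
  "initial_segment c d \<longleftrightarrow> finite c \<and> c = {i \<in> d. c \<noteq> {} \<and> i \<le> Max c}"

definition block :: "nat set set \<Rightarrow> bool" where
  "block B \<longleftrightarrow> infinite B \<and> (\<forall>b\<in>B. finite b) \<and>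
     (\<forall>X. infinite X \<and> X \<subseteq> \<Union>B \<longrightarrow> (\<exists>b\<in>B. initial_segment b X))"

definition barrier :: "nat set set \<Rightarrow> bool" where
  "barrier B \<longleftrightarrow> block B \<and> (\<forall>b\<in>B. \<forall>c\<in>B. b \<noteq> c \<longrightarrow> \<not> b \<subseteq> c \<and> \<not> c \<subseteq> b)"

definition shift_rel :: "nat set \<Rightarrow> nat set \<Rightarrow> bool"  (infix \<open>\<lhd>\<^sub>s\<close> 50) where
  "b1 \<lhd>\<^sub>s b2 \<longleftrightarrow>
     (\<exists>(i :: nat \<Rightarrow> nat) m k. strict_mono_on {1..m} i \<and> 1 \<le> k \<and> k < m \<and>
        b1 = i ` {1..k} \<and> b2 = i ` {2..m})"

definition bqo_on :: "'q set \<Rightarrow> ('q \<Rightarrow> 'q \<Rightarrow> bool) \<Rightarrow> bool" where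
  "bqo_on Q le \<longleftrightarrow> quasi_order_on Q le \<and>
     (\<forall>B f. barrier B \<and> f ` B \<subseteq> Q \<longrightarrow>
        (\<exists>b1\<in>B. \<exists>b2\<in>B. b1 \<lhd>\<^sub>s b2 \<and> le (f b1) (f b2)))"

definition cclo :: "real set \<Rightarrow> bool" where
  "cclo V \<longleftrightarrow> countable V \<and> closed V"

definition smc_embedding :: "(real \<Rightarrow> real) \<Rightarrow> real set \<Rightarrow> real set \<Rightarrow> bool" where
  "smc_embedding h V1 V2 \<longleftrightarrow> h ` V1 \<subseteq> V2 \<and> strict_mono_on V1 h \<and>
     (\<forall>p x. (\<forall>n. p n \<in> V1) \<and> x \<in> V1 \<and> p \<longlonglongrightarrow> x \<longrightarrow> (\<lambda>n. h (p n)) \<longlonglongrightarrow> h x)"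

lemma smc_embedding_iff_continuous_on:
  "smc_embedding h V1 V2 \<longleftrightarrow> h ` V1 \<subseteq> V2 \<and> strict_mono_on V1 h \<and> continuous_on V1 h"
  unfolding smc_embedding_def continuous_on_sequentially comp_def by blast

text \<open>A partial function \<open>A :: real \<rightharpoonup> 'q\<close> is a total function on its domain \<open>dom A\<close>; two such
  maps are equal iff they have the same domain and the same labels on it.\<close>

definition Q_cclos :: "'q set \<Rightarrow> (real \<rightharpoonup> 'q) set" where
  "Q_cclos Q = {A. cclo (dom A) \<and> ran A \<subseteq> Q}"

definition cclo_le :: "('q \<Rightarrow> 'q \<Rightarrow> bool) \<Rightarrow> (real \<rightharpoonup> 'q) \<Rightarrow> (real \<rightharpoonup> 'q) \<Rightarrow> bool" where
  "cclo_le le A B \<longleftrightarrow>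
     (\<exists>h. smc_embedding h (dom A) (dom B) \<and> (\<forall>a\<in>dom A. le (the (A a)) (the (B (h a)))))"

definition cclo_equiv :: "'q set \<Rightarrow> ('q \<Rightarrow> 'q \<Rightarrow> bool) \<Rightarrow> ((real \<rightharpoonup> 'q) \<times> (real \<rightharpoonup> 'q)) set" where
  "cclo_equiv Q le = {(A, B). A \<in> Q_cclos Q \<and> B \<in> Q_cclos Q \<and> cclo_le le A B \<and> cclo_le le B A}"

lemma cclo_le_refl:
  assumes "quasi_order_on Q le" "A \<in> Q_cclos Q"
  shows "cclo_le le A A"
proof -
  have "le (the (A a)) (the (A a))" if "a \<in> dom A" for a
  proof -
    from that obtain q where "A a = Some q" by blast
    moreover from this have "q \<in> Q" using assms(2) by (auto simp: Q_cclos_def ran_def)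
    ultimately show ?thesis using assms(1) by (auto simp: quasi_order_on_def dest: reflp_onD)
  qed
  moreover have "smc_embedding id (dom A) (dom A)"
    by (auto simp: smc_embedding_def strict_mono_on_def)
  ultimately show ?thesis unfolding cclo_le_def by fastforce
qed

lemma cclo_le_trans:
  assumes Q: "quasi_order_on Q le"
    and mem: "A \<in> Q_cclos Q" "B \<in> Q_cclos Q" "C \<in> Q_cclos Q"
    and AB: "cclo_le le A B" and BC: "cclo_le le B C"
  shows "cclo_le le A C"
proof -
  have lab: "the (X a) \<in> Q" if "X \<in> Q_cclos Q" "a \<in> dom X" for X a
    using that by (auto simp: Q_cclos_def ran_def)
  from AB obtain h where h: "smc_embedding h (dom A) (dom B)"
    and hl: "\<And>a. a \<in> dom A \<Longrightarrow> le (the (A a)) (the (B (h a)))"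
    unfolding cclo_le_def by blast
  from BC obtain g where g: "smc_embedding g (dom B) (dom C)"
    and gl: "\<And>b. b \<in> dom B \<Longrightarrow> le (the (B b)) (the (C (g b)))"
    unfolding cclo_le_def by blast
  have hB: "h a \<in> dom B" if "a \<in> dom A" for a
    using h that unfolding smc_embedding_def by blast
  have gC: "g b \<in> dom C" if "b \<in> dom B" for b
    using g that unfolding smc_embedding_def by blast
  have "continuous_on (dom A) (g \<circ> h)"
    using h g unfolding smc_embedding_iff_continuous_on
    by (metis continuous_on_compose continuous_on_subset)
  moreover have "strict_mono_on (dom A) (g \<circ> h)"
    using h g hB unfolding smc_embedding_def strict_mono_on_def by simp
  ultimately have "smc_embedding (g \<circ> h) (dom A) (dom C)"
    using hB gC unfolding smc_embedding_iff_continuous_on by auto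
  moreover have "le (the (A a)) (the (C ((g \<circ> h) a)))" if a: "a \<in> dom A" for a
  proof -
    have "the (A a) \<in> Q" "the (B (h a)) \<in> Q" "the (C (g (h a))) \<in> Q"
      using lab mem a hB gC by blast+
    then show ?thesis
      using Q hl[OF a] gl[OF hB[OF a]] unfolding quasi_order_on_def comp_def
      by (blast dest: transp_onD)
  qed
  ultimately show ?thesis unfolding cclo_le_def by blast
qed

lemma equiv_cclo_equiv:
  assumes "quasi_order_on Q le"
  shows "equiv (Q_cclos Q) (cclo_equiv Q le)"
proof (rule equivI)
  show "cclo_equiv Q le \<subseteq> Q_cclos Q \<times> Q_cclos Q"
    by (auto simp: cclo_equiv_def)
  show "refl_on (Q_cclos Q) (cclo_equiv Q le)"
    using cclo_le_refl[OF assms] by (auto simp: cclo_equiv_def refl_on_def)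
  show "sym (cclo_equiv Q le)"
    by (auto simp: cclo_equiv_def sym_def)
  show "trans (cclo_equiv Q le)"
    using cclo_le_trans[OF assms] unfolding cclo_equiv_def trans_def by blast
qed

end

theory Submission
  imports Defs
begin

text \<open>
Lower bound: a strictly increasing map of a well-ordered set into itself cannot move a point down.
Given countably many well-ordered closed sets, placing them one after another yields a well-ordered
closed set that embeds in none of them, so the constantly labelled well-ordered sets alone lie in
uncountably many classes (\<open>uncountable_classes\<close>).

Upper bound: a countable compact set is scattered, and around a point \<open>p\<close> that is isolated among the
points not yet dealt with, it consists of \<open>p\<close>, an \<open>\<omega>\<close>-sequence of pieces converging to \<open>p\<close> from
the left (or nothing) and one from the right (or nothing). Iterating this describes a labelled set by a
well-founded term whose nodes carry a label of \<open>Q\<close> and two sequences of subterms. The terms are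
quasi-ordered by \<open>tle\<close>: \<open>s\<close> lies below \<open>t\<close> if it lies below an immediate subterm of \<open>t\<close>, or if the root
label increases and each left (right) subterm of \<open>s\<close> lies below a left (right) subterm of \<open>t\<close>. If each
subterm in a sequence lies below infinitely many members of the same sequence, which by wqo can be
achieved by dropping finitely many pieces, then \<open>tle s t\<close> implies that sets represented by \<open>s\<close> embed
in sets represented by \<open>t\<close>: the pieces on one side are sent one by one into later and later pieces, so
the limit points correspond and the map is continuous (\<open>rep_emb\<close>). Every countable compact labelled set
splits into finitely many represented pieces (\<open>decomposition\<close>), so its class is determined by a finite
list of terms up to equivalence. General cclo's are reduced to compact ones by applying \<open>arctan\<close> and
adding the end points \<open>-\<pi>/2\<close> and \<open>\<pi>/2\<close>; an embedding between two such sets restricts to the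
original sets because it maps interior points strictly between the images of the end points.

That the terms are well-quasi-ordered needs the full strength of bqo and is a minimal bad array
argument in the style of Nash-Williams. Arrays are taken as locally constant functions on the infinite
subsets of a set of naturals, \<open>f\<close> being bad if \<open>f X \<le> f (X - {min X})\<close> never holds. A barrier version
of badness is recovered from such an array through its minimal determining initial segments
(\<open>bqo_no_bad_array\<close>). A bad array of terms yields a minimal one (\<open>minimal_bad_array\<close>), and by Ramsey's
theorem for open sets (\<open>open_ramsey\<close>) this would have either a bad array of labels or a bad array of
immediate subterms below it (\<open>tle_no_bad_array\<close>).

Finally, order the terms by rank in \<open>\<omega>\<^sub>1\<close>. A countable wqo has only countably many downward closed
subsets, and a term is determined up to equivalence by its label and the downward closures of its two
sets of subterms; hence each rank contributes countably many classes and there are at most \<open>\<aleph>\<^sub>1\<close>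
in all (\<open>tm_classes_le_aleph1\<close>).
\<close>

section \<open>Ramsey theory of infinite sets of natural numbers\<close>

text \<open>\<open>f\<close> is locally constant on the infinite subsets of \<open>A\<close>: the value \<open>f X\<close> depends only on a finite
  initial part of \<open>X\<close>. This is continuity for the topology of initial segments and a discrete target;
  nothing is required of \<open>f\<close> outside the infinite subsets of \<open>A\<close>.\<close>

definition loc_const :: "nat set \<Rightarrow> (nat set \<Rightarrow> 'a) \<Rightarrow> bool" where
  "loc_const A f \<longleftrightarrow> (\<forall>X. infinite X \<and> X \<subseteq> A \<longrightarrow>
     (\<exists>n. \<forall>Y. infinite Y \<and> Y \<subseteq> A \<and> Y \<inter> {..<n} = X \<inter> {..<n} \<longrightarrow> f Y = f X))"

lemma loc_constD:
  assumes "loc_const A f" "infinite X" "X \<subseteq> A"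
  obtains n where "\<And>Y. infinite Y \<Longrightarrow> Y \<subseteq> A \<Longrightarrow> Y \<inter> {..<n} = X \<inter> {..<n} \<Longrightarrow> f Y = f X"
  using assms unfolding loc_const_def by meson

lemma loc_const_subset: "loc_const A f \<Longrightarrow> B \<subseteq> A \<Longrightarrow> loc_const B f"
  unfolding loc_const_def
proof (intro allI impI)
  fix X assume *: "\<forall>X. infinite X \<and> X \<subseteq> A \<longrightarrow> (\<exists>n. \<forall>Y. infinite Y \<and> Y \<subseteq> A \<and>
      Y \<inter> {..<n} = X \<inter> {..<n} \<longrightarrow> f Y = f X)" "B \<subseteq> A" and X: "infinite X \<and> X \<subseteq> B"
  then obtain n where "\<forall>Y. infinite Y \<and> Y \<subseteq> A \<and> Y \<inter> {..<n} = X \<inter> {..<n} \<longrightarrow> f Y = f X"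
    by (meson subset_trans)
  then show "\<exists>n. \<forall>Y. infinite Y \<and> Y \<subseteq> B \<and> Y \<inter> {..<n} = X \<inter> {..<n} \<longrightarrow> f Y = f X"
    using *(2) by (intro exI[of _ n]) auto
qed

lemma agree_below_mono:
  fixes X Y :: "nat set"
  assumes "Y \<inter> {..<n} = X \<inter> {..<n}" "m \<le> n"
  shows "Y \<inter> {..<m} = X \<inter> {..<m}"
proof -
  have "Z \<inter> {..<m} = Z \<inter> {..<n} \<inter> {..<m}" for Z :: "nat set" using assms(2) by auto
  then show ?thesis using assms(1) by metis
qed

lemma infinite_above: "infinite X \<Longrightarrow> infinite {x\<in>X. (n::nat) < x}"
proof -
  assume "infinite X"
  moreover have "X \<subseteq> {x\<in>X. n < x} \<union> {..n}" by auto
  ultimately show ?thesis by (meson finite_UnI finite_atMost finite_subset)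
qed

lemma infinite_above_set:
  assumes "infinite X" "finite (s::nat set)" shows "infinite {x\<in>X. \<forall>y\<in>s. y < x}"
proof -
  obtain n where "\<forall>y\<in>s. y \<le> n" using assms(2) finite_nat_set_iff_bounded_le by blast
  then have "{x\<in>X. n < x} \<subseteq> {x\<in>X. \<forall>y\<in>s. y < x}" by auto
  then show ?thesis using infinite_above[OF assms(1)] finite_subset by blast
qed

lemma Inf_nat_mem: "infinite (X::nat set) \<Longrightarrow> Inf X \<in> X"
  by (metis Inf_nat_def1 finite.emptyI)

lemma Inf_nat_le: "x \<in> X \<Longrightarrow> Inf X \<le> (x::nat)"
  by (simp add: cInf_lower)

lemma Inf_agree_below:
  fixes X Y :: "nat set"
  assumes "infinite X" "infinite Y" "Y \<inter> {..<n} = X \<inter> {..<n}" "Inf X < n"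
  shows "Inf Y = Inf X"
proof -
  have "Inf X \<in> X \<inter> {..<n}" using Inf_nat_mem[OF assms(1)] assms(4) by simp
  then have le: "Inf Y \<le> Inf X" using Inf_nat_le[of _ Y] unfolding assms(3)[symmetric] by simp
  then have "Inf Y \<in> Y \<inter> {..<n}" using Inf_nat_mem[OF assms(2)] assms(4) by simp
  then have "Inf X \<le> Inf Y" using Inf_nat_le[of _ X] unfolding assms(3) by simp
  with le show ?thesis by simp
qed

text \<open>Diagonalisation: if a hereditary property of (stem, reservoir) can be forced for each single
  stem by shrinking the reservoir, then a single infinite set forces it for all of its own finite
  subsets, with the elements above the stem as reservoir.\<close>

lemma fusion:
  fixes P :: "nat set \<Rightarrow> nat set \<Rightarrow> bool"
  assumes A: "infinite A"
    and shrink: "\<And>s N. finite s \<Longrightarrow> infinite N \<Longrightarrow> N \<subseteq> A \<Longrightarrow> \<exists>M\<subseteq>N. infinite M \<and> P s M"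
    and hered: "\<And>s N M. P s N \<Longrightarrow> M \<subseteq> N \<Longrightarrow> infinite M \<Longrightarrow> P s M"
  obtains B where "infinite B" "B \<subseteq> A" "\<And>s. finite s \<Longrightarrow> s \<subseteq> B \<Longrightarrow> P s {x\<in>B. \<forall>y\<in>s. y < x}"
proof -
  have many: "\<exists>M\<subseteq>N. infinite M \<and> (\<forall>s\<in>S. P s M)"
    if "finite S" "\<And>s. s \<in> S \<Longrightarrow> finite s" "infinite N" "N \<subseteq> A" for S N
    using that
  proof (induction S arbitrary: N rule: finite_induct)
    case empty then show ?case by auto
  next
    case (insert s S)
    obtain M where M: "M \<subseteq> N" "infinite M" "P s M" using shrink insert by (meson insertI1)
    obtain M' where M': "M' \<subseteq> M" "infinite M'" "\<forall>s\<in>S. P s M'"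
      using insert.IH[of M] M insert.prems by (meson insertI2 subset_trans)
    show ?case
      using M M' hered by (intro exI[of _ M']) auto
  qed
  have "\<exists>f. \<forall>n. (infinite (f n) \<and> f n \<subseteq> A \<and> (n = 0 \<longrightarrow> P {} (f n))) \<and>
      (f (Suc n) \<subseteq> {x\<in>f n. Inf (f n) < x} \<and> (\<forall>s. s \<subseteq> {..Inf (f n)} \<longrightarrow> P s (f (Suc n))))"
  proof (rule dependent_nat_choice, goal_cases)
    case 1
    then show ?case using shrink[of "{}" A] A by auto
  next
    case (2 N n)
    obtain M where M: "M \<subseteq> {x\<in>N. Inf N < x}" "infinite M" "\<forall>s\<in>Pow {..Inf N}. P s M"
      using many[of "Pow {..Inf N}" "{x\<in>N. Inf N < x}"] 2 infinite_above[of N "Inf N"]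
      by (force intro: finite_subset[of _ "{..Inf N}"])
    then show ?case using 2 by (intro exI[of _ M]) auto
  qed
  then obtain f where F: "\<forall>n. (infinite (f n) \<and> f n \<subseteq> A \<and> (n = 0 \<longrightarrow> P {} (f n))) \<and>
      (f (Suc n) \<subseteq> {x\<in>f n. Inf (f n) < x} \<and> (\<forall>s. s \<subseteq> {..Inf (f n)} \<longrightarrow> P s (f (Suc n))))" ..
  have inf: "infinite (f n)" and sub: "f n \<subseteq> A" and step: "f (Suc n) \<subseteq> {x\<in>f n. Inf (f n) < x}"
    and PS: "s \<subseteq> {..Inf (f n)} \<Longrightarrow> P s (f (Suc n))" for n s
    using F[rule_format, of n] by auto
  have P0: "P {} (f 0)" using F by auto
  define a where "a n = Inf (f n)" for n
  have af: "a n \<in> f n" for n unfolding a_def by (rule Inf_nat_mem[OF inf])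
  have dec: "f m \<subseteq> f n" if "n \<le> m" for n m
    by (rule lift_Suc_antimono_le[of f, OF _ that]) (use step in blast)
  have "a n < a (Suc n)" for n
    using af[of "Suc n"] step[of n] unfolding a_def by auto
  then have mono: "strict_mono a"
    by (simp add: strict_mono_Suc_iff)
  have infB: "infinite (range a)"
    by (rule range_inj_infinite) (rule strict_mono_imp_inj_on[OF mono])
  show thesis
  proof (rule that[of "range a"])
    show "range a \<subseteq> A" using af sub by blast
    fix s assume s: "finite s" "s \<subseteq> range a"
    let ?N = "{x\<in>range a. \<forall>y\<in>s. y < x}"
    have infN: "infinite ?N" by (rule infinite_above_set[OF infB s(1)])
    show "P s ?N"
    proof (cases "s = {}")
      case True
      have "range a \<subseteq> f 0" using af dec by blast
      then have "?N \<subseteq> f 0" by auto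
      then show ?thesis using hered[OF P0 _ infN] True by blast
    next
      case False
      then have "Max s \<in> s" using s by simp
      then obtain n where n: "Max s = a n" using s by blast
      have "s \<subseteq> {..Inf (f n)}" using n s(1) unfolding a_def by (metis Max_ge atMost_iff subsetI)
      moreover have "?N \<subseteq> f (Suc n)"
      proof
        fix x assume x: "x \<in> ?N"
        then obtain m where m: "x = a m" by auto
        have "a n < a m" using x m n \<open>Max s \<in> s\<close> by auto
        then have "n < m" using mono strict_mono_less by blast
        then show "x \<in> f (Suc n)" using af[of m] dec[of "Suc n" m] m by auto
      qed
      ultimately show ?thesis using hered[OF PS] infN by blast
    qed
  qed (rule infB)
qed

text \<open>Open sets are Ramsey (Nash-Williams). A reservoir \<open>N\<close> accepts a stem \<open>s\<close> if all extensions of \<open>s\<close>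
  into \<open>N\<close> satisfy \<open>P\<close>, and rejects it if no infinite subset of \<open>N\<close> accepts it.\<close>

lemma open_ramsey:
  fixes P :: "nat set \<Rightarrow> bool"
  assumes A: "infinite A"
    and opn: "\<And>X. infinite X \<Longrightarrow> X \<subseteq> A \<Longrightarrow> P X \<Longrightarrow>
      \<exists>n. \<forall>Y. infinite Y \<and> Y \<subseteq> A \<and> Y \<inter> {..<n} = X \<inter> {..<n} \<longrightarrow> P Y"
  obtains B where "infinite B" "B \<subseteq> A"
    "(\<forall>X\<subseteq>B. infinite X \<longrightarrow> P X) \<or> (\<forall>X\<subseteq>B. infinite X \<longrightarrow> \<not> P X)"
proof -
  define acc where "acc s N \<longleftrightarrow> (\<forall>X\<subseteq>N. infinite X \<and> (\<forall>x\<in>X. \<forall>y\<in>s. y < x) \<longrightarrow> P (s \<union> X))" for s N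
  define rej where "rej s N \<longleftrightarrow> (\<forall>M\<subseteq>N. infinite M \<longrightarrow> \<not> acc s M)" for s N
  have acc_mono: "acc s M" if "acc s N" "M \<subseteq> N" for s M N
    using that unfolding acc_def by (meson subset_trans)
  have rej_mono: "rej s M" if "rej s N" "M \<subseteq> N" for s M N
    using that unfolding rej_def by (meson subset_trans)
  have acc_above: "acc s N" if "acc s {x\<in>N. \<forall>y\<in>s. y < x}" for s N
    unfolding acc_def
  proof (intro allI impI)
    fix X assume X: "X \<subseteq> N" "infinite X \<and> (\<forall>x\<in>X. \<forall>y\<in>s. y < x)"
    then have "X \<subseteq> {x\<in>N. \<forall>y\<in>s. y < x}" by auto
    then show "P (s \<union> X)" using that X(2) unfolding acc_def by simp
  qed
  have rej_above: "rej s N" if r: "rej s {x\<in>N. \<forall>y\<in>s. y < x}" and s: "finite s" for s N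
    unfolding rej_def
  proof (intro allI impI notI)
    fix M assume M: "M \<subseteq> N" "infinite M" "acc s M"
    have "infinite {x\<in>M. \<forall>y\<in>s. y < x}" by (rule infinite_above_set[OF M(2) s])
    moreover have "{x\<in>M. \<forall>y\<in>s. y < x} \<subseteq> {x\<in>N. \<forall>y\<in>s. y < x}" using M by auto
    moreover have "acc s {x\<in>M. \<forall>y\<in>s. y < x}" using M(3) by (rule acc_mono) auto
    ultimately show False using r unfolding rej_def by blast
  qed
  obtain B where B: "infinite B" "B \<subseteq> A"
    and decB: "\<And>s. finite s \<Longrightarrow> s \<subseteq> B \<Longrightarrow> acc s B \<or> rej s B"
  proof (rule fusion[OF A, of "\<lambda>s N. acc s N \<or> rej s N"], goal_cases)
    case (1 s N)
    show ?case
    proof (cases "rej s N")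
      case True
      then show ?thesis using 1 by auto
    next
      case False
      then obtain M where "M \<subseteq> N" "infinite M" "acc s M" unfolding rej_def by auto
      then show ?thesis by auto
    qed
  next
    case (2 s N M)
    then show ?case using acc_mono[of s N M] rej_mono[of s N M] by auto
  next
    case (3 B)
    show ?case
    proof (rule that[OF 3(2,3)])
      fix s assume s: "finite s" "s \<subseteq> B"
      then show "acc s B \<or> rej s B" using 3(4)[OF s] acc_above rej_above[of s B] by auto
    qed
  qed
  show thesis
  proof (cases "acc {} B")
    case True
    then have "\<forall>X\<subseteq>B. infinite X \<longrightarrow> P X" unfolding acc_def by simp
    then show ?thesis using that[of B] B by simp
  next
    case False
    then have rej0: "rej {} B" using decB by blast
    \<comment> \<open>If \<open>s\<close> is rejected, then so are almost all of its one-point extensions: otherwise the accepted ones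
    would assemble to a reservoir accepting \<open>s\<close>.\<close>
    obtain C where C: "infinite C" "C \<subseteq> B"
      and stepC: "\<And>s n. finite s \<Longrightarrow> s \<subseteq> C \<Longrightarrow> rej s B \<Longrightarrow> n \<in> C \<Longrightarrow> \<forall>y\<in>s. y < n \<Longrightarrow> rej (insert n s) B"
    proof (rule fusion[OF B(1), of "\<lambda>s N. s \<subseteq> B \<longrightarrow> rej s B \<longrightarrow> (\<forall>n\<in>N. (\<forall>y\<in>s. y < n) \<longrightarrow> rej (insert n s) B)"],
        goal_cases)
      case (1 s N)
      show ?case
      proof (cases "s \<subseteq> B \<and> rej s B")
        case True
        define M where "M = {n\<in>N. (\<forall>y\<in>s. y < n) \<and> \<not> rej (insert n s) B}"
        have "acc s M"
          unfolding acc_def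
        proof (intro allI impI)
          fix X assume X: "X \<subseteq> M" "infinite X \<and> (\<forall>x\<in>X. \<forall>y\<in>s. y < x)"
          define n where "n = Inf X"
          have nX: "n \<in> X" using X Inf_nat_mem n_def by blast
          then have "\<not> rej (insert n s) B" using X M_def by auto
          then have "acc (insert n s) B" using decB[of "insert n s"] nX X True 1 M_def by auto
          moreover have "X - {n} \<subseteq> B" using X M_def 1 by auto
          moreover have "\<forall>x\<in>X - {n}. \<forall>y\<in>insert n s. y < x"
            using X Inf_nat_le[of _ X] unfolding n_def by (metis DiffE insert_iff le_neq_implies_less)
          ultimately have "P (insert n s \<union> (X - {n}))" using X unfolding acc_def by auto
          moreover have "insert n s \<union> (X - {n}) = s \<union> X" using nX by auto
          ultimately show "P (s \<union> X)" by simp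
        qed
        moreover have "M \<subseteq> B" using 1 by (auto simp: M_def)
        ultimately have "finite M" using True unfolding rej_def by auto
        then have "infinite (N - M)" using 1 by (simp add: Diff_infinite_finite)
        then show ?thesis by (intro exI[of _ "N - M"]) (auto simp: M_def)
      qed (use 1 in auto)
    next
      case (2 s N M)
      then show ?case by (meson subsetD)
    next
      case (3 C)
      show ?case
      proof (rule that[OF 3(2,3)])
        fix s n assume s: "finite s" "s \<subseteq> C" and n: "rej s B" "n \<in> C" "\<forall>y\<in>s. y < n"
        have "s \<subseteq> B" using s(2) 3(3) by (rule subset_trans)
        then show "rej (insert n s) B" using 3(4)[OF s] n by auto
      qed
    qed
    have rejC: "rej s B" if "finite s" "s \<subseteq> C" for s
      using that
    proof (induction s rule: finite_linorder_max_induct)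
      case empty then show ?case using rej0 by simp
    next
      case (insert n s)
      then show ?case using stepC[of s n] by auto
    qed
    have "\<not> P X" if X: "X \<subseteq> C" "infinite X" for X
    proof
      assume "P X"
      have "X \<subseteq> A" using X C B by auto
      from opn[OF X(2) this \<open>P X\<close>]
      obtain n where n: "\<And>Y. infinite Y \<Longrightarrow> Y \<subseteq> A \<Longrightarrow> Y \<inter> {..<n} = X \<inter> {..<n} \<Longrightarrow> P Y"
        by auto
      define s where "s = X \<inter> {..<n}"
      have "acc s {x\<in>C. n < x}"
        unfolding acc_def
      proof (intro allI impI)
        fix Z assume Z: "Z \<subseteq> {x\<in>C. n < x}" "infinite Z \<and> (\<forall>x\<in>Z. \<forall>y\<in>s. y < x)"
        have "infinite (s \<union> Z)" using Z by simp
        moreover have "s \<union> Z \<subseteq> A" using Z X C B by (auto simp: s_def)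
        moreover have "(s \<union> Z) \<inter> {..<n} = X \<inter> {..<n}" using Z by (auto simp: s_def)
        ultimately show "P (s \<union> Z)" by (rule n)
      qed
      moreover have "infinite {x\<in>C. n < x}" using C(1) by (rule infinite_above)
      moreover have "rej s B" by (rule rejC) (use X in \<open>auto simp: s_def\<close>)
      moreover have "{x\<in>C. n < x} \<subseteq> B" using C by auto
      ultimately show False unfolding rej_def by auto
    qed
    moreover have "C \<subseteq> A" using C B by auto
    ultimately show ?thesis using that[of C] C by auto
  qed
qed

lemma loc_const_ramsey:
  assumes A: "infinite A" and f: "loc_const A f"
  obtains B where "infinite B" "B \<subseteq> A"
    "(\<forall>X\<subseteq>B. infinite X \<longrightarrow> R (f X)) \<or> (\<forall>X\<subseteq>B. infinite X \<longrightarrow> \<not> R (f X))"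
proof (rule open_ramsey[OF A, of "\<lambda>X. R (f X)"], goal_cases)
  case (1 X)
  then show ?case using loc_constD[OF f 1(2,3)] by metis
qed (use that in auto)

text \<open>An eventually constant pointwise limit of locally constant functions need not be locally constant,
  but it is so on the infinite subsets of some smaller set. For a stem \<open>s\<close>, the sets \<open>Z\<close> for which
  \<open>f n (s \<union> Z)\<close> is constant from \<open>n = min Z\<close> on form a closed set, to which the open Ramsey theorem
  applies. A stem \<open>s\<close> of \<open>X\<close> that is long compared with the stabilisation index of \<open>X\<close> must fall on the
  constant side, and there the limit equals \<open>f (min Z) (s \<union> Z)\<close>.\<close>

lemma loc_const_limit:
  fixes f :: "nat \<Rightarrow> nat set \<Rightarrow> 'a"
  assumes A: "infinite A" and f: "\<And>n. loc_const A (f n)"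
    and lim: "\<And>X. infinite X \<Longrightarrow> X \<subseteq> A \<Longrightarrow> \<exists>N. \<forall>n\<ge>N. f n X = g X"
  obtains B where "infinite B" "B \<subseteq> A" "loc_const B g"
proof -
  define E where "E s Z \<longleftrightarrow> (\<forall>n\<ge>Inf Z. f n (s \<union> Z) = f (Inf Z) (s \<union> Z))" for s Z
  define above where "above s (N::nat set) = {x\<in>N. \<forall>y\<in>s. y < x}" for s N
  define H where "H s N \<longleftrightarrow> s \<subseteq> A \<longrightarrow> N \<subseteq> A \<and>
      ((\<forall>Z. infinite Z \<and> Z \<subseteq> above s N \<longrightarrow> \<not> E s Z) \<or> (\<forall>Z. infinite Z \<and> Z \<subseteq> above s N \<longrightarrow> E s Z))" for s N
  have above_mono: "above s M \<subseteq> above s N" if "M \<subseteq> N" for s M N using that above_def by auto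
  have above_above: "above s (above s N) = above s N" for s N by (auto simp: above_def)
  obtain B where B: "infinite B" "B \<subseteq> A" and hom: "\<And>s. finite s \<Longrightarrow> s \<subseteq> B \<Longrightarrow> H s (above s B)"
  proof (rule fusion[OF A, of H], goal_cases)
    case (1 s N)
    show ?case
    proof (cases "s \<subseteq> A")
      case True
      have infN: "infinite (above s N)" unfolding above_def using 1 by (intro infinite_above_set)
      obtain M where M: "infinite M" "M \<subseteq> above s N"
        "(\<forall>Z\<subseteq>M. infinite Z \<longrightarrow> \<not> E s Z) \<or> (\<forall>Z\<subseteq>M. infinite Z \<longrightarrow> \<not> \<not> E s Z)"
      proof (rule open_ramsey[OF infN, of "\<lambda>Z. \<not> E s Z"], goal_cases)
        case (1 X)
        then obtain n where n: "n \<ge> Inf X" "f n (s \<union> X) \<noteq> f (Inf X) (s \<union> X)"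
          unfolding E_def by blast
        have sX: "infinite (s \<union> X)" "s \<union> X \<subseteq> A"
          using 1 True \<open>N \<subseteq> A\<close> by (auto simp: above_def)
        obtain k1 where k1: "\<And>Y. infinite Y \<Longrightarrow> Y \<subseteq> A \<Longrightarrow> Y \<inter> {..<k1} = (s \<union> X) \<inter> {..<k1} \<Longrightarrow> f n Y = f n (s \<union> X)"
          using loc_constD[OF f sX] by blast
        obtain k2 where k2: "\<And>Y. infinite Y \<Longrightarrow> Y \<subseteq> A \<Longrightarrow> Y \<inter> {..<k2} = (s \<union> X) \<inter> {..<k2} \<Longrightarrow> f (Inf X) Y = f (Inf X) (s \<union> X)"
          using loc_constD[OF f sX] by blast
        define k where "k = max (max k1 k2) (Suc (Inf X))"
        show ?case
        proof (intro exI[of _ k] allI impI)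
          fix Y assume Y: "infinite Y \<and> Y \<subseteq> above s N \<and> Y \<inter> {..<k} = X \<inter> {..<k}"
          have InfY: "Inf Y = Inf X"
            using Inf_agree_below[of X Y k] Y 1 by (auto simp: k_def)
          have sY: "infinite (s \<union> Y)" "s \<union> Y \<subseteq> A" using Y True \<open>N \<subseteq> A\<close> by (auto simp: above_def)
          have "(s \<union> Y) \<inter> {..<k} = (s \<union> X) \<inter> {..<k}" using Y by blast
          then have "f n (s \<union> Y) = f n (s \<union> X)" "f (Inf X) (s \<union> Y) = f (Inf X) (s \<union> X)"
            by (intro k1 k2 sY; rule agree_below_mono; simp add: k_def)+
          then show "\<not> E s Y" using n InfY unfolding E_def by metis
        qed
      qed (use that in blast)
      have "above s M \<subseteq> M" "M \<subseteq> N" "M \<subseteq> A" using M(2) 1 by (auto simp: above_def)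
      then show ?thesis using M 1 unfolding H_def by (intro exI[of _ M]) blast
    qed (use 1 in \<open>auto simp: H_def\<close>)
  next
    case (2 s N M)
    then show ?case unfolding H_def using above_mono[of M N s] by (meson subset_trans)
  qed (use that above_def in auto)
  have "loc_const B g"
    unfolding loc_const_def
  proof (intro allI impI)
    fix X assume X: "infinite X \<and> X \<subseteq> B"
    obtain N where N: "\<And>n. n \<ge> N \<Longrightarrow> f n X = g X" using lim[of X] X B by auto
    define s where "s = X \<inter> {..<N}"
    define Z where "Z = X - {..<N}"
    have XsZ: "s \<union> Z = X" by (auto simp: s_def Z_def)
    have "infinite Z" using X by (simp add: Z_def Diff_infinite_finite)
    moreover have "Z \<subseteq> above s B" using X by (auto simp: s_def Z_def above_def)
    ultimately have Z: "infinite Z" "Z \<subseteq> above s B" by auto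
    have "Inf Z \<ge> N" using Inf_nat_mem[OF Z(1)] by (auto simp: Z_def)
    then have "E s Z" unfolding E_def XsZ using N by auto
    moreover have "finite s" "s \<subseteq> B" using X by (auto simp: s_def)
    ultimately have allE: "E s Y" if "infinite Y" "Y \<subseteq> above s B" for Y
      using hom[of s] B Z that unfolding H_def above_above by blast
    have gE: "g (s \<union> Y) = f (Inf Y) (s \<union> Y)" if "infinite Y" "Y \<subseteq> above s B" for Y
    proof -
      have "s \<union> Y \<subseteq> A" "infinite (s \<union> Y)" using that B \<open>s \<subseteq> B\<close> by (auto simp: above_def)
      from lim[OF this(2,1)] obtain M where M: "\<And>n. n \<ge> M \<Longrightarrow> f n (s \<union> Y) = g (s \<union> Y)"
        by blast
      show ?thesis using allE[OF that] M[of "max M (Inf Y)"] unfolding E_def by (metis max.cobounded1 max.cobounded2)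
    qed
    have "X \<subseteq> A" using X B by blast
    then obtain k where k: "\<And>Y. infinite Y \<Longrightarrow> Y \<subseteq> A \<Longrightarrow> Y \<inter> {..<k} = X \<inter> {..<k} \<Longrightarrow> f (Inf Z) Y = f (Inf Z) X"
      using loc_constD[OF f, of X] X by blast
    define m where "m = max (max N k) (Suc (Inf Z))"
    show "\<exists>n. \<forall>Y. infinite Y \<and> Y \<subseteq> B \<and> Y \<inter> {..<n} = X \<inter> {..<n} \<longrightarrow> g Y = g X"
    proof (intro exI[of _ m] allI impI)
      fix Y assume Y: "infinite Y \<and> Y \<subseteq> B \<and> Y \<inter> {..<m} = X \<inter> {..<m}"
      define Z' where "Z' = Y - {..<N}"
      have Ys: "Y \<inter> {..<N} = s" unfolding s_def
        by (rule agree_below_mono[of _ m]) (use Y in \<open>simp_all add: m_def\<close>)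
      then have YsZ: "s \<union> Z' = Y" by (auto simp: Z'_def)
      have "infinite Z'" using Y by (simp add: Z'_def Diff_infinite_finite)
      moreover have "Z' \<subseteq> above s B" using Y by (auto simp: s_def Z'_def above_def)
      ultimately have Z': "infinite Z'" "Z' \<subseteq> above s B" by auto
      have "Y \<inter> {..<m} = X \<inter> {..<m}" using Y by simp
      then have "Z' \<inter> {..<m} = Z \<inter> {..<m}" unfolding Z'_def Z_def by (metis Diff_Int_distrib2)
      then have "Inf Z' = Inf Z" using Inf_agree_below[of Z Z' m] Z Z' by (auto simp: m_def)
      moreover have "f (Inf Z) Y = f (Inf Z) X"
      proof (rule k)
        show "Y \<inter> {..<k} = X \<inter> {..<k}"
          by (rule agree_below_mono[of _ m]) (use Y in \<open>simp_all add: m_def\<close>)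
      qed (use Y B in auto)
      ultimately show "g Y = g X" using gE[OF Z] gE[OF Z'] unfolding XsZ YsZ by simp
    qed
  qed
  with B show ?thesis by (rule that)
qed

section \<open>Minimal bad arrays\<close>

text \<open>Bad arrays. For infinite \<open>X\<close>, the set \<open>X - {Inf X}\<close> plays the role of the shift.\<close>

definition bad_array :: "('t \<Rightarrow> 't \<Rightarrow> bool) \<Rightarrow> nat set \<Rightarrow> (nat set \<Rightarrow> 't) \<Rightarrow> bool" where
  "bad_array le A f \<longleftrightarrow> infinite A \<and> loc_const A f \<and>
     (\<forall>X. infinite X \<and> X \<subseteq> A \<longrightarrow> \<not> le (f X) (f (X - {Inf X})))"

lemma bad_arrayD:
  assumes "bad_array le A f"
  shows "infinite A" "loc_const A f" "infinite X \<Longrightarrow> X \<subseteq> A \<Longrightarrow> \<not> le (f X) (f (X - {Inf X}))"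
  using assms unfolding bad_array_def by auto

text \<open>A well-founded strict order \<open>lt\<close> such that passing to an \<open>lt\<close>-larger right-hand side preserves \<open>le\<close>;
  for terms, \<open>lt\<close> is the proper subterm relation.\<close>

locale compatible_ranking =
  fixes le lt :: "'t \<Rightarrow> 't \<Rightarrow> bool"
  assumes wf_lt: "wfp lt" and trans_lt: "lt x y \<Longrightarrow> lt y z \<Longrightarrow> lt x z"
    and compat: "le x z \<Longrightarrow> lt z y \<Longrightarrow> le x y"
begin

text \<open>\<open>(D, g)\<close> improves \<open>(A, f)\<close>: it is again a bad array, on a smaller set that retains all elements of
  \<open>A\<close> below \<open>m\<close>, and its values do not increase.\<close>

definition ext :: "nat \<Rightarrow> nat set \<Rightarrow> (nat set \<Rightarrow> 't) \<Rightarrow> nat set \<Rightarrow> (nat set \<Rightarrow> 't) \<Rightarrow> bool" where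
  "ext m A f D g \<longleftrightarrow> bad_array le D g \<and> D \<subseteq> A \<and> A \<inter> {..<m} \<subseteq> D \<and>
     (\<forall>X. infinite X \<and> X \<subseteq> D \<longrightarrow> lt\<^sup>=\<^sup>= (g X) (f X))"

text \<open>No improvement that retains the elements below \<open>m\<close> brings all values on the sets with stem \<open>s\<close>
  strictly below one of the present values on that stem.\<close>

definition frozen :: "nat \<Rightarrow> nat set \<Rightarrow> nat set \<Rightarrow> (nat set \<Rightarrow> 't) \<Rightarrow> bool" where
  "frozen m s A f \<longleftrightarrow> (\<forall>D g X. ext m A f D g \<and> infinite X \<and> X \<subseteq> A \<and> X \<inter> {..<m} = s \<longrightarrow>
     \<not> (\<forall>Y. infinite Y \<and> Y \<subseteq> D \<and> Y \<inter> {..<m} = s \<longrightarrow> lt (g Y) (f X)))"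

lemma lteq_trans: "lt\<^sup>=\<^sup>= x y \<Longrightarrow> lt\<^sup>=\<^sup>= y z \<Longrightarrow> lt\<^sup>=\<^sup>= x z"
  using trans_lt by auto

lemma ext_refl: "bad_array le A f \<Longrightarrow> ext m A f A f"
  unfolding ext_def by auto

lemma ext_trans:
  assumes 1: "ext m A f B g" and 2: "ext n B g C h" and le: "m \<le> n"
  shows "ext m A f C h"
  unfolding ext_def
proof (intro conjI allI impI)
  show "bad_array le C h" "C \<subseteq> A" using 1 2 unfolding ext_def by auto
  show "A \<inter> {..<m} \<subseteq> C"
  proof
    fix x assume "x \<in> A \<inter> {..<m}"
    then have "x \<in> B \<inter> {..<n}" using 1 le unfolding ext_def by auto
    then show "x \<in> C" using 2 unfolding ext_def by auto
  qed
  fix X assume X: "infinite X \<and> X \<subseteq> C"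
  then have "X \<subseteq> B" using 2 unfolding ext_def by auto
  then have "lt\<^sup>=\<^sup>= (g X) (f X)" "lt\<^sup>=\<^sup>= (h X) (g X)" using X 1 2 unfolding ext_def by auto
  then show "lt\<^sup>=\<^sup>= (h X) (f X)" by (meson lteq_trans)
qed

lemma frozen_ext:
  assumes fr: "frozen m s A f" and e: "ext m A f B g"
  shows "frozen m s B g"
  unfolding frozen_def
proof (intro allI impI notI)
  fix D h X
  assume X: "ext m B g D h \<and> infinite X \<and> X \<subseteq> B \<and> X \<inter> {..<m} = s"
    and lt: "\<forall>Y. infinite Y \<and> Y \<subseteq> D \<and> Y \<inter> {..<m} = s \<longrightarrow> lt (h Y) (g X)"
  have "lt\<^sup>=\<^sup>= (g X) (f X)" "X \<subseteq> A" using e X unfolding ext_def by auto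
  then have "\<forall>Y. infinite Y \<and> Y \<subseteq> D \<and> Y \<inter> {..<m} = s \<longrightarrow> lt (h Y) (f X)"
    using lt trans_lt by (auto simp: sup_fun_def)
  moreover have "ext m A f D h" using ext_trans[OF e, of m D h] X by auto
  moreover have "infinite X" "X \<inter> {..<m} = s" using X by auto
  ultimately show False using fr[unfolded frozen_def, rule_format, of D h X] \<open>X \<subseteq> A\<close> by auto
qed

text \<open>Otherwise the values that bound some improvement strictly from above on the stem \<open>s\<close> would form a
  nonempty set without a minimal element.\<close>

lemma ex_frozen:
  assumes f: "bad_array le A f"
  shows "\<exists>D g. ext m A f D g \<and> frozen m s D g"
proof (rule ccontr)
  assume no: "\<not> ?thesis"
  define S where "S = {v. \<exists>D g. ext m A f D g \<and>
      (\<forall>Y. infinite Y \<and> Y \<subseteq> D \<and> Y \<inter> {..<m} = s \<longrightarrow> lt (g Y) v)}"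
  have step: "\<exists>X. X \<subseteq> D \<and> infinite X \<and> X \<inter> {..<m} = s \<and> g X \<in> S" if e: "ext m A f D g" for D g
  proof -
    have "\<not> frozen m s D g" using no e by auto
    then obtain D' g' X where X: "ext m D g D' g'" "infinite X" "X \<subseteq> D" "X \<inter> {..<m} = s"
      "\<forall>Y. infinite Y \<and> Y \<subseteq> D' \<and> Y \<inter> {..<m} = s \<longrightarrow> lt (g' Y) (g X)"
      unfolding frozen_def by metis
    have "ext m A f D' g'" using ext_trans[OF e X(1)] by simp
    then have "g X \<in> S"
      unfolding S_def using X(5) by (intro CollectI exI[of _ D'] exI[of _ g'] conjI)
    then show ?thesis using X(2-4) by (intro exI[of _ X] conjI)
  qed
  have "S \<noteq> {}" using step[OF ext_refl[OF f]] by auto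
  then obtain v where v: "v \<in> S" "\<And>w. lt w v \<Longrightarrow> w \<notin> S"
    using wf_lt unfolding wfp_eq_minimal by (metis all_not_in_conv)
  then obtain D g where e: "ext m A f D g"
    and lt: "\<And>Y. infinite Y \<Longrightarrow> Y \<subseteq> D \<Longrightarrow> Y \<inter> {..<m} = s \<Longrightarrow> lt (g Y) v" unfolding S_def by auto
  obtain X where "X \<subseteq> D" "infinite X" "X \<inter> {..<m} = s" "g X \<in> S" using step[OF e] by auto
  then show False using lt[of X] v(2)[of "g X"] by simp
qed

lemma ex_all_frozen:
  assumes f: "bad_array le A f" and S: "finite S"
  shows "\<exists>D g. ext m A f D g \<and> (\<forall>s\<in>S. frozen m s D g)"
  using S
proof (induction S rule: finite_induct)
  case empty
  then show ?case using ext_refl[OF f] by auto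
next
  case (insert s S)
  then obtain D g where D: "ext m A f D g" "\<forall>s\<in>S. frozen m s D g" by auto
  then have "bad_array le D g" unfolding ext_def by auto
  then obtain D' g' where D': "ext m D g D' g'" "frozen m s D' g'" using ex_frozen by meson
  moreover have "ext m A f D' g'" using ext_trans[OF D(1) D'(1)] by simp
  moreover have "\<forall>s\<in>S. frozen m s D' g'" using D(2) frozen_ext[OF _ D'(1)] by auto
  ultimately show ?case by auto
qed

text \<open>Every bad array gives rise to a minimal one: below it there is no bad array on a smaller set with
  strictly smaller values everywhere. Improve \<open>(A, f)\<close> repeatedly, retaining longer and longer initial
  parts and freezing all of their subsets as stems. By well-foundedness the values at each \<open>X\<close> stabilise,
  and the limit is locally constant after shrinking once more.\<close>

theorem minimal_bad_array:
  assumes f0: "bad_array le A0 f0"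
  obtains A f where "bad_array le A f"
    "\<And>B h. bad_array le B h \<Longrightarrow> B \<subseteq> A \<Longrightarrow> \<exists>X\<subseteq>B. infinite X \<and> \<not> lt (h X) (f X)"
proof -
  have "\<exists>F :: nat \<Rightarrow> nat \<times> nat set \<times> (nat set \<Rightarrow> 't). \<forall>n.
      (case F n of (m, A, f) \<Rightarrow> bad_array le A f) \<and>
      (case F n of (m, A, f) \<Rightarrow> case F (Suc n) of (m', A', f') \<Rightarrow>
         ext m A f A' f' \<and> (\<forall>s\<in>Pow {..<m}. frozen m s A' f') \<and> m < m' \<and> (\<exists>a\<in>A'. m \<le> a \<and> a < m'))"
  proof (rule dependent_nat_choice, goal_cases)
    case 1
    then show ?case using f0 by (intro exI[of _ "(0, A0, f0)"]) auto
  next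
    case (2 x n)
    obtain m A f where x: "x = (m, A, f)" by (cases x)
    obtain D g where D: "ext m A f D g" "\<forall>s\<in>Pow {..<m}. frozen m s D g"
      using ex_all_frozen[of A f "Pow {..<m}" m] 2 x by auto
    then have bD: "bad_array le D g" unfolding ext_def by auto
    then obtain a where a: "a \<in> D" "m \<le> a"
      using bad_arrayD(1) by (meson finite_nat_set_iff_bounded not_le)
    show ?case
      by (rule exI[of _ "(Suc a, D, g)"]) (use x D bD a in auto)
  qed
  then obtain F :: "nat \<Rightarrow> nat \<times> nat set \<times> (nat set \<Rightarrow> 't)" where
    F: "\<And>n. (case F n of (m, A, f) \<Rightarrow> bad_array le A f) \<and>
      (case F n of (m, A, f) \<Rightarrow> case F (Suc n) of (m', A', f') \<Rightarrow>
         ext m A f A' f' \<and> (\<forall>s\<in>Pow {..<m}. frozen m s A' f') \<and> m < m' \<and> (\<exists>a\<in>A'. m \<le> a \<and> a < m'))"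
    by auto
  define m where "m n = fst (F n)" for n
  define A where "A n = fst (snd (F n))" for n
  define f where "f n = snd (snd (F n))" for n
  have Feq: "F n = (m n, A n, f n)" for n by (simp add: m_def A_def f_def)
  have bad: "bad_array le (A n) (f n)" and ext1: "ext (m n) (A n) (f n) (A (Suc n)) (f (Suc n))"
    and fr: "s \<subseteq> {..<m n} \<Longrightarrow> frozen (m n) s (A (Suc n)) (f (Suc n))"
    and mS: "m n < m (Suc n)" and new: "\<exists>a\<in>A (Suc n). m n \<le> a \<and> a < m (Suc n)" for n s
    using F[of n] unfolding Feq by auto
  have mono: "strict_mono m" using mS by (simp add: strict_mono_Suc_iff)
  have m_ge: "n \<le> m n" for n using mono by (rule strict_mono_imp_increasing)
  have ext: "ext (m i) (A i) (f i) (A j) (f j)" if "i \<le> j" for i j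
    using that
  proof (induction j rule: dec_induct)
    case base
    show ?case by (rule ext_refl[OF bad])
  next
    case (step j)
    show ?case
      by (rule ext_trans[OF step.IH ext1]) (use mono step in \<open>simp add: strict_mono_less_eq\<close>)
  qed
  define Ai where "Ai = (\<Inter>n. A n)"
  have AiA: "Ai \<subseteq> A n" for n unfolding Ai_def by auto
  have keep: "x \<in> Ai" if "x \<in> A n" "x < m n" for x n
    unfolding Ai_def
  proof
    fix k
    show "x \<in> A k"
    proof (cases "n \<le> k")
      case True
      then show ?thesis using ext[OF True] that unfolding ext_def by auto
    next
      case False
      then have "ext (m k) (A k) (f k) (A n) (f n)" using ext by simp
      then show ?thesis using that unfolding ext_def by auto
    qed
  qed
  have infAi: "infinite Ai"
    unfolding infinite_nat_iff_unbounded
  proof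
    fix n
    obtain a where a: "a \<in> A (Suc (Suc n))" "m (Suc n) \<le> a" "a < m (Suc (Suc n))"
      using new[of "Suc n"] by auto
    then have "a \<in> Ai" using keep by auto
    then show "\<exists>a>n. a \<in> Ai" using a(2) m_ge[of "Suc n"] by (intro exI[of _ a]) auto
  qed
  have le_f: "lt\<^sup>=\<^sup>= (f j X) (f i X)" if "i \<le> j" "infinite X" "X \<subseteq> Ai" for i j X
  proof -
    have "X \<subseteq> A j" using that AiA by auto
    then show ?thesis using ext[OF that(1)] that(2) unfolding ext_def by auto
  qed
  have stab: "\<exists>N. \<forall>n\<ge>N. f n X = f N X" if X: "infinite X" "X \<subseteq> Ai" for X
  proof -
    have "(\<lambda>n. f n X) 0 \<in> range (\<lambda>n. f n X)" by simp
    then obtain v where v: "v \<in> range (\<lambda>n. f n X)" "\<And>w. lt w v \<Longrightarrow> w \<notin> range (\<lambda>n. f n X)"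
      using wf_lt unfolding wfp_eq_minimal by (metis (no_types, lifting))
    then obtain N where N: "v = f N X" by auto
    have "f n X = f N X" if "n \<ge> N" for n
    proof -
      have "\<not> lt (f n X) (f N X)"
      proof
        assume "lt (f n X) (f N X)"
        then have "f n X \<notin> range (\<lambda>n. f n X)" by (rule v(2)[unfolded N])
        then show False by (metis rangeI)
      qed
      then show ?thesis using le_f[OF that X] by auto
    qed
    then show ?thesis by metis
  qed
  have "\<forall>X. \<exists>v. infinite X \<and> X \<subseteq> Ai \<longrightarrow> (\<exists>N. \<forall>n\<ge>N. f n X = v)"
    using stab by metis
  then obtain g where "\<forall>X. infinite X \<and> X \<subseteq> Ai \<longrightarrow> (\<exists>N. \<forall>n\<ge>N. f n X = g X)"
    using choice[of "\<lambda>X v. infinite X \<and> X \<subseteq> Ai \<longrightarrow> (\<exists>N. \<forall>n\<ge>N. f n X = v)"] by blast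
  then have glim: "\<exists>N. \<forall>n\<ge>N. f n X = g X" if "infinite X" "X \<subseteq> Ai" for X
    using that by simp
  have g_le: "lt\<^sup>=\<^sup>= (g X) (f n X)" if X: "infinite X" "X \<subseteq> Ai" for X n
  proof -
    obtain N where "\<forall>n\<ge>N. f n X = g X" using glim[OF X] by auto
    then have "f (max N n) X = g X" by auto
    then show ?thesis using le_f[of n "max N n" X] X by auto
  qed
  have lcf: "loc_const Ai (f n)" for n
    using bad_arrayD(2)[OF bad] AiA by (rule loc_const_subset)
  obtain B where B: "infinite B" "B \<subseteq> Ai" "loc_const B g"
    by (rule loc_const_limit[OF infAi lcf glim])
  have bad_g: "bad_array le B g"
    unfolding bad_array_def
  proof (intro conjI allI impI)
    fix X assume X: "infinite X \<and> X \<subseteq> B"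
    then have X1: "infinite X" "X \<subseteq> Ai" using B by auto
    have X2: "infinite (X - {Inf X})" "X - {Inf X} \<subseteq> Ai" using X1 by auto
    obtain N where N: "\<forall>n\<ge>N. f n X = g X" using glim[OF X1] by auto
    obtain M where M: "\<forall>n\<ge>M. f n (X - {Inf X}) = g (X - {Inf X})" using glim[OF X2] by auto
    have "X \<subseteq> A (max N M)" using X1 AiA by auto
    then have "\<not> le (f (max N M) X) (f (max N M) (X - {Inf X}))"
      by (rule bad_arrayD(3)[OF bad X1(1)])
    then show "\<not> le (g X) (g (X - {Inf X}))" using N M by simp
  qed (use B in auto)
  show thesis
  proof (rule that[OF bad_g])
    fix C h assume h: "bad_array le C h" and CB: "C \<subseteq> B"
    show "\<exists>X\<subseteq>C. infinite X \<and> \<not> lt (h X) (g X)"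
    proof (rule ccontr)
      assume "\<not> ?thesis"
      then have lt: "lt (h X) (g X)" if "infinite X" "X \<subseteq> C" for X using that by auto
      have infC: "infinite C" by (rule bad_arrayD(1)[OF h])
      have CAi: "C \<subseteq> Ai" using CB B by auto
      obtain k where k: "\<And>Y. infinite Y \<Longrightarrow> Y \<subseteq> B \<Longrightarrow> Y \<inter> {..<k} = C \<inter> {..<k} \<Longrightarrow> g Y = g C"
        using loc_constD[OF B(3) infC CB] by blast
      obtain N where N: "\<forall>n\<ge>N. f n C = g C" using glim[OF infC CAi] by auto
      define j where "j = max k N"
      define M where "M = m j"
      define s where "s = C \<inter> {..<M}"
      define G where "G = f (Suc j)"
      have GC: "G C = g C" using N by (simp add: G_def j_def)
      have kM: "k \<le> M" using m_ge[of j] by (simp add: M_def j_def)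
      \<comment> \<open>A strictly smaller \<open>h\<close> on \<open>C\<close> would improve stage \<open>j + 1\<close>: keep the old values on sets that are not
      contained in \<open>C\<close>. Badness survives since \<open>X \<subseteq> C\<close> passes to the shift of \<open>X\<close>, and at the transition
      the value on the right only drops. On the stem \<open>s\<close> only subsets of \<open>C\<close> remain, which contradicts that
      \<open>s\<close> is frozen.\<close>
      define D where "D = (A (Suc j) \<inter> {..<M}) \<union> (C \<inter> {M..})"
      define H where "H Y = (if Y \<subseteq> C then h Y else G Y)" for Y
      have CA: "C \<subseteq> A (Suc j)" using CAi AiA by (rule subset_trans)
      have DA: "D \<subseteq> A (Suc j)" using CA by (auto simp: D_def)
      have infD: "infinite D"
      proof -
        have "C \<subseteq> D \<union> {..<M}" by (auto simp: D_def)
        then show ?thesis using infC by (metis finite_UnI finite_lessThan finite_subset)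
      qed
      have sub: "Y \<subseteq> C" if "Y \<subseteq> D" "Z \<subseteq> C" "Y \<inter> {..<M} = Z \<inter> {..<M}" for Y Z
      proof
        fix y assume y: "y \<in> Y"
        show "y \<in> C"
        proof (cases "y < M")
          case True
          then have "y \<in> Z \<inter> {..<M}" using y unfolding that(3)[symmetric] by simp
          then show ?thesis using that(2) by auto
        next
          case False
          then show ?thesis using y that(1) by (auto simp: D_def)
        qed
      qed
      have H_le: "lt\<^sup>=\<^sup>= (H Y) (G Y)" if "infinite Y" "Y \<subseteq> D" for Y
      proof (cases "Y \<subseteq> C")
        case True
        then have "lt (h Y) (g Y)" using lt that(1) by simp
        moreover have "Y \<subseteq> Ai" using True CAi by (rule subset_trans)
        then have "lt\<^sup>=\<^sup>= (g Y) (G Y)" unfolding G_def using g_le that(1) by auto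
        ultimately have "lt (h Y) (G Y)" using trans_lt by auto
        then show ?thesis using True by (simp add: H_def)
      qed (simp add: H_def)
      have lcG: "loc_const D G"
        using bad_arrayD(2)[OF bad] DA unfolding G_def by (rule loc_const_subset)
      have lcH: "loc_const D H"
        unfolding loc_const_def
      proof (intro allI impI)
        fix X assume X: "infinite X \<and> X \<subseteq> D"
        show "\<exists>n. \<forall>Y. infinite Y \<and> Y \<subseteq> D \<and> Y \<inter> {..<n} = X \<inter> {..<n} \<longrightarrow> H Y = H X"
        proof (cases "X \<subseteq> C")
          case True
          obtain n where n: "\<And>Y. infinite Y \<Longrightarrow> Y \<subseteq> C \<Longrightarrow> Y \<inter> {..<n} = X \<inter> {..<n} \<Longrightarrow> h Y = h X"
            using loc_constD[OF bad_arrayD(2)[OF h] _ True] X by blast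
          show ?thesis
          proof (intro exI[of _ "max n M"] allI impI)
            fix Y assume Y: "infinite Y \<and> Y \<subseteq> D \<and> Y \<inter> {..<max n M} = X \<inter> {..<max n M}"
            have "Y \<inter> {..<M} = X \<inter> {..<M}" by (rule agree_below_mono[of _ "max n M"]) (use Y in simp_all)
            then have "Y \<subseteq> C" using sub[of Y X] Y True by simp
            moreover have "Y \<inter> {..<n} = X \<inter> {..<n}" by (rule agree_below_mono[of _ "max n M"]) (use Y in simp_all)
            ultimately show "H Y = H X" using n[of Y] Y True by (simp add: H_def)
          qed
        next
          case False
          obtain n where n: "\<And>Y. infinite Y \<Longrightarrow> Y \<subseteq> D \<Longrightarrow> Y \<inter> {..<n} = X \<inter> {..<n} \<Longrightarrow> G Y = G X"
            using loc_constD[OF lcG, of X] X by blast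
          show ?thesis
          proof (intro exI[of _ "max n M"] allI impI)
            fix Y assume Y: "infinite Y \<and> Y \<subseteq> D \<and> Y \<inter> {..<max n M} = X \<inter> {..<max n M}"
            have "Y \<inter> {..<M} = X \<inter> {..<M}" by (rule agree_below_mono[of _ "max n M"]) (use Y in simp_all)
            then have "\<not> Y \<subseteq> C" using sub[of X Y] X False by auto
            moreover have "Y \<inter> {..<n} = X \<inter> {..<n}" by (rule agree_below_mono[of _ "max n M"]) (use Y in simp_all)
            ultimately show "H Y = H X" using n[of Y] Y False by (simp add: H_def)
          qed
        qed
      qed
      have badH: "bad_array le D H"
        unfolding bad_array_def
      proof (intro conjI allI impI infD lcH)
        fix X assume X: "infinite X \<and> X \<subseteq> D"
        let ?X' = "X - {Inf X}"
        have X': "infinite ?X'" "?X' \<subseteq> D" using X by auto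
        show "\<not> le (H X) (H ?X')"
        proof (cases "X \<subseteq> C")
          case True
          then have "?X' \<subseteq> C" by auto
          then show ?thesis using True bad_arrayD(3)[OF h, of X] X by (simp add: H_def)
        next
          case False
          have "X \<subseteq> A (Suc j)" using X DA by auto
          then have "\<not> le (G X) (G ?X')" unfolding G_def using bad_arrayD(3)[OF bad, of X] X by simp
          then have "\<not> le (G X) (H ?X')" using H_le[OF X'] compat by auto
          then show ?thesis using False by (simp add: H_def)
        qed
      qed
      have exH: "ext M (A (Suc j)) G D H"
        unfolding ext_def using badH DA H_le by (auto simp: D_def)
      have frG: "frozen M s (A (Suc j)) G"
        unfolding M_def G_def by (rule fr) (auto simp: s_def M_def)
      have ltH: "lt (H Y) (G C)" if Y: "infinite Y" "Y \<subseteq> D" "Y \<inter> {..<M} = s" for Y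
      proof -
        have YC: "Y \<subseteq> C" using sub[of Y C] Y by (simp add: s_def)
        have "Y \<inter> {..<k} = C \<inter> {..<k}"
          by (rule agree_below_mono[OF _ kM]) (use Y in \<open>simp add: s_def\<close>)
        then have "g Y = g C" using k[of Y] Y(1) YC CB by auto
        then show ?thesis using lt[OF Y(1) YC] YC GC by (simp add: H_def)
      qed
      have "\<not> (\<forall>Y. infinite Y \<and> Y \<subseteq> D \<and> Y \<inter> {..<M} = s \<longrightarrow> lt (H Y) (G C))"
        using frG[unfolded frozen_def, THEN spec[of _ D], THEN spec[of _ H], THEN spec[of _ C]]
          exH infC CA by (simp only: s_def simp_thms)
      then show False using ltH by simp
    qed
  qed
qed

end

section \<open>Barriers and locally constant arrays\<close>

lemma loc_const_comp: "loc_const A f \<Longrightarrow> loc_const A (\<lambda>X. g (f X))"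
  unfolding loc_const_def by metis

lemma loc_const_shift_pair:
  assumes f: "loc_const A f"
  shows "loc_const A (\<lambda>X. (f X, f (X - {Inf X})))"
  unfolding loc_const_def
proof (intro allI impI)
  fix X assume X: "infinite X \<and> X \<subseteq> A"
  then have X': "infinite (X - {Inf X})" "X - {Inf X} \<subseteq> A" by auto
  obtain n1 where n1: "\<And>Y. infinite Y \<Longrightarrow> Y \<subseteq> A \<Longrightarrow> Y \<inter> {..<n1} = X \<inter> {..<n1} \<Longrightarrow> f Y = f X"
    using loc_constD[OF f, of X] X by blast
  obtain n2 where n2: "\<And>Y. infinite Y \<Longrightarrow> Y \<subseteq> A \<Longrightarrow> Y \<inter> {..<n2} = (X - {Inf X}) \<inter> {..<n2} \<Longrightarrow> f Y = f (X - {Inf X})"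
    using loc_constD[OF f X'] by blast
  define n where "n = max (max n1 n2) (Suc (Inf X))"
  show "\<exists>n. \<forall>Y. infinite Y \<and> Y \<subseteq> A \<and> Y \<inter> {..<n} = X \<inter> {..<n} \<longrightarrow>
      (f Y, f (Y - {Inf Y})) = (f X, f (X - {Inf X}))"
  proof (intro exI[of _ n] allI impI)
    fix Y assume Y: "infinite Y \<and> Y \<subseteq> A \<and> Y \<inter> {..<n} = X \<inter> {..<n}"
    have Inf: "Inf Y = Inf X" by (rule Inf_agree_below[of X Y n]) (use X Y in \<open>simp_all add: n_def\<close>)
    have a1: "Y \<inter> {..<n1} = X \<inter> {..<n1}" by (rule agree_below_mono[of _ n]) (use Y in \<open>simp_all add: n_def\<close>)
    have "Y \<inter> {..<n2} = X \<inter> {..<n2}" by (rule agree_below_mono[of _ n]) (use Y in \<open>simp_all add: n_def\<close>)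
    then have "(Y - {Inf Y}) \<inter> {..<n2} = (X - {Inf X}) \<inter> {..<n2}"
      unfolding Inf by (metis Diff_Int_distrib2)
    moreover have "infinite (Y - {Inf Y})" "Y - {Inf Y} \<subseteq> A" using Y by auto
    ultimately have "f (Y - {Inf Y}) = f (X - {Inf X})" by (intro n2)
    then show "(f Y, f (Y - {Inf Y})) = (f X, f (X - {Inf X}))" using n1[of Y] Y a1 by simp
  qed
qed

text \<open>Let \<open>b X\<close> be the shortest nonempty initial segment of \<open>X\<close> that determines \<open>f X\<close>. By the open Ramsey
  theorem one can pass to a set on which no \<open>b X\<close> properly contains another such segment; the segments then
  form a barrier, and \<open>f\<close> induces a function on it.\<close>

theorem bqo_no_bad_array:
  assumes Q: "bqo_on Q le" and fQ: "\<And>X. f X \<in> Q"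
  shows "\<not> bad_array le A f"
proof
  assume bad: "bad_array le A f"
  note infA = bad_arrayD(1)[OF bad] and lc = bad_arrayD(2)[OF bad]
  define det where "det X n \<longleftrightarrow> n \<in> X \<and>
      (\<forall>Y. infinite Y \<and> Y \<subseteq> A \<and> Y \<inter> {..n} = X \<inter> {..n} \<longrightarrow> f Y = f X)" for X n
  define e where "e X = (LEAST n. det X n)" for X
  define b where "b X = X \<inter> {..e X}" for X
  define I where "I H = {X. infinite X \<and> X \<subseteq> H}" for H :: "nat set"
  have ex_det: "\<exists>n. det X n" if "X \<in> I A" for X
  proof -
    have X: "infinite X" "X \<subseteq> A" using that by (auto simp: I_def)
    obtain k where k: "\<And>Y. infinite Y \<Longrightarrow> Y \<subseteq> A \<Longrightarrow> Y \<inter> {..<k} = X \<inter> {..<k} \<Longrightarrow> f Y = f X"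
      using loc_constD[OF lc X] by blast
    obtain n where n: "n \<in> X" "k \<le> n" using X(1) by (meson finite_nat_set_iff_bounded not_le)
    have "f Y = f X" if Y: "infinite Y" "Y \<subseteq> A" "Y \<inter> {..n} = X \<inter> {..n}" for Y
    proof (rule k[OF Y(1,2)])
      show "Y \<inter> {..<k} = X \<inter> {..<k}"
        by (rule agree_below_mono[of _ "Suc n"]) (use Y(3) n in \<open>simp_all add: lessThan_Suc_atMost\<close>)
    qed
    then show ?thesis using n unfolding det_def by (intro exI[of _ n]) simp
  qed
  have det_e: "det X (e X)" if "X \<in> I A" for X
    unfolding e_def using ex_det[OF that] by (rule LeastI_ex)
  have atMost_mono: "Y \<inter> {..m} = X \<inter> {..m}" if "Y \<inter> {..n} = X \<inter> {..n}" "m \<le> n" for X Y :: "nat set" and m n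
    using agree_below_mono[of Y "Suc n" X "Suc m"] that by (simp add: lessThan_Suc_atMost)
  have det_trans: "det Y n" if "det X n" "Y \<inter> {..n} = X \<inter> {..n}" "infinite Y" "Y \<subseteq> A" for X Y n
  proof -
    have "n \<in> X \<inter> {..n}" using that(1) by (simp add: det_def)
    then have "n \<in> Y" unfolding that(2)[symmetric] by simp
    moreover have "f Y = f X" using that unfolding det_def by simp
    ultimately show ?thesis using that(1) unfolding det_def that(2) by simp
  qed
  have local: "e Y = e X" "b Y = b X" "f Y = f X"
    if X: "X \<in> I A" and Y: "Y \<in> I A" and eq: "Y \<inter> {..e X} = X \<inter> {..e X}" for X Y
  proof -
    have dY: "det Y (e X)" by (rule det_trans[OF det_e[OF X] eq]) (use Y in \<open>auto simp: I_def\<close>)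
    then have le1: "e Y \<le> e X" unfolding e_def[of Y] by (rule Least_le)
    have "det X (e Y)"
      by (rule det_trans[OF det_e[OF Y] atMost_mono[OF eq[symmetric] le1]]) (use X in \<open>auto simp: I_def\<close>)
    then have "e X \<le> e Y" unfolding e_def[of X] by (rule Least_le)
    with le1 show "e Y = e X" by simp
    then show "b Y = b X" using eq by (simp add: b_def)
    show "f Y = f X" using det_e[OF X] Y eq by (simp add: det_def I_def)
  qed
  have e_in: "e X \<in> b X" if "X \<in> I A" for X using det_e[OF that] by (simp add: b_def det_def)
  have fin_b: "finite (b X)" for X by (simp add: b_def)
  have Max_b: "Max (b X) = e X" if "X \<in> I A" for X
    by (rule Max_eqI) (use fin_b e_in[OF that] in \<open>auto simp: b_def\<close>)
  define P where "P X \<longleftrightarrow> (\<exists>Z\<in>I A. b Z \<subset> b X)" for X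
  obtain H where H: "infinite H" "H \<subseteq> A"
    and hom: "(\<forall>X\<subseteq>H. infinite X \<longrightarrow> P X) \<or> (\<forall>X\<subseteq>H. infinite X \<longrightarrow> \<not> P X)"
  proof (rule open_ramsey[OF infA, of P], goal_cases)
    case (1 X)
    have "P Y" if "infinite Y \<and> Y \<subseteq> A \<and> Y \<inter> {..<Suc (e X)} = X \<inter> {..<Suc (e X)}" for Y
    proof -
      have "b Y = b X"
        by (rule local(2)) (use 1 that in \<open>auto simp: I_def lessThan_Suc_atMost\<close>)
      then show ?thesis using 1 by (simp add: P_def)
    qed
    then show ?case by blast
  qed auto
  have IH: "I H \<subseteq> I A" using H by (auto simp: I_def)
  have b_sub: "b X \<subseteq> X" for X by (simp add: b_def)
  have extend: "b (b Z \<union> T) = b Z" "f (b Z \<union> T) = f Z" if "Z \<in> I A" "\<forall>x\<in>T. e Z < x" "infinite T" "T \<subseteq> A" for Z T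
  proof -
    have "Z \<subseteq> A" using that by (simp add: I_def)
    then have "b Z \<union> T \<in> I A" using that b_sub[of Z] by (auto simp: I_def)
    moreover have "(b Z \<union> T) \<inter> {..e Z} = Z \<inter> {..e Z}" using that(2) by (auto simp: b_def)
    ultimately show "b (b Z \<union> T) = b Z" "f (b Z \<union> T) = f Z" using local(2,3)[OF that(1)] by auto
  qed
  have noP: "\<not> P X" if "X \<in> I H" for X
  proof -
    \<comment> \<open>The other homogeneous case would give an infinite descent in the cardinality of \<open>b X\<close>.\<close>
    have "\<exists>X\<in>I H. \<not> P X"
    proof (rule ccontr)
      assume allP: "\<not> ?thesis"
      have "False" if "X \<in> I H" for X
        using that
      proof (induction "card (b X)" arbitrary: X rule: less_induct)
        case less
        have "P X" using allP less.prems by simp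
        then obtain Z where Z: "Z \<in> I A" "b Z \<subset> b X" unfolding P_def by (elim bexE)
        define T where "T = {x\<in>H. e X < x}"
        have "e Z \<in> b X" using e_in[OF Z(1)] Z by auto
        then have "e Z \<le> e X" by (simp add: b_def)
        then have "\<forall>x\<in>T. e Z < x" by (auto simp: T_def)
        moreover have T: "infinite T" unfolding T_def by (rule infinite_above[OF H(1)])
        moreover have "T \<subseteq> A" using H(2) by (auto simp: T_def)
        ultimately have bZT: "b (b Z \<union> T) = b Z" using extend(1)[OF Z(1)] by simp
        have "b Z \<subseteq> H" using Z(2) b_sub[of X] less.prems by (auto simp: I_def)
        then have "b Z \<union> T \<in> I H" using T by (auto simp: I_def T_def)
        moreover have "card (b Z) < card (b X)" using Z(2) fin_b by (simp add: psubset_card_mono)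
        ultimately show False using less.hyps[of "b Z \<union> T"] bZT by simp
      qed
      moreover have "H \<in> I H" using H by (simp add: I_def)
      ultimately show False by blast
    qed
    then show ?thesis using hom that by (auto simp: I_def)
  qed
  define BB where "BB = b ` I H"
  define F where "F c = f (SOME X. X \<in> I H \<and> b X = c)" for c
  have F_b: "F (b X) = f X" if X: "X \<in> I H" for X
  proof -
    define Z where "Z = (SOME Z. Z \<in> I H \<and> b Z = b X)"
    have Z: "Z \<in> I H \<and> b Z = b X" unfolding Z_def by (rule someI[of _ X]) (use X in simp)
    have XA: "X \<in> I A" "Z \<in> I A" using X Z IH by auto
    then have "e Z = e X" using Max_b[of X] Max_b[of Z] Z by simp
    then have "Z \<inter> {..e X} = X \<inter> {..e X}" using Z by (simp add: b_def)
    then show ?thesis unfolding F_def Z_def[symmetric] by (rule local(3)[OF XA])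
  qed
  have HBB: "H \<subseteq> \<Union>BB"
  proof
    fix h assume h: "h \<in> H"
    define X where "X = insert h {x\<in>H. h < x}"
    have X: "X \<in> I H" using h infinite_above[OF H(1), of h] by (auto simp: I_def X_def)
    then have "e X \<in> X" using e_in[of X] IH b_sub[of X] by auto
    then have "h \<le> e X" by (auto simp: X_def)
    then have "h \<in> b X" by (simp add: b_def X_def)
    then show "h \<in> \<Union>BB" using X by (auto simp: BB_def)
  qed
  have BBH: "\<Union>BB \<subseteq> H" using b_sub by (force simp: BB_def I_def)
  have "block BB"
    unfolding block_def
  proof (intro conjI allI impI ballI)
    show "infinite BB"
    proof
      assume "finite BB"
      then have "finite (\<Union>BB)" using fin_b by (auto simp: BB_def)
      then show False using HBB H(1) finite_subset by auto
    qed
    show "finite c" if "c \<in> BB" for c using that fin_b by (auto simp: BB_def)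
    fix X assume X: "infinite X \<and> X \<subseteq> \<Union>BB"
    then have XH: "X \<in> I H" using BBH by (auto simp: I_def)
    then have XA: "X \<in> I A" using IH by auto
    have "initial_segment (b X) X"
      unfolding initial_segment_def Max_b[OF XA] using fin_b e_in[OF XA] by (auto simp: b_def)
    then show "\<exists>c\<in>BB. initial_segment c X" using XH by (auto simp: BB_def)
  qed
  moreover have "\<not> c \<subset> d" if cd: "c \<in> BB" "d \<in> BB" for c d
  proof
    assume "c \<subset> d"
    moreover obtain X where "X \<in> I H" "d = b X" using cd by (auto simp: BB_def)
    moreover obtain Z where "Z \<in> I A" "c = b Z" using cd IH by (auto simp: BB_def)
    ultimately show False using noP[of X] by (auto simp: P_def)
  qed
  ultimately have "barrier BB" unfolding barrier_def by auto
  moreover have "F ` BB \<subseteq> Q" using fQ by (auto simp: F_def)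
  ultimately obtain b1 b2 where bb: "b1 \<in> BB" "b2 \<in> BB" "b1 \<lhd>\<^sub>s b2" "le (F b1) (F b2)"
    using Q unfolding bqo_on_def by meson
  from bb(3) obtain i :: "nat \<Rightarrow> nat" and m k :: nat where i: "strict_mono_on {1..m} i" "1 \<le> k" "k < m"
    and b12: "b1 = i ` {1..k}" "b2 = i ` {2..m}"
    unfolding shift_rel_def by blast
  obtain X1 X2 where X1: "X1 \<in> I H" "b1 = b X1" and X2: "X2 \<in> I H" "b2 = b X2"
    using bb by (auto simp: BB_def)
  have XA: "X1 \<in> I A" "X2 \<in> I A" using X1 X2 IH by auto
  have i_less: "i x < i y" if "1 \<le> x" "x < y" "y \<le> m" for x y
    using i(1) that by (auto simp: strict_mono_on_def)
  have i_le: "i x \<le> i y" if "1 \<le> x" "x \<le> y" "y \<le> m" for x y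
    using i_less[of x y] that by (cases "x = y") auto
  have e1: "e X1 = i k"
  proof -
    have "Max b1 = i k" unfolding b12(1) by (rule Max_eqI) (use i i_le in auto)
    then show ?thesis using Max_b[OF XA(1)] X1 by simp
  qed
  have e2: "e X2 = i m"
  proof -
    have "Max b2 = i m" unfolding b12(2) by (rule Max_eqI) (use i i_le in auto)
    then show ?thesis using Max_b[OF XA(2)] X2 by simp
  qed
  define T where "T = {x\<in>H. i m < x}"
  have T: "infinite T" "T \<subseteq> A" "T \<subseteq> H" using infinite_above[OF H(1), of "i m"] H(2) by (auto simp: T_def)
  have bH: "b1 \<subseteq> H" "b2 \<subseteq> H" using bb BBH by auto
  define T1 where "T1 = i ` {k<..m} \<union> T"
  have T1: "infinite T1" "T1 \<subseteq> H" "\<forall>x\<in>T1. e X1 < x"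
  proof -
    show "infinite T1" using T by (simp add: T1_def)
    have "i ` {k<..m} \<subseteq> b2" using i unfolding b12 by (intro image_mono) auto
    then show "T1 \<subseteq> H" using T(3) bH(2) by (simp add: T1_def)
    have "i k < i m" using i_less i by simp
    then have "\<forall>x\<in>T. i k < x" by (auto simp: T_def)
    then show "\<forall>x\<in>T1. e X1 < x" using i_less i by (auto simp: T1_def e1)
  qed
  define X where "X = b1 \<union> T1"
  have XH: "X \<in> I H" using T1 bH by (auto simp: X_def I_def)
  have fX: "f X = f X1"
    unfolding X_def X1(2) by (rule extend(2)[OF XA(1) T1(3,1)]) (use T1(2) H(2) in auto)
  have X_eq: "X = i ` {1..m} \<union> T"
  proof -
    have "{1..m} = {1..k} \<union> {k<..m}" using i by auto
    then show ?thesis by (auto simp: X_def T1_def b12)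
  qed
  have i1m: "i 1 \<le> i m" by (rule i_le) (use i in auto)
  then have lo_T: "i 1 < x" if "x \<in> T" for x using that by (auto simp: T_def)
  have lo_i: "i 1 < x" if "x \<in> i ` {2..m}" for x using that i_less[of 1] by auto
  have InfX: "Inf X = i 1"
  proof (rule cInf_eq_minimum)
    show "i 1 \<in> X" using i by (auto simp: X_eq)
    show "i 1 \<le> x" if "x \<in> X" for x
      using that i_le[of 1] lo_T[of x] by (auto simp: X_eq)
  qed
  have "i 1 \<notin> i ` {2..m} \<union> T" using lo_T lo_i by blast
  moreover have "{1..m} = insert 1 {2..m}" using i by auto
  ultimately have "X - {i 1} = b2 \<union> T" unfolding X_eq b12 by auto
  then have tail: "X - {Inf X} = b2 \<union> T" unfolding InfX .
  have "f (X - {Inf X}) = f X2"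
    unfolding tail X2(2) by (rule extend(2)[OF XA(2) _ T(1,2)]) (auto simp: T_def e2)
  moreover have "\<not> le (f X) (f (X - {Inf X}))"
    by (rule bad_arrayD(3)[OF bad]) (use XH IH in \<open>auto simp: I_def\<close>)
  ultimately show False using bb(4) fX F_b[OF X1(1)] F_b[OF X2(1)] X1 X2 by simp
qed

section \<open>Well-founded terms and their quasi-ordering\<close>

text \<open>Terms: a root label and, on each side, an \<open>\<omega>\<close>-sequence of immediate subterms or nothing. The type
  allows arbitrary partial sequences; only the sets \<open>lch\<close> and \<open>rch\<close> of subterms occurring in them matter
  for the ordering.\<close>

datatype 'q tm = Nd (lab: 'q) (lsub: "nat \<Rightarrow> 'q tm option") (rsub: "nat \<Rightarrow> 'q tm option")

definition lch :: "'q tm \<Rightarrow> 'q tm set" where "lch t = {x. \<exists>i. lsub t i = Some x}"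
definition rch :: "'q tm \<Rightarrow> 'q tm set" where "rch t = {x. \<exists>i. rsub t i = Some x}"

lemma tm_child_induct [case_names child]:
  assumes "\<And>t. (\<And>x. x \<in> lch t \<union> rch t \<Longrightarrow> P x) \<Longrightarrow> P t"
  shows "P t"
proof (induction t)
  case (Nd q l r)
  show ?case
  proof (rule assms)
    fix x assume "x \<in> lch (Nd q l r) \<union> rch (Nd q l r)"
    then obtain i where "l i = Some x \<or> r i = Some x" by (auto simp: lch_def rch_def)
    then show "P x" using Nd.IH(1)[of "l i" x] Nd.IH(2)[of "r i" x] by auto
  qed
qed

text \<open>The quasi-ordering of terms. It uses the two sides separately but may forget structure by passing
  to an immediate subterm of the right-hand term.\<close>

inductive tle :: "('q \<Rightarrow> 'q \<Rightarrow> bool) \<Rightarrow> 'q tm \<Rightarrow> 'q tm \<Rightarrow> bool" for le where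
  root: "le (lab s) (lab t) \<Longrightarrow> \<forall>x\<in>lch s. \<exists>y\<in>lch t. tle le x y \<Longrightarrow>
    \<forall>x\<in>rch s. \<exists>y\<in>rch t. tle le x y \<Longrightarrow> tle le s t"
| child: "y \<in> lch t \<union> rch t \<Longrightarrow> tle le s y \<Longrightarrow> tle le s t"

lemma tle_refl: "(\<And>q. le q q) \<Longrightarrow> tle le t t"
proof (induction t rule: tm_child_induct)
  case (child t)
  then show ?case by (intro root) blast+
qed

lemma tle_trans:
  assumes tr: "\<And>x y z. le x y \<Longrightarrow> le y z \<Longrightarrow> le x z"
    and st: "tle le s t" and tu: "tle le t u"
  shows "tle le s u"
  using st tu
proof (induction u arbitrary: s t rule: tm_child_induct)
  case (child u)
  note IH = child.IH
  from child.prems(2) show ?case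
  proof (cases rule: tle.cases)
    case (child y)
    then show ?thesis using IH \<open>tle le s t\<close> tle.child by metis
  next
    case tu: root
    from child.prems(1) show ?thesis
    proof (cases rule: tle.cases)
      case (child y)
      then obtain z where "z \<in> lch u \<union> rch u" "tle le y z" using tu by auto
      then show ?thesis using child IH[of z s y] tle.child by metis
    next
      case st: root
      show ?thesis
      proof (rule tle.root)
        show "le (lab s) (lab u)" using st tu tr by metis
        show "\<forall>x\<in>lch s. \<exists>z\<in>lch u. tle le x z" using st(2) tu(2) IH by (metis UnCI)
        show "\<forall>x\<in>rch s. \<exists>z\<in>rch u. tle le x z" using st(3) tu(3) IH by (metis UnCI)
      qed
    qed
  qed
qed

text \<open>The proper subterm relation.\<close>

definition subtm :: "'q tm \<Rightarrow> 'q tm \<Rightarrow> bool" where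
  "subtm = (\<lambda>x t. x \<in> lch t \<union> rch t)\<^sup>+\<^sup>+"

lemma subtm_ranking: "compatible_ranking (tle le) subtm"
proof
  have "wfp (\<lambda>x t. x \<in> lch t \<union> rch (t::'q tm))"
    by (rule wfpUNIVI) (metis tm_child_induct)
  then show "wfp (subtm :: 'q tm \<Rightarrow> _)" unfolding subtm_def by (rule wfp_tranclp)
  show "subtm x z" if "subtm x y" "subtm y z" for x y z :: "'q tm"
    using that unfolding subtm_def by auto
  show "tle le x y" if "tle le x z" "subtm z y" for x y z
    using that(2,1) unfolding subtm_def
    by (induction rule: tranclp_induct) (auto intro: tle.child)
qed

text \<open>If \<open>\<not> tle s t\<close>, then the root labels fail to increase, or some left subterm of \<open>s\<close> lies below no
  left subterm of \<open>t\<close>, or likewise on the right. One of these reasons applies homogeneously to the pairs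
  \<open>(f X, f (X - {min X}))\<close> of a minimal bad array \<open>f\<close>; the first gives a bad array of labels, and the others
  give a bad array of subterms of the \<open>f X\<close>.\<close>

theorem tle_no_bad_array:
  assumes nobad: "\<And>A f. \<not> bad_array le A f"
  shows "\<not> bad_array (tle le) A0 f0"
proof
  assume bad0: "bad_array (tle le) A0 f0"
  obtain A f where bad: "bad_array (tle le) A f" and min:
    "\<And>B h. bad_array (tle le) B h \<Longrightarrow> B \<subseteq> A \<Longrightarrow> \<exists>X\<subseteq>B. infinite X \<and> \<not> subtm (h X) (f X)"
    using compatible_ranking.minimal_bad_array[OF subtm_ranking bad0] by metis
  note infA = bad_arrayD(1)[OF bad] and lc = bad_arrayD(2)[OF bad]
  define F where "F X = (f X, f (X - {Inf X}))" for X
  have lcF: "loc_const A F" unfolding F_def by (rule loc_const_shift_pair[OF lc])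
  define Rq where "Rq p \<longleftrightarrow> \<not> le (lab (fst p)) (lab (snd p))" for p :: "'a tm \<times> 'a tm"
  define Rc where "Rc ch p \<longleftrightarrow> (\<exists>x\<in>ch (fst p). \<forall>y\<in>ch (snd p). \<not> tle le x y)"
    for ch :: "'a tm \<Rightarrow> 'a tm set" and p
  have no_ch: "\<not> (\<forall>X\<subseteq>B. infinite X \<longrightarrow> Rc ch (F X))"
    if B: "infinite B" "B \<subseteq> A" and ch: "\<And>x t. x \<in> ch t \<Longrightarrow> x \<in> lch t \<union> rch t" for B ch
  proof
    assume all: "\<forall>X\<subseteq>B. infinite X \<longrightarrow> Rc ch (F X)"
    define c where "c p = (SOME x. x \<in> ch (fst p) \<and> (\<forall>y\<in>ch (snd p). \<not> tle le x y))" for p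
    define h where "h X = c (F X)" for X
    have h: "h X \<in> ch (f X)" "\<And>y. y \<in> ch (f (X - {Inf X})) \<Longrightarrow> \<not> tle le (h X) y"
      if X: "infinite X" "X \<subseteq> B" for X
    proof -
      have "\<exists>x. x \<in> ch (fst (F X)) \<and> (\<forall>y\<in>ch (snd (F X)). \<not> tle le x y)"
        using all X unfolding Rc_def by blast
      then have "h X \<in> ch (fst (F X)) \<and> (\<forall>y\<in>ch (snd (F X)). \<not> tle le (h X) y)"
        unfolding h_def c_def by (rule someI_ex)
      then show "h X \<in> ch (f X)" "\<And>y. y \<in> ch (f (X - {Inf X})) \<Longrightarrow> \<not> tle le (h X) y"
        by (auto simp: F_def)
    qed
    have "bad_array (tle le) B h"
      unfolding bad_array_def
    proof (intro conjI allI impI)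
      show "loc_const B h" unfolding h_def
        using loc_const_comp[OF lcF] B(2) by (rule loc_const_subset)
      fix X assume X: "infinite X \<and> X \<subseteq> B"
      then have "infinite (X - {Inf X})" "X - {Inf X} \<subseteq> B" by auto
      then show "\<not> tle le (h X) (h (X - {Inf X}))" using h X by simp
    qed (rule B(1))
    then obtain X where "X \<subseteq> B" "infinite X" "\<not> subtm (h X) (f X)" using min B(2) by blast
    then show False using h(1)[of X] ch unfolding subtm_def by blast
  qed
  have cases: "Rq (F X) \<or> Rc lch (F X) \<or> Rc rch (F X)" if "infinite X" "X \<subseteq> A" for X
  proof (rule ccontr)
    assume "\<not> ?thesis"
    then have "tle le (f X) (f (X - {Inf X}))"
      unfolding Rq_def Rc_def F_def by (intro tle.root) auto
    then show False using bad_arrayD(3)[OF bad that] by simp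
  qed
  obtain B where B: "infinite B" "B \<subseteq> A"
    and homB: "(\<forall>X\<subseteq>B. infinite X \<longrightarrow> Rq (F X)) \<or> (\<forall>X\<subseteq>B. infinite X \<longrightarrow> \<not> Rq (F X))"
    by (rule loc_const_ramsey[OF infA lcF])
  have noq: "\<forall>X\<subseteq>B. infinite X \<longrightarrow> \<not> Rq (F X)"
  proof (rule ccontr)
    assume "\<not> ?thesis"
    then have all: "\<forall>X\<subseteq>B. infinite X \<longrightarrow> Rq (F X)" using homB by blast
    have "bad_array le B (\<lambda>X. lab (f X))"
      unfolding bad_array_def using B(1) all loc_const_subset[OF loc_const_comp[OF lc] B(2)]
      by (simp add: Rq_def F_def)
    then show False using nobad by blast
  qed
  have lcB: "loc_const B F" using lcF B(2) by (rule loc_const_subset)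
  obtain C where C: "infinite C" "C \<subseteq> B"
    and homC: "(\<forall>X\<subseteq>C. infinite X \<longrightarrow> Rc lch (F X)) \<or> (\<forall>X\<subseteq>C. infinite X \<longrightarrow> \<not> Rc lch (F X))"
    by (rule loc_const_ramsey[OF B(1) lcB])
  have CA: "C \<subseteq> A" using B C by auto
  have "\<forall>X\<subseteq>C. infinite X \<longrightarrow> \<not> Rc lch (F X)"
    using homC no_ch[OF C(1) CA, of lch] by blast
  then have "\<forall>X\<subseteq>C. infinite X \<longrightarrow> Rc rch (F X)"
    using noq cases CA C(2) by (meson subset_trans)
  then show False using no_ch[OF C(1) CA, of rch] by blast
qed

lemma no_bad_array_imp_wqo:
  fixes t :: "nat \<Rightarrow> 't"
  assumes "\<And>A f. \<not> bad_array le A f"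
  shows "\<exists>i j. i < j \<and> le (t i) (t j)"
proof (rule ccontr)
  assume bad: "\<not> ?thesis"
  have "bad_array le UNIV (\<lambda>X. t (Inf X))"
    unfolding bad_array_def
  proof (intro conjI allI impI)
    show "loc_const UNIV (\<lambda>X. t (Inf X))"
      unfolding loc_const_def
    proof (intro allI impI)
      fix X :: "nat set" assume X: "infinite X \<and> X \<subseteq> UNIV"
      show "\<exists>n. \<forall>Y. infinite Y \<and> Y \<subseteq> UNIV \<and> Y \<inter> {..<n} = X \<inter> {..<n} \<longrightarrow> t (Inf Y) = t (Inf X)"
        by (rule exI[of _ "Suc (Inf X)"]) (metis Inf_agree_below X lessI)
    qed
    fix X :: "nat set" assume "infinite X \<and> X \<subseteq> UNIV"
    then have "infinite (X - {Inf X})" by auto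
    then have "Inf (X - {Inf X}) \<in> X - {Inf X}" by (rule Inf_nat_mem)
    then have "Inf X < Inf (X - {Inf X})" using Inf_nat_le[of _ X] by (metis DiffE insert_iff le_neq_implies_less)
    then show "\<not> le (t (Inf X)) (t (Inf (X - {Inf X})))" using bad by blast
  qed simp
  then show False using assms by blast
qed

section \<open>Labelled sets of reals represented by terms\<close>

text \<open>\<open>h\<close> embeds the set \<open>K\<close> with labelling \<open>c\<close> into the set \<open>L\<close> with labelling \<open>d\<close>. Labellings are total
  functions here, of which only the values on \<open>K\<close> and \<open>L\<close> matter.\<close>

definition emb_fun :: "('q \<Rightarrow> 'q \<Rightarrow> bool) \<Rightarrow> (real \<Rightarrow> 'q) \<Rightarrow> real set \<Rightarrow> (real \<Rightarrow> 'q) \<Rightarrow> real set \<Rightarrow> (real \<Rightarrow> real) \<Rightarrow> bool" where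
  "emb_fun le c K d L h \<longleftrightarrow>
     h ` K \<subseteq> L \<and> strict_mono_on K h \<and> continuous_on K h \<and> (\<forall>x\<in>K. le (c x) (d (h x)))"

definition emb :: "('q \<Rightarrow> 'q \<Rightarrow> bool) \<Rightarrow> (real \<Rightarrow> 'q) \<Rightarrow> real set \<Rightarrow> (real \<Rightarrow> 'q) \<Rightarrow> real set \<Rightarrow> bool" where
  "emb le c K d L \<longleftrightarrow> (\<exists>h. emb_fun le c K d L h)"

text \<open>Embeddings that map the point \<open>p\<close> to \<open>p'\<close>.\<close>

definition embp :: "('q \<Rightarrow> 'q \<Rightarrow> bool) \<Rightarrow> (real \<Rightarrow> 'q) \<Rightarrow> real set \<Rightarrow> real \<Rightarrow> (real \<Rightarrow> 'q) \<Rightarrow> real set \<Rightarrow> real \<Rightarrow> bool" where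
  "embp le c K p d L p' \<longleftrightarrow> (\<exists>h. emb_fun le c K d L h \<and> h p = p')"

lemma emb_mono: "emb le c K d L \<Longrightarrow> L \<subseteq> L' \<Longrightarrow> emb le c K d L'"
  unfolding emb_def emb_fun_def by (meson subset_trans)

lemma emb_fun_neg:
  assumes "emb_fun le c K d L h"
  shows "emb_fun le (c \<circ> uminus) (uminus ` K) (d \<circ> uminus) (uminus ` L) (\<lambda>x. - h (- x))"
  unfolding emb_fun_def
proof (intro conjI)
  have h: "h ` K \<subseteq> L" "strict_mono_on K h" "continuous_on K h" "\<forall>x\<in>K. le (c x) (d (h x))"
    using assms by (auto simp: emb_fun_def)
  show "(\<lambda>x. - h (- x)) ` uminus ` K \<subseteq> uminus ` L" using h(1) by auto
  show "strict_mono_on (uminus ` K) (\<lambda>x. - h (- x))"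
    using h(2) by (auto simp: strict_mono_on_def)
  show "\<forall>x\<in>uminus ` K. le ((c \<circ> uminus) x) ((d \<circ> uminus) (- h (- x)))" using h(4) by auto
  have "continuous_on (uminus ` K) (\<lambda>x. h (- x))"
    by (rule continuous_on_compose2[OF h(3)]) (auto intro: continuous_intros)
  then show "continuous_on (uminus ` K) (\<lambda>x. - h (- x))" by (rule continuous_on_minus)
qed

lemma uminus_uminus_image [simp]: "uminus ` uminus ` K = (K :: real set)"
  by (simp add: image_image)

lemma comp_uminus2 [simp]: "(c \<circ> uminus) \<circ> uminus = (c :: real \<Rightarrow> 'a)"
  by (simp add: fun_eq_iff)

text \<open>Reflection at 0 exchanges left and right; it reduces statements on right-hand sides of points to
  the corresponding ones on left-hand sides.\<close>

lemma emb_neg: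
  "emb le (c \<circ> uminus) (uminus ` K) (d \<circ> uminus) (uminus ` L) \<longleftrightarrow> emb le c K d L"
proof -
  have "emb le (c \<circ> uminus) (uminus ` K) (d \<circ> uminus) (uminus ` L)" if "emb le c K d L" for c d K L
    using that emb_fun_neg unfolding emb_def by blast
  from this this[of "c \<circ> uminus" "uminus ` K" "d \<circ> uminus" "uminus ` L"]
  show ?thesis by (auto simp only: uminus_uminus_image comp_uminus2)
qed

lemma embp_neg:
  assumes "embp le (c \<circ> uminus) (uminus ` K) (- p) (d \<circ> uminus) (uminus ` L) (- p')"
  shows "embp le c K p d L p'"
proof -
  obtain h where h: "emb_fun le (c \<circ> uminus) (uminus ` K) (d \<circ> uminus) (uminus ` L) h" "h (- p) = - p'"
    using assms unfolding embp_def by blast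
  have "emb_fun le c K d L (\<lambda>x. - h (- x))"
    using emb_fun_neg[OF h(1)] by (simp only: uminus_uminus_image comp_uminus2)
  then show ?thesis using h(2) unfolding embp_def by (intro exI[of _ "\<lambda>x. - h (- x)"]) simp
qed

text \<open>Two embeddings defined on either side of \<open>a\<close> can be glued; \<open>a\<close> may be a point of \<open>K\<close> or a gap.\<close>

lemma emb_fun_glue:
  fixes K L :: "real set"
  assumes h1: "emb_fun le c (K \<inter> {..a}) d L h1" and h2: "emb_fun le c (K \<inter> {a..}) d L h2"
    and eq: "a \<in> K \<Longrightarrow> h1 a = h2 a"
    and less: "\<And>x y. x \<in> K \<Longrightarrow> y \<in> K \<Longrightarrow> x \<le> a \<Longrightarrow> a \<le> y \<Longrightarrow> x < y \<Longrightarrow> h1 x < h2 y"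
  shows "emb le c K d L"
proof -
  define h where "h x = (if x \<le> a then h1 x else h2 x)" for x
  have "emb_fun le c K d L h"
    unfolding emb_fun_def
  proof (intro conjI)
    show "h ` K \<subseteq> L" using h1 h2 by (auto simp: emb_fun_def h_def)
    show "\<forall>x\<in>K. le (c x) (d (h x))" using h1 h2 by (auto simp: emb_fun_def h_def)
    show "strict_mono_on K h"
    proof (rule strict_mono_onI)
      fix x y assume "x \<in> K" "y \<in> K" "x < y"
      then show "h x < h y"
        using less[of x y] strict_mono_onD[of "K \<inter> {..a}" h1 x y] strict_mono_onD[of "K \<inter> {a..}" h2 x y] h1 h2
        by (auto simp: emb_fun_def h_def)
    qed
    have "continuous_on (K \<inter> {..a} \<union> K \<inter> {a..}) (\<lambda>x. if x \<le> a then h1 x else h2 x)"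
    proof (rule continuous_on_cases_local)
      show "closedin (top_of_set (K \<inter> {..a} \<union> K \<inter> {a..})) (K \<inter> {..a})"
        unfolding closedin_closed by (rule exI[of _ "{..a}"]) auto
      show "closedin (top_of_set (K \<inter> {..a} \<union> K \<inter> {a..})) (K \<inter> {a..})"
        unfolding closedin_closed by (rule exI[of _ "{a..}"]) auto
      show "continuous_on (K \<inter> {..a}) h1" "continuous_on (K \<inter> {a..}) h2"
        using h1 h2 by (auto simp: emb_fun_def)
      fix x assume "x \<in> K \<inter> {..a} \<and> \<not> x \<le> a \<or> x \<in> K \<inter> {a..} \<and> x \<le> a"
      then have "x = a" "a \<in> K" by auto
      then show "h1 x = h2 x" using eq by simp
    qed
    moreover have "K \<inter> {..a} \<union> K \<inter> {a..} = K" by auto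
    ultimately show "continuous_on K h" unfolding h_def by simp
  qed
  then show ?thesis unfolding emb_def by blast
qed

lemma emb_fun_mono: "emb_fun le c K d L h \<Longrightarrow> L \<subseteq> L' \<Longrightarrow> emb_fun le c K d L' h"
  unfolding emb_fun_def by auto

lemma emb_glue_cut:
  fixes K L :: "real set"
  assumes 1: "emb le c (K \<inter> {..a}) d (L \<inter> {..b})" and 2: "emb le c (K \<inter> {a..}) d (L \<inter> {b..})"
    and a: "a \<notin> K" and b: "b \<notin> L"
  shows "emb le c K d L"
proof -
  obtain h1 h2 where h1: "emb_fun le c (K \<inter> {..a}) d (L \<inter> {..b}) h1"
    and h2: "emb_fun le c (K \<inter> {a..}) d (L \<inter> {b..}) h2"
    using 1 2 unfolding emb_def by blast
  show ?thesis
  proof (rule emb_fun_glue[of le c K a d L h1 h2])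
    fix x y assume xy: "x \<in> K" "y \<in> K" "x \<le> a" "a \<le> y"
    then have "h1 x \<in> L \<inter> {..b}" "h2 y \<in> L \<inter> {b..}" using h1 h2 by (auto simp: emb_fun_def)
    then have "h1 x \<le> b" "h1 x \<noteq> b" "b \<le> h2 y" using b by auto
    then show "h1 x < h2 y" by linarith
  qed (use a emb_fun_mono[OF h1] emb_fun_mono[OF h2] in auto)
qed

lemma emb_glue_point:
  fixes K L :: "real set"
  assumes 1: "embp le c (K \<inter> {..p}) p d (L \<inter> {..p'}) p'" and 2: "embp le c (K \<inter> {p..}) p d (L \<inter> {p'..}) p'"
    and p: "p \<in> K"
  shows "emb le c K d L"
proof -
  obtain h1 h2 where h1: "emb_fun le c (K \<inter> {..p}) d (L \<inter> {..p'}) h1" "h1 p = p'"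
    and h2: "emb_fun le c (K \<inter> {p..}) d (L \<inter> {p'..}) h2" "h2 p = p'"
    using 1 2 unfolding embp_def by blast
  show ?thesis
  proof (rule emb_fun_glue[of le c K p d L h1 h2])
    fix x y assume xy: "x \<in> K" "y \<in> K" "x \<le> p" "p \<le> y" "x < y"
    have h1x: "h1 x \<le> p'" and h2y: "p' \<le> h2 y" using xy h1 h2 by (auto simp: emb_fun_def)
    show "h1 x < h2 y"
    proof (cases "x = p")
      case True
      then have "h2 p < h2 y" using strict_mono_onD[of "K \<inter> {p..}" h2 p y] h2 xy by (auto simp: emb_fun_def)
      then show ?thesis using True h1 h2 by simp
    next
      case False
      then have "h1 x < h1 p" using strict_mono_onD[of "K \<inter> {..p}" h1 x p] h1 xy p by (auto simp: emb_fun_def)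
      then show ?thesis using h1 h2y by simp
    qed
  qed (use h1 h2 emb_fun_mono[OF h1(1)] emb_fun_mono[OF h2(1)] in auto)
qed

text \<open>Cut points outside \<open>K\<close> that increase to \<open>p\<close> and divide the part of \<open>K\<close> to the left of \<open>p\<close> into an
  \<open>\<omega>\<close>-sequence of pieces.\<close>

definition lcuts :: "real set \<Rightarrow> real \<Rightarrow> (nat \<Rightarrow> real) \<Rightarrow> bool" where
  "lcuts K p a \<longleftrightarrow> strict_mono a \<and> a \<longlonglongrightarrow> p \<and> (\<forall>n. a n \<notin> K) \<and> K \<inter> {..<p} \<subseteq> {a 0<..}"

lemma lcuts_less: "lcuts K p a \<Longrightarrow> a n < p"
proof -
  assume "lcuts K p a"
  then have "strict_mono a" "a \<longlonglongrightarrow> p" by (auto simp: lcuts_def)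
  then have "a (Suc n) \<le> p" by (meson incseq_le strict_mono_mono)
  moreover have "a n < a (Suc n)" using \<open>strict_mono a\<close> by (simp add: strict_mono_Suc_iff)
  ultimately show ?thesis by simp
qed

lemma lcuts_piece:
  assumes a: "lcuts K p a" and x: "x \<in> K" "x < p"
  shows "\<exists>!n. a n < x \<and> x < a (Suc n)"
proof -
  have mono: "strict_mono a" and lim: "a \<longlonglongrightarrow> p" and nin: "\<And>n. a n \<notin> K" and "a 0 < x"
    using a x by (auto simp: lcuts_def)
  have "\<exists>n. x < a n" using order_tendstoD(1)[OF lim x(2)] by (auto simp: eventually_sequentially)
  define N where "N = (LEAST n. x < a n)"
  have N: "x < a N" unfolding N_def using \<open>\<exists>n. x < a n\<close> by (rule LeastI_ex)
  have min: "a n \<le> x" if "n < N" for n using not_less_Least[of n "\<lambda>n. x < a n"] that by (simp add: N_def)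
  obtain n where n: "N = Suc n" using N \<open>a 0 < x\<close> by (cases N) auto
  have "a n < x" using min[of n] n nin[of n] x(1) by (auto simp: order_less_le)
  moreover have uniq: "k = n" if "a k < x" "x < a (Suc k)" for k
  proof (rule ccontr)
    assume "k \<noteq> n"
    then consider "Suc k \<le> n" | "Suc n \<le> k" by linarith
    then show False
    proof cases
      case 1
      then have "a (Suc k) \<le> a n" using mono by (simp add: strict_mono_less_eq)
      then show ?thesis using that \<open>a n < x\<close> by simp
    next
      case 2
      then have "a (Suc n) \<le> a k" using mono by (simp add: strict_mono_less_eq)
      then show ?thesis using that N n by simp
    qed
  qed
  moreover have "x < a (Suc n)" using N n by simp
  ultimately have "a n < x \<and> x < a (Suc n)" by (intro conjI)
  then show ?thesis by (rule ex1I) (metis uniq)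
qed

text \<open>If the pieces to the left of \<open>p\<close> embed into a subsequence of the pieces to the left of \<open>q\<close>, then the
  union of these embeddings is continuous, and it remains so when \<open>p\<close> is sent to \<open>q\<close>.\<close>

lemma embp_omega:
  fixes K L :: "real set"
  assumes a: "lcuts K p a" and b: "lcuts L q b" and j: "strict_mono j"
    and pieces: "\<And>n. emb le c (K \<inter> {a n..a (Suc n)}) d (L \<inter> {b (j n)..b (Suc (j n))})"
    and pq: "le (c p) (d q)" "q \<in> L"
  shows "embp le c (K \<inter> {..p}) p d (L \<inter> {..q}) q"
proof -
  obtain H where H: "\<And>n. emb_fun le c (K \<inter> {a n..a (Suc n)}) d (L \<inter> {b (j n)..b (Suc (j n))}) (H n)"
    using pieces unfolding emb_def by metis
  define N where "N x = (THE n. a n < x \<and> x < a (Suc n))" for x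
  have N: "a (N x) < x" "x < a (Suc (N x))" if "x \<in> K" "x < p" for x
    using theI'[OF lcuts_piece[OF a that]] by (auto simp: N_def)
  have N_eq: "N x = n" if "x \<in> K" "x < p" "a n < x" "x < a (Suc n)" for x n
    using lcuts_piece[OF a that(1,2)] N[OF that(1,2)] that(3,4) by blast
  define h where "h x = (if x = p then q else H (N x) x)" for x
  have mono_a: "strict_mono a" and mono_b: "strict_mono b" using a b by (auto simp: lcuts_def)
  have ap: "a n < p" and bq: "b n < q" for n using a b lcuts_less by auto
  have in_piece: "H n x \<in> L" "b (j n) < H n x" "H n x < b (Suc (j n))" "le (c x) (d (H n x))"
    if "x \<in> K" "a n < x" "x < a (Suc n)" for n x
  proof -
    have x: "x \<in> K \<inter> {a n..a (Suc n)}" using that by auto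
    have "H n ` (K \<inter> {a n..a (Suc n)}) \<subseteq> L \<inter> {b (j n)..b (Suc (j n))}"
      "\<forall>x\<in>K \<inter> {a n..a (Suc n)}. le (c x) (d (H n x))"
      using H[of n] unfolding emb_fun_def by simp_all
    then have "H n x \<in> L \<inter> {b (j n)..b (Suc (j n))}" "le (c x) (d (H n x))"
      using x by blast+
    moreover have "b k \<notin> L" for k using b by (auto simp: lcuts_def)
    ultimately show "H n x \<in> L" "b (j n) < H n x" "H n x < b (Suc (j n))" "le (c x) (d (H n x))"
      by (auto simp: order_less_le) metis+
  qed
  have h_less: "h x = H (N x) x" "h x \<in> L" "h x < q" "b (j (N x)) < h x" "h x < b (Suc (j (N x)))" "le (c x) (d (h x))"
    if "x \<in> K" "x < p" for x
  proof -
    show 1: "h x = H (N x) x" using that by (simp add: h_def)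
    show "h x \<in> L" "b (j (N x)) < h x" and 2: "h x < b (Suc (j (N x)))" and "le (c x) (d (h x))"
      unfolding 1 using in_piece[OF that(1) N[OF that]] by auto
    show "h x < q" using 2 bq[of "Suc (j (N x))"] by linarith
  qed
  have "emb_fun le c (K \<inter> {..p}) d (L \<inter> {..q}) h"
    unfolding emb_fun_def
  proof (intro conjI)
    have hp: "h p = q" by (simp add: h_def)
    show "h ` (K \<inter> {..p}) \<subseteq> L \<inter> {..q}"
    proof
      fix y assume "y \<in> h ` (K \<inter> {..p})"
      then obtain x where x: "x \<in> K" "x \<le> p" "y = h x" by auto
      then show "y \<in> L \<inter> {..q}" using h_less(2,3)[of x] pq hp by (cases "x = p") auto
    qed
    show "\<forall>x\<in>K \<inter> {..p}. le (c x) (d (h x))"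
    proof
      fix x assume "x \<in> K \<inter> {..p}"
      then show "le (c x) (d (h x))" using h_less(6)[of x] pq hp by (cases "x = p") auto
    qed
    show "strict_mono_on (K \<inter> {..p}) h"
    proof (rule strict_mono_onI)
      fix x y assume xy: "x \<in> K \<inter> {..p}" "y \<in> K \<inter> {..p}" "x < y"
      then have x: "x \<in> K" "x < p" by auto
      show "h x < h y"
      proof (cases "y = p")
        case True
        then show ?thesis using h_less(3)[OF x] hp by simp
      next
        case False
        then have y: "y \<in> K" "y < p" using xy by auto
        show ?thesis
        proof (cases "N x = N y")
          case True
          have "x \<in> K \<inter> {a (N x)..a (Suc (N x))}" "y \<in> K \<inter> {a (N x)..a (Suc (N x))}"
            using N[OF x] N[OF y] x y True by auto
          then have "H (N x) x < H (N x) y"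
            using strict_mono_onD[of "K \<inter> {a (N x)..a (Suc (N x))}" "H (N x)"] H[of "N x"] xy(3)
            unfolding emb_fun_def by blast
          then show ?thesis using h_less(1)[OF x] h_less(1)[OF y] True by simp
        next
          case False
          have "a (N x) < a (Suc (N y))" using N[OF x] N[OF y] xy(3) by linarith
          then have "N x < Suc (N y)" using mono_a by (simp add: strict_mono_less)
          then have "N x < N y" using False by simp
          then have "j (N x) < j (N y)" using j by (simp add: strict_mono_less)
          then have "b (Suc (j (N x))) \<le> b (j (N y))" using mono_b by (simp add: strict_mono_less_eq)
          then show ?thesis using h_less(5)[OF x] h_less(4)[OF y] by linarith
        qed
      qed
    qed
    show "continuous_on (K \<inter> {..p}) h"
      unfolding continuous_on_def
    proof
      fix x assume "x \<in> K \<inter> {..p}"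
      then consider "x = p" | "x \<in> K" "x < p" by force
      then show "(h \<longlongrightarrow> h x) (at x within K \<inter> {..p})"
      proof cases
        case 1
        have "(h \<longlongrightarrow> q) (at p within K \<inter> {..p})"
        proof (rule order_tendstoI)
          fix l assume "l < q"
          then obtain M where M: "\<And>n. n \<ge> M \<Longrightarrow> l < b n"
            using b order_tendstoD(1)[of b q sequentially l] by (auto simp: lcuts_def eventually_sequentially)
          show "eventually (\<lambda>y. l < h y) (at p within K \<inter> {..p})"
            unfolding eventually_at_topological
          proof (intro exI[of _ "{a M<..}"] conjI ballI impI)
            show "p \<in> {a M<..}" using ap by simp
            fix y assume y: "y \<in> {a M<..}" "y \<noteq> p" "y \<in> K \<inter> {..p}"
            then have y': "y \<in> K" "y < p" by auto
            have "a M < a (Suc (N y))" using N[OF y'] y by simp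
            then have "M \<le> N y" using mono_a by (simp add: strict_mono_less)
            also have "N y \<le> j (N y)" using j by (rule strict_mono_imp_increasing)
            finally have "l < b (j (N y))" by (rule M)
            then show "l < h y" using h_less(4)[OF y'] by simp
          qed simp
        next
          fix u assume u: "q < u"
          show "eventually (\<lambda>y. h y < u) (at p within K \<inter> {..p})"
            unfolding eventually_at_topological
          proof (intro exI[of _ UNIV] conjI ballI impI)
            fix y assume "y \<noteq> p" "y \<in> K \<inter> {..p}"
            then show "h y < u" using h_less(3)[of y] u by auto
          qed auto
        qed
        then show ?thesis using 1 hp by simp
      next
        case 2
        define n where "n = N x"
        let ?P = "K \<inter> {a n..a (Suc n)}"
        have xn: "a n < x" "x < a (Suc n)" using N[OF 2] by (auto simp: n_def)
        have "(H n \<longlongrightarrow> H n x) (at x within ?P)"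
          using H[of n] 2 xn unfolding emb_fun_def continuous_on_def by auto
        moreover have "at x within (K \<inter> {..p}) = at x within ?P"
          by (rule at_within_nhd[of x "{a n<..<a (Suc n)}"]) (use xn ap[of "Suc n"] in auto)
        ultimately have *: "(H n \<longlongrightarrow> H n x) (at x within K \<inter> {..p})" by simp
        have "eventually (\<lambda>y. H n y = h y) (at x within K \<inter> {..p})"
          unfolding eventually_at_topological
        proof (intro exI[of _ "{a n<..<a (Suc n)}"] conjI ballI impI)
          fix y assume y: "y \<in> {a n<..<a (Suc n)}" "y \<in> K \<inter> {..p}"
          then have y': "y \<in> K" "y < p" using ap[of "Suc n"] by auto
          have "N y = n" by (rule N_eq[OF y']) (use y in auto)
          then show "H n y = h y" using h_less(1)[OF y'] by simp
        qed (use xn in auto)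
        with * have "(h \<longlongrightarrow> H n x) (at x within K \<inter> {..p})"
          by (rule Lim_transform_eventually)
        then show ?thesis using h_less(1)[OF 2] by (simp add: n_def)
      qed
    qed
  qed
  then show ?thesis unfolding embp_def by (intro exI[of _ h]) (simp add: h_def)
qed

text \<open>Each term of the sequence lies below infinitely many members of the sequence.\<close>

definition recurrent :: "('q \<Rightarrow> 'q \<Rightarrow> bool) \<Rightarrow> (nat \<Rightarrow> 'q tm) \<Rightarrow> bool" where
  "recurrent le t \<longleftrightarrow> (\<forall>i. infinite {j. tle le (t i) (t j)})"

text \<open>The part of \<open>K\<close> to the left of \<open>p\<close> is described by \<open>l\<close>: either both are empty, or \<open>l\<close> is a recurrent
  sequence of terms and its members represent the successive pieces between cut points. Representation is
  the parameter \<open>R\<close>, so that right-hand sides are covered by reflecting both \<open>K\<close> and \<open>R\<close>.\<close>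

definition side :: "('q \<Rightarrow> 'q \<Rightarrow> bool) \<Rightarrow> ('q tm \<Rightarrow> real set \<Rightarrow> bool) \<Rightarrow> real set \<Rightarrow> real \<Rightarrow> (nat \<Rightarrow> 'q tm option) \<Rightarrow> bool" where
  "side le R K p l \<longleftrightarrow> (l = (\<lambda>_. None) \<and> K \<inter> {..<p} = {}) \<or>
     (\<exists>t a. l = (\<lambda>i. Some (t i)) \<and> recurrent le t \<and> lcuts K p a \<and> (\<forall>n. R (t n) (K \<inter> {a n..a (Suc n)})))"

lemma side_mono [mono]:
  "(\<And>t S. R t S \<longrightarrow> R' t S) \<Longrightarrow> side le R K p l \<longrightarrow> side le R' K p l"
  unfolding side_def by blast

text \<open>\<open>rep le c t K\<close>: the term \<open>t\<close> represents the set \<open>K\<close> with labelling \<open>c\<close>, with a point \<open>p\<close> of \<open>K\<close> as its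
  root.\<close>

inductive rep :: "('q \<Rightarrow> 'q \<Rightarrow> bool) \<Rightarrow> (real \<Rightarrow> 'q) \<Rightarrow> 'q tm \<Rightarrow> real set \<Rightarrow> bool" for le c where
  rep: "p \<in> K \<Longrightarrow> c p = q \<Longrightarrow> side le (\<lambda>t S. rep le c t S) K p l \<Longrightarrow>
    side le (\<lambda>t S. rep le c t (uminus ` S)) (uminus ` K) (- p) r \<Longrightarrow> rep le c (Nd q l r) K"

text \<open>The side-wise step of the embedding theorem. The target indices are chosen strictly increasing, which is
  possible because the sequence on the target side is recurrent.\<close>

lemma side_emb:
  assumes tr: "\<And>x y z. le x y \<Longrightarrow> le y z \<Longrightarrow> le x z"
    and K: "side le R K p l" and L: "side le R' L q l'"
    and dom: "\<And>i x. l i = Some x \<Longrightarrow> \<exists>k y. l' k = Some y \<and> tle le x y"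
    and IH: "\<And>i x y S T. l i = Some x \<Longrightarrow> R x S \<Longrightarrow> R' y T \<Longrightarrow> tle le x y \<Longrightarrow> emb le c S d T"
    and pq: "le (c p) (d q)" "q \<in> L"
  shows "embp le c (K \<inter> {..p}) p d (L \<inter> {..q}) q"
  using K unfolding side_def
proof (elim disjE exE conjE)
  assume "K \<inter> {..<p} = {}"
  then have K: "K \<inter> {..p} \<subseteq> {p}" by (auto simp: order_less_le)
  have "emb_fun le c (K \<inter> {..p}) d (L \<inter> {..q}) (\<lambda>_. q)"
    unfolding emb_fun_def
  proof (intro conjI)
    show "strict_mono_on (K \<inter> {..p}) (\<lambda>_. q)"
      using K by (intro strict_mono_onI) (metis order_less_irrefl singletonD subsetD)
  qed (use K pq in auto)
  then show ?thesis unfolding embp_def by blast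
next
  fix t a assume t: "l = (\<lambda>i. Some (t i))" and a: "lcuts K p a"
    and R: "\<forall>n. R (t n) (K \<inter> {a n..a (Suc n)})"
  have "l' \<noteq> (\<lambda>_. None)" using dom[of 0 "t 0"] t by auto
  then obtain u b where u: "l' = (\<lambda>i. Some (u i))" and rec: "recurrent le u" and b: "lcuts L q b"
    and R': "\<forall>n. R' (u n) (L \<inter> {b n..b (Suc n)})"
    using L unfolding side_def by blast
  have next_j: "\<exists>k>m. tle le (t n) (u k)" for n m
  proof -
    obtain k where k: "tle le (t n) (u k)" using dom[of n "t n"] t u by auto
    have "infinite {i. tle le (u k) (u i)}" using rec by (simp add: recurrent_def)
    then obtain i where i: "i > m" "tle le (u k) (u i)" by (auto simp: infinite_nat_iff_unbounded)
    have "tle le (t n) (u i)" by (rule tle_trans[OF _ k i(2)]) (rule tr)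
    then show ?thesis using i(1) by blast
  qed
  have "\<exists>j. \<forall>n. tle le (t n) (u (j n)) \<and> j n < j (Suc n)"
    by (rule dependent_nat_choice[of "\<lambda>n k. tle le (t n) (u k)" "\<lambda>_ k k'. k < k'"])
       (use next_j in blast)+
  then obtain j where j: "\<And>n. tle le (t n) (u (j n))" "\<And>n. j n < j (Suc n)" by blast
  show ?thesis
  proof (rule embp_omega[where le = le and c = c and d = d and j = j, OF a b])
    show "strict_mono j" using j(2) by (simp add: strict_mono_Suc_iff)
    show "emb le c (K \<inter> {a n..a (Suc n)}) d (L \<inter> {b (j n)..b (Suc (j n))})" for n
      by (rule IH[of n "t n", OF _ R[rule_format] R'[rule_format] j(1)]) (simp add: t)
  qed (rule pq)+
qed

lemma side_piece:
  assumes "side le R K p l" "l i = Some x"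
  shows "\<exists>S\<subseteq>K. R x S"
  using assms unfolding side_def by auto

text \<open>If \<open>s\<close> lies below \<open>t\<close>, then every set represented by \<open>s\<close> embeds in every set represented by \<open>t\<close>.\<close>

lemma rep_emb:
  assumes tr: "\<And>x y z. le x y \<Longrightarrow> le y z \<Longrightarrow> le x z"
  shows "rep le c s K \<Longrightarrow> rep le d t L \<Longrightarrow> tle le s t \<Longrightarrow> emb le c K d L"
proof (induction s arbitrary: K t L rule: tm_child_induct)
  case (child s)
  note IHs = child.IH
  from child.prems(2,3) show ?case
  proof (induction t arbitrary: L rule: tm_child_induct)
    case (child t)
    from child.prems(2) show ?case
    proof (cases rule: tle.cases)
      case (child y)
      have "\<exists>S\<subseteq>L. rep le d y S"
        using \<open>rep le d t L\<close>
      proof (cases rule: rep.cases)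
        case (rep p q l r)
        show ?thesis
        proof (cases "y \<in> lch t")
          case True
          then obtain i where "l i = Some y" using rep by (auto simp: lch_def)
          then show ?thesis using side_piece[OF rep(4)] by blast
        next
          case False
          then obtain i where "r i = Some y" using child rep by (auto simp: rch_def)
          then obtain S where S: "S \<subseteq> uminus ` L" "rep le d y (uminus ` S)"
            using side_piece[OF rep(5)] by blast
          have "uminus ` S \<subseteq> L" using image_mono[OF S(1), of uminus] by (simp only: uminus_uminus_image)
          then show ?thesis using S by blast
        qed
      qed
      then obtain S where "S \<subseteq> L" "rep le d y S" by blast
      then show ?thesis using child.IH[of y S] child emb_mono by blast
    next
      case root
      from \<open>rep le c s K\<close> obtain p l r where p: "p \<in> K" and s: "s = Nd (c p) l r"
        and sl: "side le (rep le c) K p l" and sr: "side le (\<lambda>t S. rep le c t (uminus ` S)) (uminus ` K) (- p) r"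
        by (cases rule: rep.cases) auto
      from \<open>rep le d t L\<close> obtain p' l' r' where p': "p' \<in> L" and t: "t = Nd (d p') l' r'"
        and tl: "side le (rep le d) L p' l'" and tr': "side le (\<lambda>t S. rep le d t (uminus ` S)) (uminus ` L) (- p') r'"
        by (cases rule: rep.cases) auto
      have pp: "le (c p) (d p')" using root s t by simp
      have "embp le c (K \<inter> {..p}) p d (L \<inter> {..p'}) p'"
      proof (rule side_emb[where le = le and c = c and d = d, OF _ sl tl])
        show "le x z" if "le x y" "le y z" for x y z by (rule tr[OF that])
        show "\<exists>k y. l' k = Some y \<and> tle le x y" if "l i = Some x" for i x
        proof -
          have "x \<in> lch s" using that s by (auto simp: lch_def)
          then obtain y where "y \<in> lch t" "tle le x y" using root(2) by blast
          then show ?thesis using t by (auto simp: lch_def)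
        qed
        show "emb le c S d T" if "l i = Some x" "rep le c x S" "rep le d y T" "tle le x y" for i x y S T
          using IHs[of x S y T] that s by (auto simp: lch_def)
      qed (rule pp p')+
      moreover have "embp le c (K \<inter> {p..}) p d (L \<inter> {p'..}) p'"
      proof (rule embp_neg)
        have eq: "uminus ` (K \<inter> {p..}) = uminus ` K \<inter> {..- p}" for K :: "real set" and p
          by auto
        show "embp le (c \<circ> uminus) (uminus ` (K \<inter> {p..})) (- p) (d \<circ> uminus) (uminus ` (L \<inter> {p'..})) (- p')"
          unfolding eq
        proof (rule side_emb[where le = le and c = "c \<circ> uminus" and d = "d \<circ> uminus", OF _ sr tr'])
          show "le ((c \<circ> uminus) (- p)) ((d \<circ> uminus) (- p'))" "- p' \<in> uminus ` L" using pp p' by auto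
          show "le x z" if "le x y" "le y z" for x y z by (rule tr[OF that])
          show "\<exists>k y. r' k = Some y \<and> tle le x y" if "r i = Some x" for i x
          proof -
            have "x \<in> rch s" using that s by (auto simp: rch_def)
            then obtain y where "y \<in> rch t" "tle le x y" using root(3) by blast
            then show ?thesis using t by (auto simp: rch_def)
          qed
          show "emb le (c \<circ> uminus) S (d \<circ> uminus) T"
            if "r i = Some x" "rep le c x (uminus ` S)" "rep le d y (uminus ` T)" "tle le x y" for i x y S T
          proof -
            have "emb le c (uminus ` S) d (uminus ` T)"
              using IHs[of x "uminus ` S" y "uminus ` T"] that s by (auto simp: rch_def)
            then show ?thesis
              using emb_neg[of le c "uminus ` S" d "uminus ` T"] by (simp only: uminus_uminus_image)
          qed
        qed
      qed
      ultimately show ?thesis using p by (rule emb_glue_point)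
    qed
  qed
qed

text \<open>A list of terms represents a set if the set splits at finitely many gaps into consecutive pieces
  represented by the members of the list.\<close>

primrec wrep :: "('q \<Rightarrow> 'q \<Rightarrow> bool) \<Rightarrow> (real \<Rightarrow> 'q) \<Rightarrow> 'q tm list \<Rightarrow> real set \<Rightarrow> bool" where
  "wrep le c [] K \<longleftrightarrow> K = {}"
| "wrep le c (t # ts) K \<longleftrightarrow> (\<exists>a. a \<notin> K \<and> rep le c t (K \<inter> {..a}) \<and> wrep le c ts (K \<inter> {a..}))"

lemma wrep_emb:
  assumes tr: "\<And>x y z. le x y \<Longrightarrow> le y z \<Longrightarrow> le x z"
  shows "list_all2 (tle le) ss ts \<Longrightarrow> wrep le c ss K \<Longrightarrow> wrep le d ts L \<Longrightarrow> emb le c K d L"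
proof (induction arbitrary: K L rule: list_all2_induct)
  case Nil
  then have "emb_fun le c K d L id" by (auto simp: emb_fun_def)
  then show ?case unfolding emb_def by blast
next
  case (Cons s ss t ts)
  obtain a where a: "a \<notin> K" "rep le c s (K \<inter> {..a})" "wrep le c ss (K \<inter> {a..})" using Cons.prems by auto
  obtain b where b: "b \<notin> L" "rep le d t (L \<inter> {..b})" "wrep le d ts (L \<inter> {b..})" using Cons.prems by auto
  show ?case
    by (rule emb_glue_cut[OF rep_emb[OF _ a(2) b(2) Cons.hyps(1)] Cons.IH[OF a(3) b(3)] a(1) b(1)]) (rule tr)
qed

section \<open>Decomposition of countable closed sets into represented pieces\<close>

text \<open>In a wqo, all but finitely many members of a sequence lie below infinitely many members: otherwise
  those that do not would contain a bad subsequence.\<close>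

lemma recurrent_tail:
  assumes wqo: "\<And>u :: nat \<Rightarrow> 'q tm. \<exists>i j. i < j \<and> tle le (u i) (u j)"
  obtains N where "recurrent le (\<lambda>i. t (N + i))"
proof -
  define I where "I = {i. finite {j. tle le (t i) (t j)}}"
  have "finite I"
  proof (rule ccontr)
    assume inf: "infinite I"
    have "\<exists>f. \<forall>n. f n \<in> I \<and> (f n < f (Suc n) \<and> (\<forall>j\<ge>f (Suc n). \<not> tle le (t (f n)) (t j)))"
    proof (rule dependent_nat_choice)
      show "\<exists>x. x \<in> I" using infinite_imp_nonempty[OF inf] by blast
      fix x assume "x \<in> I"
      then have "finite {j. tle le (t x) (t j)}" by (simp add: I_def)
      then obtain m where m: "\<And>j. tle le (t x) (t j) \<Longrightarrow> j < m"
        by (auto simp: finite_nat_set_iff_bounded)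
      obtain y where "y \<in> I" "y > max x m" using inf by (meson infinite_nat_iff_unbounded)
      then show "\<exists>y. y \<in> I \<and> x < y \<and> (\<forall>j\<ge>y. \<not> tle le (t x) (t j))"
        using m by (intro exI[of _ y]) force
    qed
    then obtain f where f: "\<And>n. f n < f (Suc n)" "\<And>n j. j \<ge> f (Suc n) \<Longrightarrow> \<not> tle le (t (f n)) (t j)"
      by blast
    obtain i j where ij: "i < j" "tle le (t (f i)) (t (f j))" using wqo[of "\<lambda>n. t (f n)"] by blast
    have "strict_mono f" using f(1) by (simp add: strict_mono_Suc_iff)
    then have "f (Suc i) \<le> f j" using ij(1) by (simp add: strict_mono_less_eq)
    then show False using f(2) ij(2) by blast
  qed
  then obtain N where N: "\<And>i. i \<in> I \<Longrightarrow> i < N" by (auto simp: finite_nat_set_iff_bounded)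
  have "recurrent le (\<lambda>i. t (N + i))"
    unfolding recurrent_def
  proof
    fix i
    have "N + i \<notin> I" using N by force
    then have inf: "infinite {j. tle le (t (N + i)) (t j)}" by (simp add: I_def)
    have "{j. tle le (t (N + i)) (t j)} \<subseteq> {..<N} \<union> (+) N ` {j. tle le (t (N + i)) (t (N + j))}"
    proof
      fix j assume j: "j \<in> {j. tle le (t (N + i)) (t j)}"
      show "j \<in> {..<N} \<union> (+) N ` {j. tle le (t (N + i)) (t (N + j))}"
      proof (cases "j < N")
        case False
        then have "j = N + (j - N)" by simp
        then show ?thesis using j by (metis (mono_tags, lifting) UnI2 imageI mem_Collect_eq)
      qed simp
    qed
    then show "infinite {j. tle le (t (N + i)) (t (N + j))}"
      using inf by (metis finite_UnI finite_imageI finite_lessThan finite_subset)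
  qed
  then show ?thesis by (rule that)
qed

text \<open>An infinite chain of nonempty finite chains is a single infinite chain. The state \<open>(n, i)\<close> records the
  position \<open>i\<close> inside the \<open>n\<close>-th finite chain.\<close>

lemma flatten_chain:
  fixes S :: "'b \<Rightarrow> 'b \<Rightarrow> bool"
  assumes c: "\<And>n. S\<^sup>+\<^sup>+ (c n) (c (Suc n))"
  obtains s where "s 0 = c (0::nat)" "\<And>i::nat. S (s i) (s (Suc i))" "\<And>n. \<exists>i. s i = c n"
proof -
  have "\<forall>n. \<exists>k g. 0 < k \<and> g 0 = c n \<and> g k = c (Suc n) \<and> (\<forall>i<k. S (g i) (g (Suc i)))"
    using c unfolding tranclp_power relpowp_fun_conv by metis
  then obtain k g where kg: "\<And>n. 0 < k n" "\<And>n. g n 0 = c n" "\<And>n. g n (k n) = c (Suc n)"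
    "\<And>n i. i < k n \<Longrightarrow> S (g n i) (g n (Suc i))" by metis
  define nxt where "nxt = (\<lambda>(n, i). if Suc i < k n then (n, Suc i) else (Suc n, 0))"
  define st where "st m = (nxt ^^ m) (0, 0)" for m
  have st_Suc: "st (Suc m) = nxt (st m)" for m by (simp add: st_def)
  have inv: "snd (st m) < k (fst (st m))" for m
  proof (induction m)
    case 0 then show ?case using kg(1) by (simp add: st_def)
  next
    case (Suc m) then show ?case using kg(1) by (auto simp: st_Suc nxt_def split: prod.split)
  qed
  define s where "s m = g (fst (st m)) (snd (st m))" for m
  have S: "S (s m) (s (Suc m))" for m
  proof -
    obtain n i where ni: "st m = (n, i)" by force
    have i: "i < k n" using inv[of m] ni by simp
    show ?thesis
    proof (cases "Suc i < k n")
      case True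
      then show ?thesis using kg(4)[OF i] by (simp add: s_def st_Suc ni nxt_def)
    next
      case False
      then have "Suc i = k n" using i by simp
      then show ?thesis using kg(4)[OF i] kg(2)[of "Suc n"] kg(3)[of n] False
        by (simp add: s_def st_Suc ni nxt_def)
    qed
  qed
  have reach: "\<exists>m. st m = (n, 0)" for n
  proof (induction n)
    case 0 then show ?case by (intro exI[of _ 0]) (simp add: st_def)
  next
    case (Suc n)
    then obtain m where m: "st m = (n, 0)" by blast
    have "st (m + i) = (n, i)" if "i < k n" for i
      using that by (induction i) (auto simp: m st_Suc nxt_def)
    from this[of "k n - 1"] have "st (m + (k n - 1)) = (n, k n - 1)" using kg(1)[of n] by simp
    then have "st (Suc (m + (k n - 1))) = (Suc n, 0)"
      using kg(1)[of n] unfolding st_Suc nxt_def by simp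
    then show ?case by blast
  qed
  show ?thesis
  proof (rule that[of s])
    show "s 0 = c 0" using kg(2) by (simp add: s_def st_def)
    show "\<exists>i. s i = c n" for n
    proof -
      obtain m where "st m = (n, 0)" using reach by blast
      then have "s m = c n" using kg(2) by (simp add: s_def)
      then show ?thesis by blast
    qed
  qed (rule S)
qed

lemma countable_gap:
  fixes K :: "real set"
  assumes "countable K" "a < b"
  shows "\<exists>z. z \<notin> K \<and> a < z \<and> z < b"
proof (rule ccontr)
  assume "\<not> ?thesis"
  then have "{a<..<b} \<subseteq> K" by force
  then show False using assms uncountable_open_interval countable_subset by blast
qed

text \<open>The points \<open>a < b\<close> are outside \<open>K\<close>, and the piece of \<open>K\<close> between them is represented by a single term.\<close>

definition step :: "('t \<Rightarrow> real set \<Rightarrow> bool) \<Rightarrow> real set \<Rightarrow> real \<Rightarrow> real \<Rightarrow> bool" where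
  "step R K a b \<longleftrightarrow> a < b \<and> a \<notin> K \<and> b \<notin> K \<and> (\<exists>t. R t (K \<inter> {a..b}))"

text \<open>The piece of \<open>K\<close> between \<open>a\<close> and \<open>b\<close> is empty or splits into finitely many represented pieces.\<close>

definition dec :: "('t \<Rightarrow> real set \<Rightarrow> bool) \<Rightarrow> real set \<Rightarrow> real \<Rightarrow> real \<Rightarrow> bool" where
  "dec R K a b \<longleftrightarrow> K \<inter> {a..b} = {} \<or> (step R K)\<^sup>+\<^sup>+ a b"

lemma steps_less: "(step R K)\<^sup>+\<^sup>+ a b \<Longrightarrow> a < b"
  by (induction rule: tranclp_induct) (auto simp: step_def)

lemma steps_extend_left:
  assumes "(step R K)\<^sup>+\<^sup>+ b c" "a \<le> b" "a \<notin> K" "K \<inter> {a..b} = {}"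
  shows "(step R K)\<^sup>+\<^sup>+ a c"
proof -
  obtain z where z: "step R K b z" "(step R K)\<^sup>*\<^sup>* z c" using assms(1) by (meson tranclpD)
  have "K \<inter> {a..z} = K \<inter> {b..z}"
  proof (intro set_eqI iffI)
    fix x assume x: "x \<in> K \<inter> {a..z}"
    then have "\<not> x \<le> b" using assms(4) by auto
    then show "x \<in> K \<inter> {b..z}" using x by auto
  qed (use assms(2) in auto)
  then have "step R K a z" using z(1) assms(2,3) by (auto simp: step_def)
  then show ?thesis using z(2) by (rule rtranclp_into_tranclp2)
qed

lemma steps_extend_right:
  assumes "(step R K)\<^sup>+\<^sup>+ a b" "b \<le> c" "c \<notin> K" "K \<inter> {b..c} = {}"
  shows "(step R K)\<^sup>+\<^sup>+ a c"
proof -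
  obtain z where z: "step R K z b" "(step R K)\<^sup>*\<^sup>* a z" using assms(1) by (metis tranclp.cases tranclp_into_rtranclp rtranclp.rtrancl_refl)
  have "K \<inter> {z..c} = K \<inter> {z..b}"
  proof (intro set_eqI iffI)
    fix x assume x: "x \<in> K \<inter> {z..c}"
    then have "\<not> b \<le> x" using assms(4) by auto
    then show "x \<in> K \<inter> {z..b}" using x by auto
  qed (use assms(2) in auto)
  then have "step R K z c" using z(1) assms(2,3) by (auto simp: step_def)
  then show ?thesis using z(2) by (metis rtranclp_into_tranclp1)
qed

text \<open>Empty pieces are absorbed into a neighbouring represented piece.\<close>

lemma dec_trans:
  assumes "dec R K a b" "dec R K b c" "a \<le> b" "b \<le> c" "a \<notin> K" "c \<notin> K"
  shows "dec R K a c"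
proof -
  consider "K \<inter> {a..b} = {}" "K \<inter> {b..c} = {}" | "K \<inter> {a..b} = {}" "(step R K)\<^sup>+\<^sup>+ b c"
    | "(step R K)\<^sup>+\<^sup>+ a b" "K \<inter> {b..c} = {}" | "(step R K)\<^sup>+\<^sup>+ a b" "(step R K)\<^sup>+\<^sup>+ b c"
    using assms(1,2) unfolding dec_def by blast
  then show ?thesis
  proof cases
    case 1
    have "{a..c} = {a..b} \<union> {b..c}" using assms(3,4) by auto
    then show ?thesis using 1 unfolding dec_def by blast
  next
    case 2 then show ?thesis using steps_extend_left assms unfolding dec_def by blast
  next
    case 3 then show ?thesis using steps_extend_right assms unfolding dec_def by blast
  next
    case 4 then show ?thesis unfolding dec_def by (meson tranclp_trans)
  qed
qed

lemma dec_neg: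
  assumes "dec R K a b"
  shows "dec (\<lambda>t S. R t (uminus ` S)) (uminus ` K) (- b) (- a)"
proof -
  have eq: "uminus ` K \<inter> {- y..- x} = uminus ` (K \<inter> {x..y})" for x y by auto
  have step: "step (\<lambda>t S. R t (uminus ` S)) (uminus ` K) (- y) (- x)" if "step R K x y" for x y
    using that unfolding step_def eq uminus_uminus_image by auto
  have "(step (\<lambda>t S. R t (uminus ` S)) (uminus ` K))\<^sup>+\<^sup>+ (- y) (- x)" if "(step R K)\<^sup>+\<^sup>+ x y" for x y
    using that
  proof (induction rule: tranclp_induct)
    case (base y)
    then show ?case using step by blast
  next
    case (step y z)
    then show ?case using \<open>\<And>y x. step R K x y \<Longrightarrow> _ y x\<close> by (meson tranclp_into_tranclp2)
  qed
  then show ?thesis using assms unfolding dec_def eq by auto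
qed

lemma side_restrict:
  assumes "side le R K p l" "K \<inter> {..<p} = K' \<inter> {..<p}"
  shows "side le R K' p l"
  using assms(1) unfolding side_def
proof (elim disjE exE conjE)
  fix t a assume *: "l = (\<lambda>i. Some (t i))" "recurrent le t" "lcuts K p a" "\<forall>n. R (t n) (K \<inter> {a n..a (Suc n)})"
  have less: "a n < p" for n using *(3) by (rule lcuts_less)
  have sub: "x \<in> K' \<longleftrightarrow> x \<in> K" if "x < p" for x using assms(2) that by blast
  have "lcuts K' p a" using *(3) sub less assms(2) by (auto simp: lcuts_def)
  moreover have "K' \<inter> {a n..a (Suc n)} = K \<inter> {a n..a (Suc n)}" for n
    using sub less[of "Suc n"] by auto
  ultimately show "(l = (\<lambda>_. None) \<and> K' \<inter> {..<p} = {}) \<or>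
     (\<exists>t a. l = (\<lambda>i. Some (t i)) \<and> recurrent le t \<and> lcuts K' p a \<and> (\<forall>n. R (t n) (K' \<inter> {a n..a (Suc n)})))"
    using * by (intro disjI2 exI[of _ t] exI[of _ a]) simp
qed (use assms(2) in auto)

text \<open>Suppose that \<open>K\<close> is decomposable between any two gaps in \<open>[a, p)\<close>. Then beyond a suitable gap
  \<open>a1 < p\<close> the part of \<open>K\<close> to the left of \<open>p\<close> is described by a sequence of terms. If \<open>p\<close> is a limit from the
  left, cut points that increase to \<open>p\<close> give nonempty decomposable pieces; these are flattened to a
  sequence of single terms, a tail of which is recurrent.\<close>

lemma ex_side:
  fixes K :: "real set" and R :: "'q tm \<Rightarrow> real set \<Rightarrow> bool"
  assumes wqo: "\<And>u :: nat \<Rightarrow> 'q tm. \<exists>i j. i < j \<and> tle le (u i) (u j)"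
    and cK: "countable K" and a: "a < p" "a \<notin> K"
    and decs: "\<And>u v. a \<le> u \<Longrightarrow> u \<le> v \<Longrightarrow> v < p \<Longrightarrow> u \<notin> K \<Longrightarrow> v \<notin> K \<Longrightarrow> dec R K u v"
  shows "\<exists>a1 l. a \<le> a1 \<and> a1 < p \<and> a1 \<notin> K \<and> dec R K a a1 \<and> side le R (K \<inter> {a1..}) p l"
proof (cases "\<exists>l<p. K \<inter> {l<..<p} = {}")
  case True
  then obtain l where l: "l < p" "K \<inter> {l<..<p} = {}" by blast
  obtain a1 where a1: "a1 \<notin> K" "max a l < a1" "a1 < p" using countable_gap[OF cK, of "max a l" p] l a by auto
  have "K \<inter> {a1..} \<inter> {..<p} = {}" using l(2) a1 by auto
  then have "side le R (K \<inter> {a1..}) p (\<lambda>_. None)" by (simp add: side_def)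
  then show ?thesis using a1 a decs[of a a1] by (intro exI[of _ a1] exI[of _ "\<lambda>_. None"]) auto
next
  case False
  have nxt: "\<exists>z. z \<notin> K \<and> x < z \<and> z < p \<and> e < z \<and> (step R K)\<^sup>+\<^sup>+ x z"
    if x: "a \<le> x" "x < p" "x \<notin> K" and e: "e < p" for x e
  proof -
    obtain y where y: "y \<in> K" "x < y" "y < p" using False x by fastforce
    obtain z where z: "z \<notin> K" "max y e < z" "z < p" using countable_gap[OF cK, of "max y e" p] y e by auto
    have "dec R K x z" by (rule decs) (use x y z in auto)
    moreover have "y \<in> K \<inter> {x..z}" using y z by auto
    ultimately have "(step R K)\<^sup>+\<^sup>+ x z" unfolding dec_def by blast
    then show ?thesis using z y by (intro exI[of _ z]) auto
  qed
  have "\<exists>f. \<forall>n. (f n \<notin> K \<and> a \<le> f n \<and> f n < p \<and> (n = 0 \<longrightarrow> f n = a)) \<and>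
      (p - 1 / real (Suc n) < f (Suc n) \<and> (step R K)\<^sup>+\<^sup>+ (f n) (f (Suc n)))"
  proof (rule dependent_nat_choice)
    show "\<exists>x. x \<notin> K \<and> a \<le> x \<and> x < p \<and> ((0::nat) = 0 \<longrightarrow> x = a)" using a by auto
    fix x and n :: nat assume x: "x \<notin> K \<and> a \<le> x \<and> x < p \<and> (n = 0 \<longrightarrow> x = a)"
    obtain z where "z \<notin> K" "x < z" "z < p" "p - 1 / real (Suc n) < z" "(step R K)\<^sup>+\<^sup>+ x z"
      using nxt[of x "p - 1 / real (Suc n)"] x by auto
    then show "\<exists>y. (y \<notin> K \<and> a \<le> y \<and> y < p \<and> (Suc n = 0 \<longrightarrow> y = a)) \<and>
        p - 1 / real (Suc n) < y \<and> (step R K)\<^sup>+\<^sup>+ x y" using x by (intro exI[of _ z]) auto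
  qed
  then obtain f where f: "\<And>n. f n < p" "\<And>n. p - 1 / real (Suc n) < f (Suc n)"
    "\<And>n. (step R K)\<^sup>+\<^sup>+ (f n) (f (Suc n))" and f0: "f 0 = a" by blast
  obtain s where s: "s 0 = a" "\<And>i. step R K (s i) (s (Suc i))" "\<And>n. \<exists>i. s i = f n"
    using flatten_chain[of "step R K" f] f(3) f0 by metis
  have mono: "strict_mono s" using s(2) by (simp add: strict_mono_Suc_iff step_def)
  have f_mono: "strict_mono f" using steps_less[OF f(3)] by (simp add: strict_mono_Suc_iff)
  have s_less: "s i < p" for i
  proof (rule ccontr)
    assume "\<not> s i < p"
    have "\<exists>k. s k = f n \<and> n \<le> k" for n
    proof (induction n)
      case (Suc n)
      then obtain k where k: "s k = f n" "n \<le> k" by blast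
      obtain k' where k': "s k' = f (Suc n)" using s(3) by blast
      have "f n < f (Suc n)" using f_mono by (simp add: strict_mono_Suc_iff)
      then have "k < k'" using k k' mono strict_mono_less by metis
      then show ?case using k k' by (intro exI[of _ k']) auto
    qed (use s f0 in auto)
    then obtain k where "s k = f i" "i \<le> k" by blast
    then have "s i \<le> f i" using mono by (metis strict_mono_less_eq)
    then show False using f(1)[of i] \<open>\<not> s i < p\<close> by simp
  qed
  have lim: "s \<longlonglongrightarrow> p"
  proof (rule order_tendstoI)
    fix l assume "l < p"
    then obtain n where n: "inverse (real (Suc n)) < p - l" using reals_Archimedean[of "p - l"] by auto
    obtain i where i: "s i = f (Suc n)" using s(3) by blast
    have "l < s i" using f(2)[of n] n i by (simp add: inverse_eq_divide)
    have "l < s m" if "m \<ge> i" for m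
      using \<open>l < s i\<close> mono that by (metis less_le_trans strict_mono_less_eq)
    then show "eventually (\<lambda>m. l < s m) sequentially" by (auto simp: eventually_sequentially)
  next
    fix u assume "p < u"
    then show "eventually (\<lambda>m. s m < u) sequentially" using s_less by (auto intro: always_eventually less_trans)
  qed
  obtain t where t: "\<And>i. R (t i) (K \<inter> {s i..s (Suc i)})" using s(2) unfolding step_def by metis
  obtain N where N: "recurrent le (\<lambda>i. t (N + i))" using recurrent_tail[where t = t, OF wqo] by blast
  have nin: "s i \<notin> K" for i using s(2)[of i] by (simp add: step_def)
  have aN: "a \<le> s N" using mono s(1) by (metis le0 strict_mono_less_eq)
  have "lcuts (K \<inter> {s N..}) p (\<lambda>i. s (N + i))"
    unfolding lcuts_def
  proof (intro conjI allI)
    show "strict_mono (\<lambda>i. s (N + i))" using mono by (simp add: strict_mono_def)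
    show "(\<lambda>i. s (N + i)) \<longlonglongrightarrow> p" using LIMSEQ_ignore_initial_segment[OF lim, of N] by (simp add: add.commute)
    show "K \<inter> {s N..} \<inter> {..<p} \<subseteq> {s (N + 0)<..}" using nin[of N] by (auto simp: order_less_le)
  qed (use nin in auto)
  moreover have "K \<inter> {s N..} \<inter> {s (N + n)..s (N + Suc n)} = K \<inter> {s (N + n)..s (Suc (N + n))}" for n
  proof -
    have "s N \<le> s (N + n)" using mono by (simp add: strict_mono_less_eq)
    then show ?thesis by auto
  qed
  ultimately have "side le R (K \<inter> {s N..}) p (\<lambda>i. Some (t (N + i)))"
    unfolding side_def using N t by (intro disjI2 exI[of _ "\<lambda>i. t (N + i)"] exI[of _ "\<lambda>i. s (N + i)"]) simp
  moreover have "dec R K a (s N)" by (rule decs) (use aN s_less nin a in auto)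
  ultimately show ?thesis using aN s_less nin by blast
qed

text \<open>Otherwise the complements of points would be countably many dense relatively open subsets of \<open>B\<close>
  with empty intersection.\<close>

lemma countable_closed_isolated:
  fixes B :: "real set"
  assumes "closed B" "countable B" "B \<noteq> {}"
  shows "\<exists>p\<in>B. \<exists>e>0. \<forall>y\<in>B. \<bar>y - p\<bar> < e \<longrightarrow> y = p"
proof (rule ccontr)
  assume no: "\<not> ?thesis"
  have "B \<subseteq> closure (\<Inter>((\<lambda>x. B - {x}) ` B))"
  proof (rule Baire[OF assms(1)])
    show "countable ((\<lambda>x. B - {x}) ` B)" using assms(2) by simp
    fix T assume "T \<in> (\<lambda>x. B - {x}) ` B"
    then obtain x where x: "x \<in> B" "T = B - {x}" by blast
    have "openin (top_of_set B) T"
      unfolding openin_open by (rule exI[of _ "- {x}"]) (use x in auto)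
    moreover have "x \<in> closure T"
      unfolding closure_approachable using no x by (force simp: dist_real_def)
    then have "B \<subseteq> closure T" using x closure_subset[of T] by blast
    ultimately show "openin (top_of_set B) T \<and> B \<subseteq> closure T" by blast
  qed
  moreover have "\<Inter>((\<lambda>x. B - {x}) ` B) = {}" using assms(3) by auto
  ultimately show False using assms(3) by simp
qed

text \<open>Call \<open>x\<close> good if \<open>K\<close> is decomposable between all gaps near \<open>x\<close>. By compactness of intervals, \<open>K\<close> is
  decomposable between gaps if all points between them are good. The set of bad points is a closed subset
  of \<open>K\<close>. If it were nonempty, it would have an isolated point \<open>p\<close>; by \<open>ex_side\<close>, applied to both
  sides of \<open>p\<close>, a neighbourhood of \<open>p\<close> is represented by a single term with root \<open>p\<close>, so that \<open>p\<close>
  would be good.\<close>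

lemma decomposition:
  fixes K :: "real set" and c :: "real \<Rightarrow> 'q"
  assumes wqo: "\<And>u :: nat \<Rightarrow> 'q tm. \<exists>i j. i < j \<and> tle le (u i) (u j)"
    and cK: "countable K" and clK: "closed K"
    and uv: "u \<le> v" "u \<notin> K" "v \<notin> K"
  shows "dec (rep le c) K u v"
proof -
  let ?R = "rep le c"
  define near where "near e x y \<longleftrightarrow>
    (\<forall>a b. a \<notin> K \<longrightarrow> b \<notin> K \<longrightarrow> x - e < a \<longrightarrow> a \<le> b \<longrightarrow> b < y + e \<longrightarrow> dec ?R K a b)" for e x y
  have nearD: "dec ?R K a b" if "near e x y" "a \<notin> K" "b \<notin> K" "x - e < a" "a \<le> b" "b < y + e" for e x y a b
    using that unfolding near_def by blast
  define good where "good x \<longleftrightarrow> (\<exists>e>0. near e x x)" for x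
  have cover: "\<exists>e>0. near e x y" if xy: "x \<le> y" and gd: "\<And>z. x \<le> z \<Longrightarrow> z \<le> y \<Longrightarrow> good z" for x y
  proof -
    have "x \<le> x \<and> y \<le> y \<longrightarrow> (\<exists>e>0. near e x y)"
      using xy
    proof (induction rule: Bolzano[where P = "\<lambda>x' y'. x \<le> x' \<and> y' \<le> y \<longrightarrow> (\<exists>e>0. near e x' y')"])
      case (trans p q r)
      show ?case
      proof
        assume pr: "x \<le> p \<and> r \<le> y"
        obtain e1 where e1: "e1 > 0" "near e1 p q" using trans pr by auto
        obtain e2 where e2: "e2 > 0" "near e2 q r" using trans pr by auto
        define e where "e = min e1 e2"
        have "near e p r"
          unfolding near_def
        proof (intro allI impI)
          fix a b assume ab: "a \<notin> K" "b \<notin> K" "p - e < a" "a \<le> b" "b < r + e"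
          consider "b < q + e" | "q - e < a" | "a \<le> q - e" "q + e \<le> b" by linarith
          then show "dec ?R K a b"
          proof cases
            case 1 then show ?thesis using ab nearD[OF e1(2), of a b] by (auto simp: e_def)
          next
            case 2 then show ?thesis using ab nearD[OF e2(2), of a b] by (auto simp: e_def)
          next
            case 3
            have "e > 0" using e1 e2 by (simp add: e_def)
            \<comment> \<open>The common end point \<open>q\<close> may belong to \<open>K\<close>; the intervals are joined at a gap near it, inside the
            margin around both.\<close>
            then obtain d where d: "d \<notin> K" "q - e < d" "d < q + e" using countable_gap[OF cK, of "q - e" "q + e"] by auto
            have "dec ?R K a d" using nearD[OF e1(2), of a d] ab d 3 by (auto simp: e_def)
            moreover have "dec ?R K d b" using nearD[OF e2(2), of d b] ab d 3 by (auto simp: e_def)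
            ultimately show ?thesis by (rule dec_trans) (use ab d 3 in auto)
          qed
        qed
        then show "\<exists>e>0. near e p r" using e1 e2 by (intro exI[of _ e]) (auto simp: e_def)
      qed
    next
      case (local z)
      obtain e where e: "e > 0" "near e z z" using gd[OF local] unfolding good_def by blast
      have "near (e/2) a b" if "a \<le> z" "z \<le> b" "b - a < e/2" for a b
        unfolding near_def
      proof (intro allI impI)
        fix a' b' assume "a' \<notin> K" "b' \<notin> K" "a - e/2 < a'" "a' \<le> b'" "b' < b + e/2"
        then show "dec ?R K a' b'" using nearD[OF e(2), of a' b'] that by auto
      qed
      then show ?case using e(1) by (intro exI[of _ "e/2"]) (auto intro!: exI[of _ "e/2"])
    qed
    then show ?thesis by simp
  qed
  have dec_good: "dec ?R K x y" if xy: "x \<le> y" "x \<notin> K" "y \<notin> K" and gd: "\<And>z. x \<le> z \<Longrightarrow> z \<le> y \<Longrightarrow> good z" for x y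
  proof -
    obtain e where "e > 0" "near e x y" using cover[OF xy(1) gd] by blast
    then show ?thesis using nearD[of e x y x y] xy by simp
  qed
  define Bad where "Bad = {x. \<not> good x}"
  have good_off: "good x" if xK: "x \<notin> K" for x
  proof -
    obtain e where e: "e > 0" "\<And>y. dist y x < e \<Longrightarrow> y \<notin> K"
      using clK xK unfolding closed_def open_dist by (metis ComplD ComplI)
    have "near e x x"
      unfolding near_def
    proof (intro allI impI)
      fix a b assume ab: "x - e < a" "a \<le> b" "b < x + e"
      have "K \<inter> {a..b} = {}" using e(2) ab by (force simp: dist_real_def)
      then show "dec ?R K a b" by (simp add: dec_def)
    qed
    then show ?thesis using e(1) by (auto simp: good_def)
  qed
  have "open {x. good x}"
    unfolding open_dist
  proof
    fix x assume "x \<in> {x. good x}"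
    then obtain e where e: "e > 0" "near e x x" by (auto simp: good_def)
    have "good y" if "dist y x < e/2" for y
    proof -
      have "near (e/2) y y"
        unfolding near_def
      proof (intro allI impI)
        fix a b assume "a \<notin> K" "b \<notin> K" "y - e/2 < a" "a \<le> b" "b < y + e/2"
        moreover from that have "x - e/2 < y" "y < x + e/2" unfolding dist_real_def abs_less_iff by linarith+
        ultimately show "dec ?R K a b" using nearD[OF e(2), of a b] by simp
      qed
      then show ?thesis using e(1) unfolding good_def by (intro exI[of _ "e/2"]) simp
    qed
    then show "\<exists>e>0. \<forall>y. dist y x < e \<longrightarrow> y \<in> {x. good x}" using e(1) by (intro exI[of _ "e/2"]) simp
  qed
  then have clBad: "closed Bad" by (simp add: Bad_def closed_def Compl_eq)
  have BadK: "Bad \<subseteq> K" using good_off by (auto simp: Bad_def)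
  have "Bad = {}"
  proof (rule ccontr)
    assume "Bad \<noteq> {}"
    then obtain p e where p: "p \<in> Bad" and e: "e > 0" "\<And>y. y \<in> Bad \<Longrightarrow> \<bar>y - p\<bar> < e \<Longrightarrow> y = p"
      using countable_closed_isolated[OF clBad countable_subset[OF BadK cK]] by blast
    have pK: "p \<in> K" using p BadK by blast
    have goodnear: "good z" if "p - e < z" "z < p + e" "z \<noteq> p" for z
    proof -
      have "\<bar>z - p\<bar> < e" using that by linarith
      then show ?thesis using e(2)[of z] that(3) by (auto simp: Bad_def)
    qed
    have "near e p p"
      unfolding near_def
    proof (intro allI impI)
      fix a b assume ab: "a \<notin> K" "b \<notin> K" "p - e < a" "a \<le> b" "b < p + e"
      have "a \<noteq> p" "b \<noteq> p" using ab pK by auto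
      then consider "p < a" | "b < p" | "a < p" "p < b" by linarith
      then show "dec ?R K a b"
      proof cases
        case 1 then show ?thesis using ab by (intro dec_good goodnear) auto
      next
        case 2 then show ?thesis using ab by (intro dec_good goodnear) auto
      next
        case 3
        let ?R' = "\<lambda>t S. rep le c t (uminus ` S)"
        have decL: "dec ?R K x y" if "a \<le> x" "x \<le> y" "y < p" "x \<notin> K" "y \<notin> K" for x y
          using that ab by (intro dec_good goodnear) auto
        have decR: "dec ?R' (uminus ` K) x y" if "- b \<le> x" "x \<le> y" "y < - p" "x \<notin> uminus ` K" "y \<notin> uminus ` K" for x y
        proof -
          have "- x \<notin> K" "- y \<notin> K" using that(4,5) by force+
          then have "dec ?R K (- y) (- x)" using that(1-3) ab by (intro dec_good goodnear) auto
          from dec_neg[OF this] show ?thesis by simp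
        qed
        obtain a1 l where a1: "a \<le> a1" "a1 < p" "a1 \<notin> K" "dec ?R K a a1" "side le ?R (K \<inter> {a1..}) p l"
          using ex_side[OF wqo cK 3(1) ab(1) decL] by blast
        have "countable (uminus ` K)" "- b < - p" "- b \<notin> uminus ` K" using cK 3 ab by auto
        from ex_side[OF wqo this decR] obtain b1 r where b1: "- b \<le> b1" "b1 < - p" "b1 \<notin> uminus ` K"
          "dec ?R' (uminus ` K) (- b) b1" "side le ?R' (uminus ` K \<inter> {b1..}) (- p) r"
          by blast
        have decb: "dec ?R K (- b1) b" using dec_neg[OF b1(4)] by (simp add: image_image)
        have b1K: "- b1 \<notin> K" using b1(3) by force
        define M where "M = K \<inter> {a1..- b1}"
        have "rep le c (Nd (c p) l r) M"
        proof (rule rep.rep)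
          show "p \<in> M" using pK a1 b1 by (auto simp: M_def)
          show "side le (rep le c) M p l"
            by (rule side_restrict[OF a1(5)]) (use b1 in \<open>auto simp: M_def\<close>)
          show "side le ?R' (uminus ` M) (- p) r"
            by (rule side_restrict[OF b1(5)]) (use a1 in \<open>auto simp: M_def\<close>)
        qed simp
        then have "step ?R K a1 (- b1)"
          using a1 b1 b1K unfolding step_def M_def by auto
        then have "dec ?R K a1 (- b1)" unfolding dec_def by blast
        with a1(4) have "dec ?R K a (- b1)" by (rule dec_trans) (use a1 b1 ab b1K in auto)
        then show ?thesis using decb by (rule dec_trans) (use a1 b1 ab in auto)
      qed
    qed
    then have "good p" using e(1) by (auto simp: good_def)
    then show False using p by (simp add: Bad_def)
  qed
  then show ?thesis using dec_good[OF uv] by (auto simp: Bad_def)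
qed

lemma dec_wrep:
  assumes "dec (rep le c) K u v" "v \<notin> K"
  shows "\<exists>ts. wrep le c ts (K \<inter> {u..v})"
proof -
  have "\<exists>ts. wrep le c ts (K \<inter> {u..v})" if "(step (rep le c) K)\<^sup>*\<^sup>* u v"
    using that
  proof (induction rule: converse_rtranclp_induct)
    case base
    have "K \<inter> {v..v} = {}" using assms(2) by auto
    then show ?case by (intro exI[of _ "[]"]) simp
  next
    case (step a z)
    then obtain ts where ts: "wrep le c ts (K \<inter> {z..v})" by blast
    obtain t where t: "a < z" "z \<notin> K" "rep le c t (K \<inter> {a..z})" using step(1) by (auto simp: step_def)
    have zv: "z \<le> v" using steps_less[of "rep le c" K z v] rtranclpD[OF step(2)] by auto
    have "K \<inter> {a..v} \<inter> {..z} = K \<inter> {a..z}" "K \<inter> {a..v} \<inter> {z..} = K \<inter> {z..v}"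
      using t(1) zv by auto
    then have "z \<notin> K \<inter> {a..v} \<and> rep le c t (K \<inter> {a..v} \<inter> {..z}) \<and> wrep le c ts (K \<inter> {a..v} \<inter> {z..})"
      using t ts by simp
    then have "wrep le c (t # ts) (K \<inter> {a..v})" unfolding wrep.simps by (rule exI)
    then show ?case by blast
  qed
  moreover have "\<exists>ts. wrep le c ts (K \<inter> {u..v})" if "K \<inter> {u..v} = {}"
    using that by (intro exI[of _ "[]"]) simp
  ultimately show ?thesis using assms(1) unfolding dec_def by (meson tranclp_into_rtranclp)
qed

section \<open>Counting terms up to equivalence\<close>

lemma countable_iff_le_natLeq: "countable A \<longleftrightarrow> |A| \<le>o natLeq"
proof -
  have "countable A \<longleftrightarrow> |A| \<le>o |UNIV :: nat set|"
    unfolding countable_def card_of_ordLeq[symmetric] by auto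
  then show ?thesis using card_of_nat ordLeq_ordIso_trans ordIso_symmetric by blast
qed

text \<open>The first uncountable cardinal; as a well-ordering of type \<open>\<omega>\<^sub>1\<close> it also serves to rank terms.\<close>

abbreviation (input) aleph1 :: "nat set rel" where "aleph1 \<equiv> cardSuc natLeq"

lemma aleph1_Card_order: "Card_order aleph1"
  by (rule cardSuc_Card_order[OF natLeq_Card_order])

lemma aleph1_infinite: "\<not> finite (Field aleph1)"
  using cardSuc_finite[OF natLeq_Card_order] Field_natLeq by simp

lemma natLeq_le_aleph1: "natLeq \<le>o aleph1"
  by (rule cardSuc_ordLeq[OF natLeq_Card_order])

lemma countable_le_aleph1: "countable A \<Longrightarrow> |A| \<le>o aleph1"
  unfolding countable_iff_le_natLeq by (erule ordLeq_transitive) (rule natLeq_le_aleph1)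

lemma uncountable_ge_aleph1:
  assumes "\<not> countable A" shows "aleph1 \<le>o |A|"
proof -
  have "natLeq <o |A|"
    using assms unfolding countable_iff_le_natLeq
    using not_ordLeq_iff_ordLess card_of_Well_order natLeq_Well_order by blast
  then show ?thesis using cardSuc_ordLess_ordLeq[OF natLeq_Card_order card_of_Card_order] by blast
qed

lemma uncountable_aleph1: "\<not> countable (Field aleph1)"
proof
  assume "countable (Field aleph1)"
  then have "|Field aleph1| \<le>o natLeq" unfolding countable_iff_le_natLeq .
  moreover have "|Field aleph1| =o aleph1" by (rule card_of_Field_ordIso[OF aleph1_Card_order])
  ultimately have "aleph1 \<le>o natLeq" using ordIso_symmetric ordIso_ordLeq_trans by blast
  then show False using cardSuc_greater[OF natLeq_Card_order] not_ordLess_ordLeq by blast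
qed

lemma countable_underS_aleph1: "a \<in> Field aleph1 \<Longrightarrow> countable (underS aleph1 a)"
  unfolding countable_iff_le_natLeq
  using card_of_underS[OF aleph1_Card_order] cardSuc_ordLeq_ordLess[OF natLeq_Card_order card_of_Card_order]
  by blast

lemma aleph1_wo: "Well_order aleph1"
  using aleph1_Card_order by (simp add: card_order_on_def)

lemma countable_bounded_aleph1:
  assumes "countable N" "N \<subseteq> Field aleph1"
  shows "\<exists>a\<in>Field aleph1. N \<subseteq> underS aleph1 a"
proof -
  define U where "U = (\<Union>b\<in>N. insert b (underS aleph1 b))"
  have "countable (insert b (underS aleph1 b))" if "b \<in> N" for b
    using countable_underS_aleph1[of b] that assms(2) by auto
  then have "countable U" unfolding U_def using assms(1) by simp
  then have "\<not> Field aleph1 \<subseteq> U" using uncountable_aleph1 countable_subset by metis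
  then obtain a where a: "a \<in> Field aleph1" "a \<notin> U" by auto
  have tot: "Total aleph1" using aleph1_wo by (simp add: order_on_defs)
  have "b \<in> underS aleph1 a" if b: "b \<in> N" for b
  proof -
    have "a \<noteq> b" "a \<notin> underS aleph1 b" using a(2) b by (auto simp: U_def)
    then have "(a, b) \<notin> aleph1" by (auto simp: underS_def)
    then have "(b, a) \<in> aleph1" using tot a(1) b assms(2) \<open>a \<noteq> b\<close> unfolding total_on_def by blast
    then show ?thesis using \<open>a \<noteq> b\<close> by (auto simp: underS_def)
  qed
  then show ?thesis using a(1) by blast
qed

lemma wo_aleph1_induct:
  assumes "\<And>a. (\<And>b. b \<in> underS aleph1 a \<Longrightarrow> P b) \<Longrightarrow> P a"
  shows "P a"
proof -
  have "wf (aleph1 - Id)" using aleph1_wo by (simp add: well_order_on_def)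
  then show ?thesis
  proof (induction a rule: wf_induct_rule)
    case (less a)
    show ?case by (rule assms) (rule less, auto simp: underS_def)
  qed
qed

lemma lists_le_aleph1:
  assumes "|N| \<le>o aleph1" shows "|lists N| \<le>o aleph1"
proof -
  define L where "L n = {xs\<in>lists N. length xs = n}" for n
  have "|L n| \<le>o aleph1" for n
  proof (induction n)
    case 0
    have "L 0 \<subseteq> {[]}" by (auto simp: L_def)
    then have "countable (L 0)" by (meson countable_empty countable_insert countable_subset)
    then show ?case by (rule countable_le_aleph1)
  next
    case (Suc n)
    have "L (Suc n) \<subseteq> (\<lambda>(x, xs). x # xs) ` (N \<times> L n)"
    proof
      fix xs assume "xs \<in> L (Suc n)"
      then show "xs \<in> (\<lambda>(x, xs). x # xs) ` (N \<times> L n)" by (cases xs) (auto simp: L_def)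
    qed
    then have "|L (Suc n)| \<le>o |(\<lambda>(x, xs). x # xs) ` (N \<times> L n)|" by (rule card_of_mono1)
    also have "|(\<lambda>(x, xs). x # xs) ` (N \<times> L n)| \<le>o |N \<times> L n|" by (rule card_of_image)
    also have "|N \<times> L n| \<le>o aleph1"
      by (rule card_of_Times_ordLeq_infinite_Field[OF aleph1_infinite assms Suc aleph1_Card_order])
    finally show ?case .
  qed
  then have "|\<Union>n\<in>(UNIV::nat set). L n| \<le>o aleph1"
    by (intro card_of_UNION_ordLeq_infinite_Field[OF aleph1_infinite aleph1_Card_order])
       (auto intro: countable_le_aleph1)
  moreover have "lists N = (\<Union>n\<in>(UNIV::nat set). L n)" by (auto simp: L_def)
  ultimately show ?thesis by simp
qed

text \<open>The complement of a downward closed set is generated by a finite set, by the wqo property.\<close>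

lemma countable_downsets:
  fixes R :: "'t \<Rightarrow> 't \<Rightarrow> bool"
  assumes refl: "\<And>x. R x x"
    and wqo: "\<And>u :: nat \<Rightarrow> 't. \<exists>i j. i < j \<and> R (u i) (u j)" and M: "countable M"
  shows "countable {D. D \<subseteq> M \<and> (\<forall>s\<in>D. \<forall>s'\<in>M. R s' s \<longrightarrow> s' \<in> D)}"
proof -
  define G where "G F = {s\<in>M. \<forall>f\<in>F. \<not> R f s}" for F
  have basis: "\<exists>F. finite F \<and> F \<subseteq> M \<and> D = G F"
    if D: "D \<subseteq> M" and dn: "\<And>s s'. s \<in> D \<Longrightarrow> s' \<in> M \<Longrightarrow> R s' s \<Longrightarrow> s' \<in> D" for D
  proof -
    have "\<exists>F. finite F \<and> F \<subseteq> M - D \<and> (\<forall>s\<in>M - D. \<exists>f\<in>F. R f s)"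
    proof (rule ccontr)
      assume no: "\<not> ?thesis"
      have "\<exists>g. \<forall>n. (finite (fst (g n)) \<and> fst (g n) \<subseteq> M - D \<and> snd (g n) \<in> M - D) \<and>
          (fst (g (Suc n)) = insert (snd (g n)) (fst (g n)) \<and> (\<forall>f\<in>fst (g (Suc n)). \<not> R f (snd (g (Suc n)))))"
      proof (rule dependent_nat_choice)
        have "M - D \<noteq> {}" using no by (metis Diff_iff empty_iff empty_subsetI finite.emptyI)
        then obtain s where "s \<in> M - D" by blast
        then show "\<exists>x. finite (fst x) \<and> fst x \<subseteq> M - D \<and> snd x \<in> M - D"
          by (intro exI[of _ "({}, s)"]) simp
        fix x assume x: "finite (fst x) \<and> fst x \<subseteq> M - D \<and> snd x \<in> M - D"
        let ?F = "insert (snd x) (fst x)"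
        have "finite ?F" "?F \<subseteq> M - D" using x by auto
        then have "\<not> (\<forall>s\<in>M - D. \<exists>f\<in>?F. R f s)" using no by metis
        then obtain s where "s \<in> M - D" "\<forall>f\<in>?F. \<not> R f s" by auto
        then show "\<exists>y. (finite (fst y) \<and> fst y \<subseteq> M - D \<and> snd y \<in> M - D) \<and>
            fst y = insert (snd x) (fst x) \<and> (\<forall>f\<in>fst y. \<not> R f (snd y))"
          using x by (intro exI[of _ "(?F, s)"]) simp
      qed
      then obtain g where g: "\<And>n. fst (g (Suc n)) = insert (snd (g n)) (fst (g n))"
        "\<And>n. \<forall>f\<in>fst (g (Suc n)). \<not> R f (snd (g (Suc n)))" by metis
      have mem: "snd (g i) \<in> fst (g j)" if "i < j" for i j
        using that by (induction j) (auto simp: g(1) less_Suc_eq)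
      obtain i j where ij: "i < j" "R (snd (g i)) (snd (g j))" using wqo[of "\<lambda>n. snd (g n)"] by blast
      then obtain k where "j = Suc k" by (cases j) auto
      then show False using g(2)[of k] mem[OF ij(1)] ij(2) by auto
    qed
    then obtain F where F: "finite F" "F \<subseteq> M - D" "\<forall>s\<in>M - D. \<exists>f\<in>F. R f s" by blast
    have "D = G F"
    proof (intro set_eqI iffI)
      fix s assume s: "s \<in> D"
      have "\<not> R f s" if "f \<in> F" for f using dn[OF s, of f] that F(2) by blast
      then show "s \<in> G F" using s D by (auto simp: G_def)
    next
      fix s assume "s \<in> G F"
      then show "s \<in> D" using F(3) unfolding G_def by blast
    qed
    then show ?thesis using F by blast
  qed
  have "{D. D \<subseteq> M \<and> (\<forall>s\<in>D. \<forall>s'\<in>M. R s' s \<longrightarrow> s' \<in> D)} \<subseteq> G ` {F. finite F \<and> F \<subseteq> M}"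
  proof
    fix D assume "D \<in> {D. D \<subseteq> M \<and> (\<forall>s\<in>D. \<forall>s'\<in>M. R s' s \<longrightarrow> s' \<in> D)}"
    then have "\<exists>F. finite F \<and> F \<subseteq> M \<and> D = G F" by (intro basis) simp_all
    then show "D \<in> G ` {F. finite F \<and> F \<subseteq> M}" by (elim exE conjE) (intro image_eqI CollectI conjI)
  qed
  moreover have "countable (G ` {F. finite F \<and> F \<subseteq> M})"
    using countable_Collect_finite_subset[OF M] by (rule countable_image)
  ultimately show ?thesis by (rule countable_subset)
qed

text \<open>The rank of \<open>t\<close> is at most \<open>a\<close>.\<close>

inductive level :: "nat set \<Rightarrow> 'q tm \<Rightarrow> bool" where
  "a \<in> Field aleph1 \<Longrightarrow> \<forall>x\<in>lch t \<union> rch t. \<exists>b\<in>underS aleph1 a. level b x \<Longrightarrow> level a t"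

lemma countable_children: "countable (lch t \<union> rch t)"
proof -
  have "lch t \<subseteq> range (\<lambda>i. the (lsub t i))"
    unfolding lch_def by (auto, metis option.sel rangeI)
  moreover have "rch t \<subseteq> range (\<lambda>i. the (rsub t i))"
    unfolding rch_def by (auto, metis option.sel rangeI)
  ultimately show ?thesis
    using countable_subset[OF _ countable_image[OF countableI_type]] by (intro countable_Un) blast+
qed

lemma ex_level: "\<exists>a. level a t"
proof (induction t rule: tm_child_induct)
  case (child t)
  then obtain a where a: "\<And>x. x \<in> lch t \<union> rch t \<Longrightarrow> level (a x) x" by metis
  have "a ` (lch t \<union> rch t) \<subseteq> Field aleph1" using a by (auto elim!: level.cases)
  then obtain b where b: "b \<in> Field aleph1" "a ` (lch t \<union> rch t) \<subseteq> underS aleph1 b"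
    using countable_bounded_aleph1[of "a ` (lch t \<union> rch t)"] countable_children[of t] by auto
  have "level b t" by (rule level.intros[OF b(1)]) (use a b(2) in blast)
  then show ?case by blast
qed

text \<open>By induction on \<open>a\<close>, the terms of rank at most \<open>a\<close> lie in countably many classes: if \<open>M\<close> contains
  representatives for all smaller ranks, then a term is determined up to equivalence by its \<open>code\<close>, which
  consists of a representative of its label and the sets of members of \<open>M\<close> that lie below one of its left,
  respectively right, subterms.\<close>

lemma tm_classes_le_aleph1:
  fixes le :: "'q \<Rightarrow> 'q \<Rightarrow> bool"
  assumes refl: "\<And>x. le x x" and tr: "\<And>x y z. le x y \<Longrightarrow> le y z \<Longrightarrow> le x z"
    and wqo: "\<And>u :: nat \<Rightarrow> 'q tm. \<exists>i j. i < j \<and> tle le (u i) (u j)"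
    and C: "countable C" "\<And>q. \<exists>c\<in>C. le q c \<and> le c q"
  obtains N :: "'q tm set" where "|N| \<le>o aleph1" "\<And>t. \<exists>s\<in>N. tle le t s \<and> tle le s t"
proof -
  have ttr: "tle le x z" if "tle le x y" "tle le y z" for x y z
    by (rule tle_trans[OF _ that]) (rule tr)
  have levels: "\<exists>N :: 'q tm set. countable N \<and> (\<forall>t. level a t \<longrightarrow> (\<exists>s\<in>N. tle le t s \<and> tle le s t))" for a
  proof (induction a rule: wo_aleph1_induct)
    case (1 a)
    show ?case
    proof (cases "a \<in> Field aleph1")
      case False
      then have "\<not> level a t" for t :: "'q tm" by (auto elim: level.cases)
      then show ?thesis by (intro exI[of _ "{}"]) simp
    next
      case aF: True
      obtain N where N: "\<And>b. b \<in> underS aleph1 a \<Longrightarrow> countable (N b)"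
        "\<And>b t. b \<in> underS aleph1 a \<Longrightarrow> level b t \<Longrightarrow> \<exists>s\<in>N b. tle le t s \<and> tle le s (t :: 'q tm)"
        using 1 by metis
      define M where "M = (\<Union>b\<in>underS aleph1 a. N b)"
      have cM: "countable M" unfolding M_def using countable_underS_aleph1[OF aF] N(1) by (rule countable_UN)
      define Dn where "Dn = {D. D \<subseteq> M \<and> (\<forall>s\<in>D. \<forall>s'\<in>M. tle le s' s \<longrightarrow> s' \<in> D)}"
      have cD: "countable Dn" unfolding Dn_def
        by (rule countable_downsets[OF tle_refl[OF refl] wqo cM])
      define cq where "cq q = (SOME c. c \<in> C \<and> le q c \<and> le c q)" for q
      have cq: "cq q \<in> C" "le q (cq q)" "le (cq q) q" for q
        unfolding cq_def using someI_ex[of "\<lambda>c. c \<in> C \<and> le q c \<and> le c q"] C(2)[of q] by blast+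
      define dn where "dn X = {s\<in>M. \<exists>x\<in>X. tle le s x}" for X
      define code where "code t = (cq (lab t), dn (lch t), dn (rch t))" for t
      have "dn X \<in> Dn" for X unfolding Dn_def dn_def using ttr by blast
      then have code_in: "code t \<in> C \<times> Dn \<times> Dn" for t using cq by (simp add: code_def)
      have child: "\<exists>s\<in>M. tle le x s \<and> tle le s x" if lv: "level a t" and x: "x \<in> lch t \<union> rch t" for t x :: "'q tm"
      proof -
        from lv have "\<forall>x\<in>lch t \<union> rch t. \<exists>b\<in>underS aleph1 a. level b x" by (rule level.cases) simp
        then obtain b where "b \<in> underS aleph1 a" "level b x" using x by blast
        then show ?thesis using N(2)[of b x] by (auto simp: M_def)
      qed
      have dom: "\<exists>y\<in>Y. tle le x y"
        if X: "x \<in> X" "\<exists>s\<in>M. tle le x s \<and> tle le s x" and eq: "dn X = dn Y" for x X Y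
      proof -
        obtain s where s: "s \<in> M" "tle le x s" "tle le s x" using X(2) by blast
        then have "s \<in> dn Y" unfolding eq[symmetric] using X(1) by (auto simp: dn_def)
        then show ?thesis using s ttr unfolding dn_def by blast
      qed
      have le_code: "tle le t t'" if lv: "level a t" and eq: "code t = code t'" for t t'
      proof (rule tle.root)
        have "cq (lab t) = cq (lab t')" using eq by (simp add: code_def)
        then show "le (lab t) (lab t')" using cq(2)[of "lab t"] cq(3)[of "lab t'"] tr by metis
        show "\<forall>x\<in>lch t. \<exists>y\<in>lch t'. tle le x y"
          using dom[of _ "lch t" "lch t'"] child[OF lv] eq by (simp add: code_def)
        show "\<forall>x\<in>rch t. \<exists>y\<in>rch t'. tle le x y"
          using dom[of _ "rch t" "rch t'"] child[OF lv] eq by (simp add: code_def)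
      qed
      define pick where "pick k = (SOME t. level a t \<and> code t = k)" for k
      have pick: "level a (pick (code t)) \<and> code (pick (code t)) = code t" if "level a t" for t
        unfolding pick_def by (rule someI[of _ t]) (use that in simp)
      have "countable (pick ` (C \<times> Dn \<times> Dn))" using C(1) cD by auto
      moreover have "\<exists>s\<in>pick ` (C \<times> Dn \<times> Dn). tle le t s \<and> tle le s t" if "level a t" for t
        using pick[OF that] le_code code_in that by (intro bexI[of _ "pick (code t)"]) auto
      ultimately show ?thesis by blast
    qed
  qed
  obtain N :: "nat set \<Rightarrow> 'q tm set" where N: "\<And>a. countable (N a)"
    "\<And>a t. level a t \<Longrightarrow> \<exists>s\<in>N a. tle le t s \<and> tle le s t" using levels by metis
  show ?thesis
  proof (rule that)
    have "|Field aleph1| \<le>o aleph1"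
      using card_of_Field_ordIso[OF aleph1_Card_order] by (simp add: ordIso_iff_ordLeq)
    then show "|\<Union>a\<in>Field aleph1. N a| \<le>o aleph1"
      by (intro card_of_UNION_ordLeq_infinite_Field[OF aleph1_infinite aleph1_Card_order])
         (auto intro: countable_le_aleph1 N)
    fix t :: "'q tm"
    obtain a where a: "level a t" using ex_level by blast
    then have "a \<in> Field aleph1" by (auto elim: level.cases)
    then show "\<exists>s\<in>\<Union>a\<in>Field aleph1. N a. tle le t s \<and> tle le s t" using N(2)[OF a] by blast
  qed
qed

section \<open>The number of classes\<close>

definition cpt :: "real set \<Rightarrow> real set" where
  "cpt V = {- (pi/2), pi/2} \<union> arctan ` V"

lemma cpt_iff: "x \<in> cpt V \<longleftrightarrow> x = - (pi/2) \<or> x = pi/2 \<or> - (pi/2) < x \<and> x < pi/2 \<and> tan x \<in> V"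
proof
  assume "x \<in> cpt V"
  then show "x = - (pi/2) \<or> x = pi/2 \<or> - (pi/2) < x \<and> x < pi/2 \<and> tan x \<in> V"
    using arctan_lbound arctan_ubound by (auto simp: cpt_def tan_arctan)
next
  assume "x = - (pi/2) \<or> x = pi/2 \<or> - (pi/2) < x \<and> x < pi/2 \<and> tan x \<in> V"
  then show "x \<in> cpt V" unfolding cpt_def using arctan_tan[of x] by (auto simp: image_iff) metis
qed

lemma cpt_subset: "cpt V \<subseteq> {- (pi/2)..pi/2}"
proof
  fix x assume "x \<in> cpt V"
  then show "x \<in> {- (pi/2)..pi/2}" 
    using pi_gt_zero unfolding cpt_iff atLeastAtMost_iff by linarith
qed

lemma countable_cpt: "countable V \<Longrightarrow> countable (cpt V)"
  by (simp add: cpt_def)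

lemma closed_cpt:
  assumes "closed V" shows "closed (cpt V)"
proof -
  let ?I = "{- (pi/2)<..<pi/2}"
  have "continuous_on ?I tan"
    by (intro Transcendental.continuous_on_tan continuous_on_id) (use cos_gt_zero_pi in force)
  then have "open (?I \<inter> tan -` (- V))"
    using assms by (intro continuous_open_preimage) auto
  moreover have "cpt V = {- (pi/2)..pi/2} - (?I \<inter> tan -` (- V))"
  proof (intro set_eqI)
    fix x
    have aux: "(y = - p \<or> y = p \<or> - p < y \<and> y < p \<and> T) \<longleftrightarrow>
        (- p \<le> y \<and> y \<le> p) \<and> \<not> ((- p < y \<and> y < p) \<and> \<not> T)" if "- p < p" for p y :: real and T
      using that by auto
    have "- (pi/2) < pi/2" using pi_gt_zero by simp
    then show "x \<in> cpt V \<longleftrightarrow> x \<in> {- (pi/2)..pi/2} - (?I \<inter> tan -` (- V))"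
      unfolding cpt_iff Diff_iff Int_iff vimage_eq Compl_iff atLeastAtMost_iff greaterThanLessThan_iff
      by (rule aux)
  qed
  ultimately show ?thesis by auto
qed

text \<open>The compactification of a closed set: its image under \<open>arctan\<close> together with both end points. The
  end points are added even if \<open>V\<close> is bounded.\<close>

text \<open>The labelling of the compactification; the end points get the label \<open>q\<close>.\<close>

definition cpt_lab :: "'q \<Rightarrow> (real \<rightharpoonup> 'q) \<Rightarrow> real \<Rightarrow> 'q" where
  "cpt_lab q A x = (if - (pi/2) < x \<and> x < pi/2 then the (A (tan x)) else q)"

text \<open>An embedding \<open>h\<close> of compactifications sends inner points strictly between the images of the end points,
  hence to inner points, so that \<open>tan \<circ> h \<circ> arctan\<close> is an embedding of the original sets.\<close>

lemma emb_cpt_imp_cclo_le: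
  assumes le': "\<And>x y. x \<in> Q \<Longrightarrow> y \<in> Q \<Longrightarrow> le' x y \<Longrightarrow> le x y"
    and A: "A \<in> Q_cclos Q" and B: "B \<in> Q_cclos Q"
    and emb: "emb le' (cpt_lab q A) (cpt (dom A)) (cpt_lab q B) (cpt (dom B))"
  shows "cclo_le le A B"
proof -
  obtain h where h: "h ` cpt (dom A) \<subseteq> cpt (dom B)" "strict_mono_on (cpt (dom A)) h"
    "continuous_on (cpt (dom A)) h" "\<forall>x\<in>cpt (dom A). le' (cpt_lab q A x) (cpt_lab q B (h x))"
    using emb unfolding emb_def emb_fun_def by blast
  define g where "g x = tan (h (arctan x))" for x
  have mem: "arctan x \<in> cpt (dom A)" if "x \<in> dom A" for x using that by (simp add: cpt_def)
  have ends: "- (pi/2) \<in> cpt (dom A)" "pi/2 \<in> cpt (dom A)" by (simp_all add: cpt_def)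
  have inside: "- (pi/2) < h (arctan x)" "h (arctan x) < pi/2" "g x \<in> dom B"
    if x: "x \<in> dom A" for x
  proof -
    have "h (- (pi/2)) < h (arctan x)" "h (arctan x) < h (pi/2)"
      using strict_mono_onD[OF h(2) ends(1) mem[OF x]] strict_mono_onD[OF h(2) mem[OF x] ends(2)]
        arctan_lbound[of x] arctan_ubound[of x] by auto
    moreover have hin: "h y \<in> cpt (dom B)" if "y \<in> cpt (dom A)" for y using that h(1) by blast
    then have "- (pi/2) \<le> h (- (pi/2))" "h (pi/2) \<le> pi/2"
      using cpt_subset[of "dom B"] ends by (meson atLeastAtMost_iff subsetD)+
    ultimately show 1: "- (pi/2) < h (arctan x)" "h (arctan x) < pi/2" by linarith+
    show "g x \<in> dom B" using hin[OF mem[OF x]] 1 unfolding cpt_iff g_def by auto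
  qed
  have "smc_embedding g (dom A) (dom B)"
    unfolding smc_embedding_iff_continuous_on
  proof (intro conjI)
    show "g ` dom A \<subseteq> dom B" using inside by blast
    show "strict_mono_on (dom A) g"
    proof (rule strict_mono_onI)
      fix x y assume xy: "x \<in> dom A" "y \<in> dom A" "x < y"
      then have "h (arctan x) < h (arctan y)"
        by (intro strict_mono_onD[OF h(2) mem mem]) (simp_all add: arctan_less_iff)
      then show "g x < g y" unfolding g_def using inside xy by (intro tan_monotone) auto
    qed
    have "continuous_on (dom A) (\<lambda>x. h (arctan x))"
      by (rule continuous_on_compose2[OF h(3)]) (use mem in \<open>auto intro!: continuous_intros\<close>)
    then show "continuous_on (dom A) g"
      unfolding g_def by (rule Transcendental.continuous_on_tan) (use inside cos_gt_zero_pi in force)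
  qed
  moreover have "le (the (A x)) (the (B (g x)))" if x: "x \<in> dom A" for x
  proof -
    have "le' (cpt_lab q A (arctan x)) (cpt_lab q B (h (arctan x)))" using h(4) mem[OF x] by blast
    then have "le' (the (A x)) (the (B (g x)))"
      using inside[OF x] arctan_lbound[of x] arctan_ubound[of x]
      by (simp add: cpt_lab_def g_def tan_arctan)
    moreover have "the (A x) \<in> Q" using A x by (auto simp: Q_cclos_def ran_def)
    moreover have "the (B (g x)) \<in> Q" using B inside(3)[OF x] by (auto simp: Q_cclos_def ran_def)
    ultimately show ?thesis using le' by blast
  qed
  ultimately show ?thesis unfolding cclo_le_def by blast
qed

lemma card_classes_le_aleph1:
  fixes Q :: "'q set" and le :: "'q \<Rightarrow> 'q \<Rightarrow> bool"
  assumes ne: "Q \<noteq> {}" and cQ: "countable Q" and bqo: "bqo_on Q le"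
  shows "|Q_cclos Q // cclo_equiv Q le| \<le>o aleph1"
proof -
  obtain q0 where q0: "q0 \<in> Q" using ne by blast
  have qo: "quasi_order_on Q le" using bqo by (simp add: bqo_on_def)
  \<comment> \<open>The quasi-ordering is extended to the whole type by sending all elements outside \<open>Q\<close> to \<open>q0\<close>. This keeps
  all properties used, and terms may then carry arbitrary labels.\<close>
  define ret where "ret x = (if x \<in> Q then x else q0)" for x
  define le' where "le' x y = le (ret x) (ret y)" for x y
  have retQ: "ret x \<in> Q" for x using q0 by (simp add: ret_def)
  have ret_id: "ret x = x" if "x \<in> Q" for x using that by (simp add: ret_def)
  have refl: "le' x x" for x
    using qo retQ[of x] unfolding le'_def quasi_order_on_def by (auto dest: reflp_onD)
  have tr: "le' x z" if "le' x y" "le' y z" for x y z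
    using qo retQ that unfolding le'_def quasi_order_on_def by (blast dest: transp_onD)
  have nobad: "\<not> bad_array le' A f" for A f
  proof
    assume "bad_array le' A f"
    then have "bad_array le A (\<lambda>X. ret (f X))"
      unfolding bad_array_def le'_def by (auto intro: loc_const_comp)
    then show False using bqo_no_bad_array[OF bqo, of "\<lambda>X. ret (f X)"] retQ by blast
  qed
  have wqo: "\<exists>i j. i < j \<and> tle le' (u i) (u j)" for u :: "nat \<Rightarrow> 'q tm"
    by (rule no_bad_array_imp_wqo[OF tle_no_bad_array[OF nobad]])
  have reps: "\<exists>c\<in>Q. le' q c \<and> le' c q" for q
    using retQ[of q] refl[of q] ret_id[OF retQ[of q]] unfolding le'_def by (intro bexI[of _ "ret q"]) auto
  obtain N :: "'q tm set" where N: "|N| \<le>o aleph1" "\<And>t. \<exists>s\<in>N. tle le' t s \<and> tle le' s t"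
    by (rule tm_classes_le_aleph1[OF refl tr wqo cQ reps]) blast+
  have "\<exists>ts. wrep le' (cpt_lab q0 A) ts (cpt (dom A))" if "A \<in> Q_cclos Q" for A
  proof -
    have V: "countable (dom A)" "closed (dom A)" using that by (auto simp: Q_cclos_def cclo_def)
    have sub: "cpt (dom A) \<inter> {-2..2} = cpt (dom A)"
      using cpt_subset[of "dom A"] pi_half_less_two by fastforce
    have out: "-2 \<notin> cpt (dom A)" "2 \<notin> cpt (dom A)" using cpt_subset[of "dom A"] pi_half_less_two by force+
    have "dec (rep le' (cpt_lab q0 A)) (cpt (dom A)) (-2) 2"
      by (rule decomposition[OF wqo countable_cpt[OF V(1)] closed_cpt[OF V(2)] _ out]) simp
    from dec_wrep[OF this out(2)] show ?thesis unfolding sub .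
  qed
  then obtain w where w: "\<And>A. A \<in> Q_cclos Q \<Longrightarrow> wrep le' (cpt_lab q0 A) (w A) (cpt (dom A))" by metis
  obtain \<rho> where \<rho>: "\<And>t. \<rho> t \<in> N" "\<And>t. tle le' t (\<rho> t)" "\<And>t. tle le' (\<rho> t) t" using N(2) by metis
  have le_of_eq: "cclo_le le A B"
    if AB: "A \<in> Q_cclos Q" "B \<in> Q_cclos Q" and eq: "map \<rho> (w A) = map \<rho> (w B)" for A B
  proof (rule emb_cpt_imp_cclo_le[OF _ AB])
    show "le x y" if "x \<in> Q" "y \<in> Q" "le' x y" for x y using that by (simp add: le'_def ret_id)
    have ttr: "tle le' x z" if "tle le' x y" "tle le' y z" for x y z
      by (rule tle_trans[OF _ that]) (rule tr)
    have "list_all2 (tle le') (w A) (w B)"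
      unfolding list_all2_conv_all_nth
    proof (intro conjI allI impI)
      show len: "length (w A) = length (w B)" using eq by (rule map_eq_imp_length_eq)
      fix i assume "i < length (w A)"
      then have "\<rho> (w A ! i) = \<rho> (w B ! i)" using eq len by (metis nth_map)
      then show "tle le' (w A ! i) (w B ! i)" using \<rho>(2)[of "w A ! i"] \<rho>(3)[of "w B ! i"] ttr by metis
    qed
    then show "emb le' (cpt_lab q0 A) (cpt (dom A)) (cpt_lab q0 B) (cpt (dom B))"
      by (rule wrep_emb[rotated, OF _ w[OF AB(1)] w[OF AB(2)]]) (rule tr)
  qed
  define pick where "pick C = (SOME A. A \<in> C)" for C :: "(real \<rightharpoonup> 'q) set"
  have eqv: "equiv (Q_cclos Q) (cclo_equiv Q le)" by (rule equiv_cclo_equiv[OF qo])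
  have pick: "pick C \<in> C" "pick C \<in> Q_cclos Q" if C: "C \<in> Q_cclos Q // cclo_equiv Q le" for C
  proof -
    show 1: "pick C \<in> C" unfolding pick_def using in_quotient_imp_non_empty[OF eqv C] by (simp add: some_in_eq)
    show "pick C \<in> Q_cclos Q" using 1 in_quotient_imp_subset[OF eqv C] by blast
  qed
  have "inj_on (\<lambda>C. map \<rho> (w (pick C))) (Q_cclos Q // cclo_equiv Q le)"
  proof (rule inj_onI)
    fix C D assume C: "C \<in> Q_cclos Q // cclo_equiv Q le" and D: "D \<in> Q_cclos Q // cclo_equiv Q le"
      and eq: "map \<rho> (w (pick C)) = map \<rho> (w (pick D))"
    have "(pick C, pick D) \<in> cclo_equiv Q le"
      unfolding cclo_equiv_def using pick[OF C] pick[OF D] le_of_eq eq by auto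
    then show "C = D" using quotient_eqI[OF eqv C D] pick[OF C] pick[OF D] by blast
  qed
  moreover have "(\<lambda>C. map \<rho> (w (pick C))) ` (Q_cclos Q // cclo_equiv Q le) \<subseteq> lists N"
    using \<rho>(1) by auto
  ultimately have "|Q_cclos Q // cclo_equiv Q le| \<le>o |lists N|"
    using card_of_ordLeq by blast
  then show ?thesis using lists_le_aleph1[OF N(1)] by (rule ordLeq_transitive)
qed

text \<open>Every nonempty subset has a least element.\<close>

definition well_ordered :: "real set \<Rightarrow> bool" where
  "well_ordered V \<longleftrightarrow> (\<forall>S\<subseteq>V. S \<noteq> {} \<longrightarrow> (\<exists>m\<in>S. \<forall>s\<in>S. m \<le> s))"

text \<open>The map \<open>blk n\<close> transports \<open>[-\<pi>/2, \<pi>/2]\<close> increasingly onto \<open>[n, n + 1]\<close>.\<close>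

definition blk :: "nat \<Rightarrow> real \<Rightarrow> real" where
  "blk n x = real n + 1/2 + x / pi"

lemma blk_mono: "x < y \<Longrightarrow> blk n x < blk n y"
  by (simp add: blk_def divide_strict_right_mono)

lemma blk_mono_le: "x \<le> y \<Longrightarrow> blk n x \<le> blk n y"
  by (simp add: blk_def divide_right_mono)

lemma blk_ends: "blk n (- (pi/2)) = real n" "blk n (pi/2) = real n + 1"
  by (simp_all add: blk_def)

lemma blk_cpt_bounds:
  assumes "x \<in> cpt V" shows "real n \<le> blk n x" "blk n x \<le> real n + 1"
proof -
  have "x \<in> {- (pi/2)..pi/2}" using assms cpt_subset[of V] by blast
  then have "- (pi/2) \<le> x" "x \<le> pi/2" unfolding atLeastAtMost_iff by blast+
  then show "real n \<le> blk n x" "blk n x \<le> real n + 1"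
    using blk_mono_le blk_ends[of n] by metis+
qed

lemma blk_cpt_inner:
  assumes "y = blk n x" "x \<in> cpt V" "y \<noteq> real n" "y \<noteq> real n + 1"
  shows "\<exists>v\<in>V. y = blk n (arctan v)"
proof -
  have "x \<noteq> - (pi/2)" "x \<noteq> pi/2" using assms blk_ends[of n] by metis+
  then show ?thesis using assms(1,2) unfolding cpt_def by blast
qed

text \<open>The compactifications of the sets \<open>V 0, V 1, \<dots>\<close> placed one after another in \<open>[0, \<infinity>)\<close>. The end
  points make this set closed and put every natural number into it.\<close>

definition blk_sum :: "(nat \<Rightarrow> real set) \<Rightarrow> real set" where
  "blk_sum V = (\<Union>n. blk n ` cpt (V n))"

lemma countable_blk_sum: "(\<And>n. countable (V n)) \<Longrightarrow> countable (blk_sum V)"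
  unfolding blk_sum_def by (intro countable_UN countable_image countable_cpt) auto

lemma closed_blk_sum:
  assumes cl: "\<And>n. closed (V n)"
  shows "closed (blk_sum V)"
proof -
  have B: "closed (blk n ` cpt (V n))" for n
  proof -
    have "compact (cpt (V n))"
      using closed_cpt[OF cl] cpt_subset by (meson compact_Icc compact_eq_bounded_closed bounded_subset)
    moreover have "continuous_on (cpt (V n)) (blk n)"
      unfolding blk_def by (intro continuous_intros) auto
    ultimately show ?thesis by (meson compact_continuous_image compact_imp_closed)
  qed
  have "open (- blk_sum V)"
    unfolding open_subopen[of "- blk_sum V"]
  proof
    fix y assume y: "y \<in> - blk_sum V"
    obtain M :: nat where M: "y < real M" using reals_Archimedean2 by blast
    let ?U = "{..<real M} - (\<Union>n<M. blk n ` cpt (V n))"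
    have "open ?U" using B by (intro open_Diff closed_UN) auto
    moreover have "y \<in> ?U" using y M by (auto simp: blk_sum_def)
    moreover have "?U \<subseteq> - blk_sum V"
    proof
      fix z assume z: "z \<in> ?U"
      have "z \<notin> blk n ` cpt (V n)" for n
      proof (cases "n < M")
        case False
        then have "real M \<le> real n" by simp
        then show ?thesis using z blk_cpt_bounds(1)[of _ "V n" n] by force
      qed (use z in auto)
      then show "z \<in> - blk_sum V" by (auto simp: blk_sum_def)
    qed
    ultimately show "\<exists>T. open T \<and> y \<in> T \<and> T \<subseteq> - blk_sum V" by blast
  qed
  then show ?thesis by (simp add: closed_def)
qed

lemma blk_sum_nat: "real n \<in> blk_sum V"
proof -
  have "- (pi/2) \<in> cpt (V n)" by (simp add: cpt_def)
  then show ?thesis using blk_ends(1)[of n] unfolding blk_sum_def by (metis UNIV_I UN_I imageI)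
qed

lemma well_ordered_blk_sum:
  assumes wo: "\<And>n. well_ordered (V n)"
  shows "well_ordered (blk_sum V)"
  unfolding well_ordered_def
proof (intro allI impI)
  fix S assume S: "S \<subseteq> blk_sum V" "S \<noteq> {}"
  have ex: "\<exists>n s. s \<in> S \<and> s \<le> real n" using S(2) real_arch_simple by blast
  define n where "n = (LEAST n. \<exists>s\<in>S. s \<le> real n)"
  have n: "\<exists>s\<in>S. s \<le> real n" unfolding n_def by (rule LeastI_ex) (use ex in blast)
  have min: "real k < s" if "k < n" "s \<in> S" for k s
    using not_less_Least[of k "\<lambda>n. \<exists>s\<in>S. s \<le> real n"] that unfolding n_def by force
  have nonneg: "0 \<le> s" if s: "s \<in> S" for s
  proof -
    obtain k x where "s = blk k x" "x \<in> cpt (V k)" using s S(1) by (auto simp: blk_sum_def)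
    then show ?thesis using blk_cpt_bounds(1)[of x "V k" k] by simp
  qed
  show "\<exists>m\<in>S. \<forall>s\<in>S. m \<le> s"
  proof (cases n)
    case 0
    then obtain s where "s \<in> S" "s \<le> 0" using n by auto
    then show ?thesis using nonneg by (meson order_trans)
  next
    case (Suc k)
    define T where "T = {v\<in>V k. blk k (arctan v) \<in> S}"
    have inner: "\<exists>v\<in>T. s = blk k (arctan v)" if s: "s \<in> S" "s < real n" for s
    proof -
      obtain j x where jx: "s = blk j x" "x \<in> cpt (V j)" using s S(1) by (auto simp: blk_sum_def)
      have b: "real j \<le> s" "s \<le> real j + 1" using jx blk_cpt_bounds by auto
      have ks: "real k < s" using min[of k s] Suc s by simp
      have "real k < real j + 1" "real j < real k + 1" using b ks s(2) Suc by simp_all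
      then have "j = k" by linarith
      then obtain v where "v \<in> V k" "s = blk k (arctan v)"
        using blk_cpt_inner[OF jx] ks s(2) Suc by auto
      then show ?thesis using s by (auto simp: T_def)
    qed
    show ?thesis
    proof (cases "T = {}")
      case True
      then have "\<not> s < real n" if "s \<in> S" for s using inner that by blast
      then show ?thesis using n by (meson le_less_linear order_trans)
    next
      case False
      have "T \<subseteq> V k" by (auto simp: T_def)
      then have "\<exists>m\<in>T. \<forall>v\<in>T. m \<le> v"
        using wo[of k, unfolded well_ordered_def, THEN spec[of _ T]] False by simp
      then obtain m where m: "m \<in> T" "\<And>v. v \<in> T \<Longrightarrow> m \<le> v" by auto
      have bm: "blk k (arctan m) \<le> real n"
      proof -
        have "arctan m \<in> cpt (V k)" using m(1) by (auto simp: T_def cpt_def)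
        then show ?thesis using blk_cpt_bounds(2)[of "arctan m" "V k" k] Suc by simp
      qed
      have "blk k (arctan m) \<le> s" if s: "s \<in> S" for s
      proof (cases "s < real n")
        case True
        then obtain v where v: "v \<in> T" "s = blk k (arctan v)" using inner[OF s] by blast
        show ?thesis
        proof (cases "m = v")
          case False
          then have "arctan m < arctan v" using m(2)[OF v(1)] by (simp add: arctan_less_iff)
          then show ?thesis using blk_mono[of _ _ k] v by fastforce
        qed (use v in simp)
      qed (use bm in simp)
      then show ?thesis using m(1) by (auto simp: T_def)
    qed
  qed
qed

text \<open>Composed with the copy of \<open>V n\<close> inside the sum, an embedding of the sum into \<open>V n\<close> would be a
  strictly increasing self-map \<open>k\<close> of a well-ordered set with \<open>k (n + 1) < n + 1\<close>; the least point that is moved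
  down would then be mapped to a smaller such point.\<close>

lemma blk_sum_not_emb:
  assumes wo: "\<And>n. well_ordered (V n)"
  shows "\<not> (h ` blk_sum V \<subseteq> V n \<and> strict_mono_on (blk_sum V) h)"
proof
  assume h: "h ` blk_sum V \<subseteq> V n \<and> strict_mono_on (blk_sum V) h"
  define k where "k y = blk n (arctan (h y))" for y
  have k_in: "k y \<in> blk_sum V" if "y \<in> blk_sum V" for y
  proof -
    have "arctan (h y) \<in> cpt (V n)" using h that by (auto simp: cpt_def)
    then show ?thesis unfolding k_def blk_sum_def by (intro UN_I[of n] imageI) simp_all
  qed
  have k_mono: "k y < k z" if "y \<in> blk_sum V" "z \<in> blk_sum V" "y < z" for y z
  proof -
    have "h y < h z" using strict_mono_onD[of "blk_sum V" h y z] h that by simp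
    then show ?thesis unfolding k_def by (intro blk_mono) (simp add: arctan_less_iff)
  qed
  define S where "S = {y\<in>blk_sum V. k y < y}"
  have "k (real (Suc n)) < real (Suc n)"
    using blk_mono[OF arctan_ubound, of n "h (real (Suc n))"] blk_ends(2)[of n] by (simp add: k_def)
  then have "S \<noteq> {}" using blk_sum_nat[of "Suc n" V] by (auto simp: S_def)
  moreover have "S \<subseteq> blk_sum V" by (auto simp: S_def)
  ultimately have "\<exists>m\<in>S. \<forall>s\<in>S. m \<le> s"
    using well_ordered_blk_sum[OF wo, unfolded well_ordered_def, THEN spec[of _ S]] by simp
  then obtain m where m: "m \<in> S" "\<And>s. s \<in> S \<Longrightarrow> m \<le> s" by auto
  have "k m \<in> S" using m(1) k_in k_mono by (auto simp: S_def)
  then show False using m by (force simp: S_def)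
qed

text \<open>If there were only countably many classes, then countably many well-ordered sets \<open>V n\<close> would
  represent all classes of constantly labelled well-ordered sets, including that of their sum.\<close>

lemma uncountable_classes:
  fixes Q :: "'q set"
  assumes ne: "Q \<noteq> {}" and qo: "quasi_order_on Q le"
  shows "\<not> countable (Q_cclos Q // cclo_equiv Q le)"
proof
  assume cnt: "countable (Q_cclos Q // cclo_equiv Q le)"
  obtain q0 where q0: "q0 \<in> Q" using ne by blast
  have eqv: "equiv (Q_cclos Q) (cclo_equiv Q le)" by (rule equiv_cclo_equiv[OF qo])
  define L where "L V = (\<lambda>x. if x \<in> V then Some q0 else None)" for V :: "real set"
  have dom_L: "dom (L V) = V" for V by (auto simp: L_def dom_def)
  define W where "W = {V. closed V \<and> countable V \<and> well_ordered V}"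
  have L_in: "L V \<in> Q_cclos Q" if "V \<in> W" for V
  proof -
    have "ran (L V) \<subseteq> Q" using q0 by (auto simp: ran_def L_def split: if_splits)
    then show ?thesis using that by (simp add: Q_cclos_def dom_L cclo_def W_def)
  qed
  define cl where "cl V = cclo_equiv Q le `` {L V}" for V
  have "cl ` W \<subseteq> Q_cclos Q // cclo_equiv Q le"
    using L_in by (auto simp: cl_def intro: quotientI)
  then have "countable (cl ` W)" using cnt countable_subset by blast
  then obtain W0 where W0: "W0 \<subseteq> W" "countable W0" "cl ` W = cl ` W0"
    using countable_subset_image[of "cl ` W" cl W] by blast
  have "{} \<in> W" by (simp add: W_def well_ordered_def)
  then have "W0 \<noteq> {}" using W0(3) by blast
  define V where "V = from_nat_into W0"
  have VW: "V n \<in> W" for n using W0(1) from_nat_into[OF \<open>W0 \<noteq> {}\<close>] by (auto simp: V_def)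
  then have wo: "well_ordered (V n)" for n by (auto simp: W_def)
  have "blk_sum V \<in> W"
    using VW countable_blk_sum[of V] closed_blk_sum[of V] well_ordered_blk_sum[of V] by (auto simp: W_def)
  then obtain n where n: "cl (blk_sum V) = cl (V n)"
    using W0(3) from_nat_into_surj[OF W0(2)] unfolding V_def by (metis imageE imageI)
  have "(L (blk_sum V), L (V n)) \<in> cclo_equiv Q le"
    using n L_in[OF \<open>blk_sum V \<in> W\<close>] L_in[OF VW] eq_equiv_class_iff[OF eqv] unfolding cl_def by blast
  then have "cclo_le le (L (blk_sum V)) (L (V n))" by (simp add: cclo_equiv_def)
  then obtain h where "smc_embedding h (blk_sum V) (V n)" unfolding cclo_le_def dom_L by blast
  then show False using blk_sum_not_emb[where V = V and h = h and n = n, OF wo] by (auto simp: smc_embedding_def)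
qed

theorem corollary27:
  fixes Q :: "'q set" and le :: "'q \<Rightarrow> 'q \<Rightarrow> bool"
  assumes "Q \<noteq> {}" and "countable Q" and "bqo_on Q le"
  shows "|Q_cclos Q // cclo_equiv Q le| =o cardSuc natLeq"
  unfolding ordIso_iff_ordLeq
proof
  show "|Q_cclos Q // cclo_equiv Q le| \<le>o aleph1" by (rule card_classes_le_aleph1[OF assms])
  have "quasi_order_on Q le" using assms(3) by (simp add: bqo_on_def)
  then show "aleph1 \<le>o |Q_cclos Q // cclo_equiv Q le|"
    using uncountable_ge_aleph1 uncountable_classes[OF assms(1)] by blast
qed

end
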